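(* Let $\pi:Y\to X$ be a smooth fiber bundle. Relative to the coordinate atlas $\{(x^\lambda,y^i_\Lambda)\}$ of $J^\infty Y$ induced by a fixed finite bundle coordinate atlas of $Y$, a derivation $\upsilon\in\mathfrak d\mathcal O^0_\infty$ of the $\mathbb R$-ring $\mathcal O^0_\infty$ is given by the expression $$\upsilon=\upsilon^\lambda\partial_\lambda+\upsilon^i\partial_i+\sum_{|\Lambda|>0}\upsilon^i_\Lambda\partial^\Lambda_i,$$ where $\upsilon^\lambda$, $\upsilon^i$, $\upsilon^i_\Lambda$ are local smooth functions of finite jet order obeying the transformation law $$\upsilon'^\lambda=\frac{\partial x'^\lambda}{\partial x^\mu}\upsilon^\mu,\qquad \upsilon'^i=\frac{\partial y'^i}{\partial y^j}\upsilon^j+\frac{\partial y'^i}{\partial x^\mu}\upsilon^\mu,\qquad \upsilon'^i_\Lambda=\sum_{|\Sigma|\le|\Lambda|}\frac{\partial y'^i_\Lambda}{\partial y^j_\Sigma}\upsilon^j_\Sigma+\frac{\partial y'^i_\Lambda}{\partial x^\mu}\upsilon^\mu .$$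
   Context: Manifolds are smooth, real, finite-dimensional, Hausdorff, second-countable and connected. $J^rY$ is the $r$-order jet manifold of sections of $Y\to X$ ($J^0Y=Y$), $J^\infty Y$ is the projective limit of the $J^rY$, and $\mathcal O^*_\infty$ is the direct limit of the graded differential algebras of exterior forms on $J^rY$ with respect to pull-back monomorphisms (all exterior forms on finite order jet manifolds modulo pull-back identification); $\mathcal O^0_\infty$ is its ring of degree-zero elements. A bundle coordinate atlas $\{(U_Y;x^\lambda,y^i)\}$ of $Y$ is fixed which contains a finite number of charts (the $U_Y$ need not be connected). It yields the atlas $\{((\pi^\infty_0)^{-1}(U_Y);x^\lambda,y^i_\Lambda)\}$, $0\le|\Lambda|$, of $J^\infty Y$, where $\Lambda=(\lambda_k\ldots\lambda_1)$ is a symmetric multi-index of length $|\Lambda|=k$, $\lambda+\Lambda=(\lambda\lambda_k\ldots\lambda_1)$, and $\pi^\infty_0:J^\infty Y\to Y$ is the natural projection, with transition functions $y'^i_{\lambda+\Lambda}=\frac{\partial x^\mu}{\partial x'^\lambda}d_\mu y'^i_\Lambda$, $d_\lambda=\partial_\lambda+\sum_{|\Lambda|\ge0}y^i_{\lambda+\Lambda}\partial_i^\Lambda$. Here $\partial_\lambda=\partial/\partial x^\lambda$, $\partial_i=\partial/\partial y^i$, $\partial_i^\Lambda=\partial/\partial y^i_\Lambda$; summation over repeated indices is understood. $\mathfrak d\mathcal O^0_\infty$ is the module of $\mathbb R$-linear derivations of $\mathcal O^0_\infty$. *)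

theory Defs
  imports "HOL-Analysis.Analysis" "HOL-Library.Multiset"
begin

section \<open>Smooth functions on open subsets of coordinate spaces\<close>

text \<open>
  For a finite index set \<open>K\<close> the coordinate space \<open>\<real>\<^sup>K\<close> is the library's
  \<open>powertop_real K\<close>, whose points are the functions in \<open>PiE K (\<lambda>_. UNIV)\<close>. Index sets are
  explicit because the dimension of the r-th jet manifold depends on the bound variable r.
\<close>

definition partial :: "'k \<Rightarrow> (('k \<Rightarrow> real) \<Rightarrow> real) \<Rightarrow> ('k \<Rightarrow> real) \<Rightarrow> real" where
  "partial k F p = deriv (\<lambda>t. F (p(k := t))) (p k)"

primrec iter_partial :: "'k list \<Rightarrow> (('k \<Rightarrow> real) \<Rightarrow> real) \<Rightarrow> ('k \<Rightarrow> real) \<Rightarrow> real" where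
  "iter_partial [] F = F"
| "iter_partial (k # ks) F = partial k (iter_partial ks F)"

text \<open>
  \<open>C\<^sup>\<infinity>\<close>: all iterated partial derivatives exist and are continuous on \<open>S\<close>. It is only applied
  to open subsets \<open>S\<close> of \<open>\<real>\<^sup>K\<close>, so that the partial derivatives at a point of \<open>S\<close> do not
  depend on the values of \<open>F\<close> outside \<open>S\<close>.
\<close>

definition smooth_on :: "'k set \<Rightarrow> ('k \<Rightarrow> real) set \<Rightarrow> (('k \<Rightarrow> real) \<Rightarrow> real) \<Rightarrow> bool" where
  "smooth_on K S F \<longleftrightarrow>
     (\<forall>ks \<in> lists K.
        continuous_map (subtopology (powertop_real K) S) euclideanreal (iter_partial ks F) \<and>
        (\<forall>k \<in> K. \<forall>p \<in> S. (\<lambda>t. iter_partial ks F (p(k := t))) differentiable (at (p k))))"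


section \<open>Manifolds\<close>

text \<open>A chart is a domain together with a coordinate map.\<close>

type_synonym ('a, 'k) chart = "'a set \<times> ('a \<Rightarrow> 'k \<Rightarrow> real)"

abbreviation cdom :: "('a, 'k) chart \<Rightarrow> 'a set" where "cdom c \<equiv> fst c"
abbreviation cmap :: "('a, 'k) chart \<Rightarrow> 'a \<Rightarrow> 'k \<Rightarrow> real" where "cmap c \<equiv> snd c"

definition in_chart :: "('a, 'k) chart \<Rightarrow> ('a \<Rightarrow> real) \<Rightarrow> ('k \<Rightarrow> real) \<Rightarrow> real" where
  "in_chart c f = (\<lambda>p. f (inv_into (cdom c) (cmap c) p))"

definition chart_partial :: "('a, 'k) chart \<Rightarrow> 'k \<Rightarrow> ('a \<Rightarrow> real) \<Rightarrow> 'a \<Rightarrow> real" where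
  "chart_partial c k f a = partial k (in_chart c f) (cmap c a)"

text \<open>Smoothness of a real function on an open subset \<open>W\<close>, tested in all charts of \<open>A\<close>.\<close>

definition smooth_fun ::
    "('a, 'k) chart set \<Rightarrow> 'k set \<Rightarrow> 'a set \<Rightarrow> ('a \<Rightarrow> real) \<Rightarrow> bool" where
  "smooth_fun A K W f \<longleftrightarrow> (\<forall>c \<in> A. smooth_on K (cmap c ` (cdom c \<inter> W)) (in_chart c f))"

definition top_chart :: "'a topology \<Rightarrow> nat \<Rightarrow> ('a, nat) chart \<Rightarrow> bool" where
  "top_chart T n c \<longleftrightarrow>
     openin T (cdom c) \<and> openin (powertop_real {..<n}) (cmap c ` cdom c) \<and>
     homeomorphic_map (subtopology T (cdom c))
       (subtopology (powertop_real {..<n}) (cmap c ` cdom c)) (cmap c)"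

definition compatible :: "nat \<Rightarrow> ('a, nat) chart \<Rightarrow> ('a, nat) chart \<Rightarrow> bool" where
  "compatible n c c' \<longleftrightarrow>
     (\<forall>k<n. smooth_fun {c} {..<n} (cdom c') (\<lambda>a. cmap c' a k)) \<and>
     (\<forall>k<n. smooth_fun {c'} {..<n} (cdom c) (\<lambda>a. cmap c a k))"

record 'a manifold =
  mtop :: "'a topology"
  mdim :: nat
  matlas :: "('a, nat) chart set"

definition smooth_structure :: "'a manifold \<Rightarrow> bool" where
  "smooth_structure M \<longleftrightarrow>
     Hausdorff_space (mtop M) \<and> second_countable (mtop M) \<and>
     (\<forall>c \<in> matlas M. top_chart (mtop M) (mdim M) c) \<and>
     (\<forall>c \<in> matlas M. \<forall>c' \<in> matlas M. compatible (mdim M) c c') \<and>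
     (\<Union>c \<in> matlas M. cdom c) = topspace (mtop M)"

definition smooth_manifold :: "'a manifold \<Rightarrow> bool" where
  "smooth_manifold M \<longleftrightarrow> smooth_structure M \<and> connected_space (mtop M)"

text \<open>The charts of the maximal atlas.\<close>

definition manifold_chart :: "'a manifold \<Rightarrow> ('a, nat) chart \<Rightarrow> bool" where
  "manifold_chart M c \<longleftrightarrow>
     top_chart (mtop M) (mdim M) c \<and> (\<forall>c' \<in> matlas M. compatible (mdim M) c c')"

definition smooth_map :: "'a manifold \<Rightarrow> 'a set \<Rightarrow> 'b manifold \<Rightarrow> ('a \<Rightarrow> 'b) \<Rightarrow> bool" where
  "smooth_map M W N f \<longleftrightarrow>
     continuous_map (subtopology (mtop M) W) (mtop N) f \<and>
     (\<forall>d \<in> matlas N. \<forall>k < mdim N.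
        smooth_fun (matlas M) {..<mdim M} {a \<in> W. f a \<in> cdom d} (\<lambda>a. cmap d (f a) k))"

definition diffeo ::
    "'a manifold \<Rightarrow> 'a set \<Rightarrow> 'b manifold \<Rightarrow> 'b set \<Rightarrow> ('a \<Rightarrow> 'b) \<Rightarrow> bool" where
  "diffeo M W N W' f \<longleftrightarrow>
     bij_betw f W W' \<and> smooth_map M W N f \<and> smooth_map N W' M (inv_into W f)"

definition append_coords :: "nat \<Rightarrow> nat \<Rightarrow> (nat \<Rightarrow> real) \<Rightarrow> (nat \<Rightarrow> real) \<Rightarrow> nat \<Rightarrow> real" where
  "append_coords n m p q = (\<lambda>k \<in> {..<n + m}. if k < n then p k else q (k - n))"

definition prod_manifold :: "'a manifold \<Rightarrow> 'b manifold \<Rightarrow> ('a \<times> 'b) manifold" where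
  "prod_manifold M N =
     \<lparr> mtop = prod_topology (mtop M) (mtop N),
       mdim = mdim M + mdim N,
       matlas = {(cdom c \<times> cdom d,
                  \<lambda>(a, b). append_coords (mdim M) (mdim N) (cmap c a) (cmap d b)) | c d.
                 c \<in> matlas M \<and> d \<in> matlas N} \<rparr>"


section \<open>Fiber bundles and bundle coordinates\<close>

record ('x, 'y) fibration =
  base_mfd :: "'x manifold"
  total_mfd :: "'y manifold"
  proj :: "'y \<Rightarrow> 'x"

abbreviation base_dim :: "('x, 'y) fibration \<Rightarrow> nat" where
  "base_dim Y \<equiv> mdim (base_mfd Y)"

abbreviation base_space :: "('x, 'y) fibration \<Rightarrow> 'x set" where
  "base_space Y \<equiv> topspace (mtop (base_mfd Y))"

abbreviation total_space :: "('x, 'y) fibration \<Rightarrow> 'y set" where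
  "total_space Y \<equiv> topspace (mtop (total_mfd Y))"

definition fib_dim :: "('x, 'y) fibration \<Rightarrow> nat" where
  "fib_dim Y = mdim (total_mfd Y) - mdim (base_mfd Y)"

text \<open>
  \<open>V\<close> is the typical fiber. Base and total space are connected; the typical fiber may be
  disconnected, so that for instance coverings are included.
\<close>

definition fiber_bundle :: "('x, 'y) fibration \<Rightarrow> 'v manifold \<Rightarrow> bool" where
  "fiber_bundle Y V \<longleftrightarrow>
     smooth_manifold (base_mfd Y) \<and> smooth_manifold (total_mfd Y) \<and> smooth_structure V \<and>
     mdim (total_mfd Y) = mdim (base_mfd Y) + mdim V \<and>
     smooth_map (total_mfd Y) (total_space Y) (base_mfd Y) (proj Y) \<and>
     proj Y ` total_space Y = base_space Y \<and>
     (\<forall>x \<in> base_space Y. \<exists>W \<psi>.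
        openin (mtop (base_mfd Y)) W \<and> x \<in> W \<and>
        diffeo (total_mfd Y) {y \<in> total_space Y. proj Y y \<in> W}
          (prod_manifold (base_mfd Y) V) (W \<times> topspace (mtop V))
          (\<lambda>y. (proj Y y, \<psi> y)))"

text \<open>
  A bundle coordinate chart \<open>(U\<^sub>Y; x\<^sup>\<lambda>, y\<^sup>i)\<close>: the \<open>x\<^sup>\<lambda>\<close> are pulled back from a chart of the
  base whose domain contains the projection of \<open>U\<^sub>Y\<close>.
\<close>

record ('x, 'y) bundle_chart =
  bdom :: "'y set"
  bbase :: "('x, nat) chart"
  bfib :: "'y \<Rightarrow> nat \<Rightarrow> real"

definition total_chart :: "('x, 'y) fibration \<Rightarrow> ('x, 'y) bundle_chart \<Rightarrow> ('y, nat) chart" where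
  "total_chart Y c =
     (bdom c, \<lambda>y. append_coords (base_dim Y) (fib_dim Y) (cmap (bbase c) (proj Y y)) (bfib c y))"

definition is_bundle_chart :: "('x, 'y) fibration \<Rightarrow> ('x, 'y) bundle_chart \<Rightarrow> bool" where
  "is_bundle_chart Y c \<longleftrightarrow>
     manifold_chart (base_mfd Y) (bbase c) \<and> proj Y ` bdom c \<subseteq> cdom (bbase c) \<and>
     manifold_chart (total_mfd Y) (total_chart Y c)"

definition bundle_atlas :: "('x, 'y) fibration \<Rightarrow> ('x, 'y) bundle_chart set \<Rightarrow> bool" where
  "bundle_atlas Y A \<longleftrightarrow> (\<forall>c \<in> A. is_bundle_chart Y c) \<and> (\<Union>c \<in> A. bdom c) = total_space Y"


section \<open>Jets\<close>

text \<open>A local section \<open>s\<close> near \<open>x\<close> is represented by a total function; only its germ at \<open>x\<close> matters.\<close>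

type_synonym ('x, 'y) pointed_section = "'x \<times> ('x \<Rightarrow> 'y)"
type_synonym ('x, 'y) jet = "('x, 'y) pointed_section set"

definition pointed_sections :: "('x, 'y) fibration \<Rightarrow> ('x, 'y) pointed_section set" where
  "pointed_sections Y =
     {(x, s). \<exists>W. openin (mtop (base_mfd Y)) W \<and> x \<in> W \<and> smooth_map (base_mfd Y) W (total_mfd Y) s \<and>
                 (\<forall>x' \<in> W. proj Y (s x') = x')}"

text \<open>
  Symmetric multi-indices are multisets of base indices. Iterated partial derivatives of smooth
  functions commute, so differentiating along the sorted list is only a choice of order.
\<close>

definition multi_indices :: "nat \<Rightarrow> nat multiset set" where
  "multi_indices n = {\<Lambda>. set_mset \<Lambda> \<subseteq> {..<n}}"

definition section_deriv ::
    "('x, 'y) bundle_chart \<Rightarrow> nat \<Rightarrow> nat multiset \<Rightarrow> ('x, 'y) pointed_section \<Rightarrow> real" where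
  "section_deriv c i \<Lambda> q =
     iter_partial (sorted_list_of_multiset \<Lambda>)
       (in_chart (bbase c) (\<lambda>x. bfib c (snd q x) i)) (cmap (bbase c) (fst q))"

definition jet_rel :: "('x, 'y) fibration \<Rightarrow> nat \<Rightarrow> ('x, 'y) pointed_section rel" where
  "jet_rel Y r =
     {(q, q'). q \<in> pointed_sections Y \<and> q' \<in> pointed_sections Y \<and>
        fst q = fst q' \<and> snd q (fst q) = snd q' (fst q') \<and>
        (\<forall>c. is_bundle_chart Y c \<and> snd q (fst q) \<in> bdom c \<longrightarrow>
           (\<forall>i < fib_dim Y. \<forall>\<Lambda> \<in> multi_indices (base_dim Y). size \<Lambda> \<le> r \<longrightarrow>
              section_deriv c i \<Lambda> q = section_deriv c i \<Lambda> q'))}"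

definition jets :: "('x, 'y) fibration \<Rightarrow> nat \<Rightarrow> ('x, 'y) jet set" where
  "jets Y r = pointed_sections Y // jet_rel Y r"

text \<open>The projection of \<open>J\<^sup>kY\<close> onto \<open>J\<^sup>rY\<close> for \<open>k \<ge> r\<close>.\<close>

definition jet_proj :: "('x, 'y) fibration \<Rightarrow> nat \<Rightarrow> ('x, 'y) jet \<Rightarrow> ('x, 'y) jet" where
  "jet_proj Y r j = jet_rel Y r `` j"

text \<open>
  The value \<open>s(x)\<close> of a jet, i.e. its projection to \<open>Y\<close>. It identifies \<open>J\<^sup>0Y\<close> (the classes of
  sections with the same value at the same point) with \<open>Y\<close>.
\<close>

definition jet_value :: "('x, 'y) jet \<Rightarrow> 'y" where
  "jet_value j = (let q = SOME q. q \<in> j in snd q (fst q))"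

definition jets_over :: "('x, 'y) fibration \<Rightarrow> nat \<Rightarrow> 'y set \<Rightarrow> ('x, 'y) jet set" where
  "jets_over Y r U = {j \<in> jets Y r. jet_value j \<in> U}"

text \<open>\<open>Bas \<lambda>\<close> labels the coordinate \<open>x\<^sup>\<lambda>\<close> and \<open>Fib i \<Lambda>\<close> the coordinate \<open>y\<^sup>i\<^sub>\<Lambda>\<close>; \<open>y\<^sup>i\<close> is \<open>Fib i {#}\<close>.\<close>

datatype jet_index = Bas nat | Fib nat "nat multiset"

definition jet_indices :: "('x, 'y) fibration \<Rightarrow> nat \<Rightarrow> jet_index set" where
  "jet_indices Y r =
     Bas ` {..<base_dim Y} \<union>
     {Fib i \<Lambda> | i \<Lambda>. i < fib_dim Y \<and> \<Lambda> \<in> multi_indices (base_dim Y) \<and> size \<Lambda> \<le> r}"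

definition jet_coord :: "('x, 'y) bundle_chart \<Rightarrow> ('x, 'y) jet \<Rightarrow> jet_index \<Rightarrow> real" where
  "jet_coord c j k =
     (let q = SOME q. q \<in> j in
      case k of Bas l \<Rightarrow> cmap (bbase c) (fst q) l | Fib i \<Lambda> \<Rightarrow> section_deriv c i \<Lambda> q)"

definition jet_chart ::
    "('x, 'y) fibration \<Rightarrow> nat \<Rightarrow> ('x, 'y) bundle_chart \<Rightarrow> (('x, 'y) jet, jet_index) chart" where
  "jet_chart Y r c = (jets_over Y r (bdom c), \<lambda>j. restrict (jet_coord c j) (jet_indices Y r))"

definition jet_atlas :: "('x, 'y) fibration \<Rightarrow> nat \<Rightarrow> (('x, 'y) jet, jet_index) chart set" where
  "jet_atlas Y r = {jet_chart Y r c | c. is_bundle_chart Y c}"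


section \<open>The infinite order jet space and its functions of finite jet order\<close>

type_synonym ('x, 'y) inf_jet = "nat \<Rightarrow> ('x, 'y) jet"

text \<open>The projective limit of the \<open>J\<^sup>rY\<close>; its projection onto \<open>J\<^sup>rY\<close> is \<open>\<lambda>z. z r\<close>.\<close>

definition inf_jets :: "('x, 'y) fibration \<Rightarrow> ('x, 'y) inf_jet set" where
  "inf_jets Y = {z. \<forall>r. z r \<in> jets Y r \<and> jet_proj Y r (z (Suc r)) = z r}"

definition inf_jets_over :: "('x, 'y) fibration \<Rightarrow> 'y set \<Rightarrow> ('x, 'y) inf_jet set" where
  "inf_jets_over Y U = {z \<in> inf_jets Y. jet_value (z 0) \<in> U}"

definition inf_jet_indices :: "('x, 'y) fibration \<Rightarrow> jet_index set" where
  "inf_jet_indices Y = (\<Union>r. jet_indices Y r)"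

definition inf_jet_coord :: "('x, 'y) bundle_chart \<Rightarrow> ('x, 'y) inf_jet \<Rightarrow> jet_index \<Rightarrow> real" where
  "inf_jet_coord c z k =
     (case k of Bas l \<Rightarrow> jet_coord c (z 0) k | Fib i \<Lambda> \<Rightarrow> jet_coord c (z (size \<Lambda>)) k)"

definition inf_jet_chart ::
    "('x, 'y) fibration \<Rightarrow> ('x, 'y) bundle_chart \<Rightarrow> (('x, 'y) inf_jet, jet_index) chart" where
  "inf_jet_chart Y c =
     (inf_jets_over Y (bdom c), \<lambda>z. restrict (inf_jet_coord c z) (inf_jet_indices Y))"

text \<open>
  Smooth functions of finite jet order on the preimage of an open subset \<open>U\<close> of \<open>Y\<close> in
  \<open>J\<^sup>\<infinity>Y\<close>: the pull-backs of smooth functions on the preimage of \<open>U\<close> in some \<open>J\<^sup>rY\<close>. As usual in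
  HOL they are total functions, normalised to vanish off their domain.

  The projections of \<open>J\<^sup>\<infinity>Y\<close> onto the \<open>J\<^sup>rY\<close> are surjective (lemma \<open>inf_jets_surj\<close> below), so
  two functions on finite order jet manifolds have the same pull-back to \<open>J\<^sup>\<infinity>Y\<close> iff their
  pull-backs to some (equivalently, every) common jet manifold agree. The direct limit
  \<open>\<O>\<^sup>0\<^sub>\<infinity>\<close> of the rings of functions on the \<open>J\<^sup>rY\<close> is thus the ring \<open>fin_order_ring\<close> with
  pointwise operations.
\<close>

definition fin_order_functions :: "('x, 'y) fibration \<Rightarrow> 'y set \<Rightarrow> (('x, 'y) inf_jet \<Rightarrow> real) set" where
  "fin_order_functions Y U =
     {f. (\<forall>z. z \<notin> inf_jets_over Y U \<longrightarrow> f z = 0) \<and>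
         (\<exists>r g. smooth_fun (jet_atlas Y r) (jet_indices Y r) (jets_over Y r U) g \<and>
                (\<forall>z \<in> inf_jets_over Y U. f z = g (z r)))}"

definition fin_order_ring :: "('x, 'y) fibration \<Rightarrow> (('x, 'y) inf_jet \<Rightarrow> real) set" where
  "fin_order_ring Y = fin_order_functions Y (total_space Y)"

lemma jet_rel_equiv: "equiv (pointed_sections Y) (jet_rel Y r)"
proof (rule equivI)
  show "sym (jet_rel Y r)"
  proof (rule symI)
    fix a b assume "(a, b) \<in> jet_rel Y r"
    then show "(b, a) \<in> jet_rel Y r"
      unfolding jet_rel_def mem_Collect_eq case_prod_conv by metis
  qed
  show "trans (jet_rel Y r)"
  proof (rule transI)
    fix a b d assume "(a, b) \<in> jet_rel Y r" "(b, d) \<in> jet_rel Y r"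
    then show "(a, d) \<in> jet_rel Y r"
      unfolding jet_rel_def mem_Collect_eq case_prod_conv by metis
  qed
  show "jet_rel Y r \<subseteq> pointed_sections Y \<times> pointed_sections Y"
    unfolding jet_rel_def by blast
  show "refl_on (pointed_sections Y) (jet_rel Y r)"
    unfolding refl_on_def jet_rel_def by blast
qed

lemma jet_rel_mono:
  assumes "r \<le> k" shows "jet_rel Y k \<subseteq> jet_rel Y r"
proof (rule subrelI)
  fix a b assume "(a, b) \<in> jet_rel Y k"
  then show "(a, b) \<in> jet_rel Y r"
    unfolding jet_rel_def mem_Collect_eq case_prod_conv using assms order_trans by meson
qed

lemma jet_proj_class:
  assumes "q \<in> pointed_sections Y" "r \<le> k"
  shows "jet_proj Y r (jet_rel Y k `` {q}) = jet_rel Y r `` {q}"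
proof -
  have "(q, q) \<in> jet_rel Y k"
    using assms(1) jet_rel_equiv[of Y k] by (blast elim: equivE dest: refl_onD)
  moreover have "trans (jet_rel Y r)"
    using jet_rel_equiv[of Y r] by (blast elim: equivE)
  ultimately show ?thesis
    using jet_rel_mono[OF assms(2), of Y] unfolding jet_proj_def by (blast dest: transD)
qed

lemma inf_jets_surj: "(\<lambda>z. z r) ` inf_jets Y = jets Y r"
proof
  show "(\<lambda>z. z r) ` inf_jets Y \<subseteq> jets Y r"
    by (auto simp: inf_jets_def)
  show "jets Y r \<subseteq> (\<lambda>z. z r) ` inf_jets Y"
  proof
    fix j assume "j \<in> jets Y r"
    then obtain q where q: "q \<in> pointed_sections Y" "j = jet_rel Y r `` {q}"
      by (auto simp: jets_def elim: quotientE)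
    have "(\<lambda>k. jet_rel Y k `` {q}) \<in> inf_jets Y"
      using q(1) by (auto simp: inf_jets_def jets_def jet_proj_class intro: quotientI)
    then show "j \<in> (\<lambda>z. z r) ` inf_jets Y"
      using q(2) by (auto intro!: rev_image_eqI)
  qed
qed


section \<open>Derivations and their coordinate expressions\<close>

text \<open>\<open>\<real>\<close>-linear derivations of a ring \<open>R\<close> of real functions with pointwise operations.\<close>

definition derivations :: "('a \<Rightarrow> real) set \<Rightarrow> (('a \<Rightarrow> real) \<Rightarrow> 'a \<Rightarrow> real) set" where
  "derivations R =
     {\<upsilon> \<in> R \<rightarrow>\<^sub>E R.
        (\<forall>f \<in> R. \<forall>g \<in> R. \<upsilon> (\<lambda>z. f z + g z) = (\<lambda>z. \<upsilon> f z + \<upsilon> g z)) \<and>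
        (\<forall>a. \<forall>f \<in> R. \<upsilon> (\<lambda>z. a * f z) = (\<lambda>z. a * \<upsilon> f z)) \<and>
        (\<forall>f \<in> R. \<forall>g \<in> R. \<upsilon> (\<lambda>z. f z * g z) = (\<lambda>z. \<upsilon> f z * g z + f z * \<upsilon> g z))}"

text \<open>
  The components of a derivation relative to the atlas \<open>A\<close>: in the chart \<open>c\<close>,
  \<open>\<nu> c (Bas \<lambda>)\<close> stands for \<open>\<upsilon>\<^sup>\<lambda>\<close>, \<open>\<nu> c (Fib i {#})\<close> for \<open>\<upsilon>\<^sup>i\<close> and \<open>\<nu> c (Fib i \<Lambda>)\<close> for \<open>\<upsilon>\<^sup>i\<^sub>\<Lambda>\<close>.
\<close>

type_synonym ('x, 'y) components =
  "('x, 'y) bundle_chart \<Rightarrow> jet_index \<Rightarrow> ('x, 'y) inf_jet \<Rightarrow> real"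

definition local_components ::
    "('x, 'y) fibration \<Rightarrow> ('x, 'y) bundle_chart set \<Rightarrow> ('x, 'y) components set" where
  "local_components Y A = (\<Pi>\<^sub>E c \<in> A. \<Pi>\<^sub>E k \<in> inf_jet_indices Y. fin_order_functions Y (bdom c))"

definition transformation_law ::
    "('x, 'y) fibration \<Rightarrow> ('x, 'y) bundle_chart set \<Rightarrow> ('x, 'y) components \<Rightarrow> bool" where
  "transformation_law Y A \<nu> \<longleftrightarrow>
     (\<forall>c \<in> A. \<forall>c' \<in> A. \<forall>z \<in> inf_jets_over Y (bdom c \<inter> bdom c').
        let n = base_dim Y; m = fib_dim Y;
            D = (\<lambda>k' k. chart_partial (inf_jet_chart Y c) k (\<lambda>w. inf_jet_coord c' w k') z)
        in
          (\<forall>l < n. \<nu> c' (Bas l) z = (\<Sum>\<mu><n. D (Bas l) (Bas \<mu>) * \<nu> c (Bas \<mu>) z)) \<and>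
          (\<forall>i < m. \<nu> c' (Fib i {#}) z =
             (\<Sum>j<m. D (Fib i {#}) (Fib j {#}) * \<nu> c (Fib j {#}) z) +
             (\<Sum>\<mu><n. D (Fib i {#}) (Bas \<mu>) * \<nu> c (Bas \<mu>) z)) \<and>
          (\<forall>i < m. \<forall>\<Lambda> \<in> multi_indices n. size \<Lambda> > 0 \<longrightarrow>
             \<nu> c' (Fib i \<Lambda>) z =
               (\<Sum>\<Sigma> | \<Sigma> \<in> multi_indices n \<and> size \<Sigma> \<le> size \<Lambda>.
                  \<Sum>j<m. D (Fib i \<Lambda>) (Fib j \<Sigma>) * \<nu> c (Fib j \<Sigma>) z) +
               (\<Sum>\<mu><n. D (Fib i \<Lambda>) (Bas \<mu>) * \<nu> c (Bas \<mu>) z)))"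

text \<open>
  The value at \<open>f\<close> of the vector field \<open>\<upsilon>\<^sup>\<lambda>\<partial>\<^sub>\<lambda> + \<upsilon>\<^sup>i\<partial>\<^sub>i + \<Sum> \<upsilon>\<^sup>i\<^sub>\<Lambda>\<partial>\<^sub>i\<^sup>\<Lambda>\<close> on the chart \<open>c\<close>. Each function of
  finite jet order depends on finitely many coordinates only, so the formal infinite sum over
  \<open>|\<Lambda>| > 0\<close> has finitely many nonzero terms at \<open>f\<close>; the sum runs over the indices with nonzero
  partial derivative because the library sum over an infinite set is zero.
\<close>

definition coordinate_expression ::
    "('x, 'y) fibration \<Rightarrow> ('x, 'y) bundle_chart \<Rightarrow> (jet_index \<Rightarrow> ('x, 'y) inf_jet \<Rightarrow> real)
     \<Rightarrow> (('x, 'y) inf_jet \<Rightarrow> real) \<Rightarrow> ('x, 'y) inf_jet \<Rightarrow> real" where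
  "coordinate_expression Y c \<nu> f z =
     (let n = base_dim Y; m = fib_dim Y;
          D = (\<lambda>k. chart_partial (inf_jet_chart Y c) k f z)
      in
        (\<Sum>l<n. \<nu> (Bas l) z * D (Bas l)) +
        (\<Sum>i<m. \<nu> (Fib i {#}) z * D (Fib i {#})) +
        (\<Sum>(i, \<Lambda>) | i < m \<and> \<Lambda> \<in> multi_indices n \<and> size \<Lambda> > 0 \<and> D (Fib i \<Lambda>) \<noteq> 0.
           \<nu> (Fib i \<Lambda>) z * D (Fib i \<Lambda>)))"

definition expressed_by ::
    "('x, 'y) fibration \<Rightarrow> ('x, 'y) bundle_chart set
     \<Rightarrow> ((('x, 'y) inf_jet \<Rightarrow> real) \<Rightarrow> ('x, 'y) inf_jet \<Rightarrow> real) \<Rightarrow> ('x, 'y) components \<Rightarrow> bool" where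
  "expressed_by Y A \<upsilon> \<nu> \<longleftrightarrow>
     (\<forall>f \<in> fin_order_ring Y. \<forall>c \<in> A. \<forall>z \<in> inf_jets_over Y (bdom c).
        \<upsilon> f z = coordinate_expression Y c (\<nu> c) f z)"

end

theory Submission
  imports Defs
begin

text \<open>
  Over a chart, Hadamard's lemma shows that a derivation \<open>\<upsilon>\<close> is determined by its values on the
  coordinate functions \<open>y\<^sup>k\<close>. These are only local, and with ordinary bump functions the jet
  order of the resulting components could grow towards the boundary of the chart. Instead, take
  a global function \<open>\<rho>\<close> that is positive exactly over the chart domain and decays so fast that
  \<open>\<rho>y\<^sup>k\<close> extends by zero to a global smooth function. Then \<open>(\<upsilon>(\<rho>y\<^sup>k) - y\<^sup>k \<upsilon>(\<rho>)) / \<rho>\<close> is the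
  component \<open>\<upsilon>\<^sup>k\<close>, and it has finite order on the whole chart. The transformation law results from
  evaluating the expression of \<open>\<upsilon>\<close> in one chart on \<open>\<rho>' y'\<^sup>k\<close> for another one. Conversely, by the
  chain rule the law makes the local expressions agree on overlaps, and since the atlas is finite
  the functions so obtained have finite order.
\<close>

section \<open>Calculus on coordinate spaces\<close>

text \<open>A derivation acts on global functions only, whereas Hadamard's expansion of
  \<open>f\<close> about a point \<open>p\<close>, with summands \<open>(y_k - p_k) g_k\<close>, is
  local. Multiplied twice by a function \<rho> supported near the point, each summand becomes a
  product of the global functions \<open>\<rho> (y_k - p_k)\<close> and \<open>\<rho> g_k\<close>.
  The first vanishes at the point, so Leibniz's rule leaves only its own derivative there. The
  neighbourhood comes from a box in a chart of \<open>Y\<close>: the derivative coordinates of a jet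
  chart range over all reals, so the preimage of the box is star-shaped.

  The recurring obstacle is the uniformity of the jet order: local functions glue to one of finite
  order only if a single order serves all of them. Smoothness over a chart is therefore always
  stated with an explicit order. For the same reason \<rho> is one weighted series of bump functions
  on \<open>Y\<close>, whose weights are chosen once for all charts of the atlas and all functions
  to be extended by zero. The order is then never raised by cutting off.\<close>

abbreviation coord_space :: "'k set \<Rightarrow> ('k \<Rightarrow> real) set" where
  "coord_space K \<equiv> PiE K (\<lambda>_. UNIV)"

section \<open>Boxes and the topology of coordinate spaces\<close>

definition box_at :: "'k set \<Rightarrow> ('k \<Rightarrow> real) \<Rightarrow> real \<Rightarrow> ('k \<Rightarrow> real) set" where
  "box_at K a e = {p \<in> coord_space K. \<forall>k\<in>K. \<bar>p k - a k\<bar> < e}"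

definition cbox_at :: "'k set \<Rightarrow> ('k \<Rightarrow> real) \<Rightarrow> real \<Rightarrow> ('k \<Rightarrow> real) set" where
  "cbox_at K a e = {p \<in> coord_space K. \<forall>k\<in>K. \<bar>p k - a k\<bar> \<le> e}"

lemma box_at_centre: "p \<in> coord_space K \<Longrightarrow> e > 0 \<Longrightarrow> p \<in> box_at K p e"
  by (auto simp: box_at_def)

lemma box_at_subset_space: "box_at K p e \<subseteq> coord_space K"
  by (auto simp: box_at_def)

lemma openin_box_at:
  assumes "finite K" shows "openin (powertop_real K) (box_at K a e)"
proof -
  have "box_at K a e = PiE K (\<lambda>k. {a k - e <..< a k + e})"
    by (auto simp: box_at_def PiE_iff abs_less_iff extensional_def) (smt (verit) | force)+
  then show ?thesis
    using assms by (auto simp: openin_PiE)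
qed

text \<open>With finitely many factors, a basic open set around \<open>p\<close> contains a box of
  one common radius; neighbourhoods can be taken to be boxes from here on.\<close>

lemma openin_powertop_iff:
  assumes K: "finite K"
  shows "openin (powertop_real K) S \<longleftrightarrow> S \<subseteq> coord_space K \<and> (\<forall>p\<in>S. \<exists>e>0. box_at K p e \<subseteq> S)"
    (is "?L \<longleftrightarrow> ?R")
proof
  assume L: ?L
  have "\<exists>e>0. box_at K p e \<subseteq> S" if p: "p \<in> S" for p
  proof -
    obtain X where X: "p \<in> PiE K X" "\<forall>i. open (X i)" "PiE K X \<subseteq> S"
      using product_topology_open_contains_basis[OF L p] by auto
    have "\<forall>k\<in>K. \<exists>e>0. \<forall>t. \<bar>t - p k\<bar> < e \<longrightarrow> t \<in> X k"
      using X by (metis PiE_mem dist_real_def open_dist)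
    then obtain e where e: "\<And>k. k \<in> K \<Longrightarrow> e k > 0 \<and> (\<forall>t. \<bar>t - p k\<bar> < e k \<longrightarrow> t \<in> X k)"
      by metis
    \<comment> \<open>The inserted \<open>1\<close> covers an empty \<open>K\<close>.\<close>
    define d where "d = Min (insert 1 (e ` K))"
    have d: "d > 0" "\<And>k. k \<in> K \<Longrightarrow> d \<le> e k"
      using K e by (auto simp: d_def Min_gr_iff)
    have "box_at K p d \<subseteq> PiE K X"
      using d e by (force simp: box_at_def PiE_iff)
    then show ?thesis using d X by blast
  qed
  moreover have "S \<subseteq> coord_space K" using openin_subset[OF L] by simp
  ultimately show ?R by blast
next
  assume R: ?R
  show ?L
  proof (subst openin_subopen, intro ballI)
    fix p assume "p \<in> S"
    with R obtain e where "e > 0" "box_at K p e \<subseteq> S" by blast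
    then show "\<exists>T. openin (powertop_real K) T \<and> p \<in> T \<and> T \<subseteq> S"
      using openin_box_at[OF K, of p e] box_at_centre[of p K e] R \<open>p \<in> S\<close> by blast
  qed
qed

text \<open>The definitions use the product topology over \<open>K\<close>, the analysis library the
  topology of the function type. They agree on subsets of \<open>coord_space K\<close>, where all
  coordinates outside \<open>K\<close> are constantly \<open>undefined\<close>. This gives access to
  \<open>continuous_on\<close>.\<close>

lemma continuous_map_powertop_iff:
  assumes "S \<subseteq> coord_space K"
  shows "continuous_map (subtopology (powertop_real K) S) (T::'b::topological_space topology) F \<longleftrightarrow>
    continuous_map (top_of_set S) T F"
proof -
  have "continuous_map (top_of_set S) (subtopology (powertop_real K) S) id"
    unfolding continuous_map_in_subtopology continuous_map_componentwise
    using assms by (auto intro!: continuous_intros simp: extensional_def PiE_def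
        continuous_on_subset[OF continuous_on_product_coordinates])
  moreover have "continuous_map (subtopology (powertop_real K) S) (top_of_set S) id"
    unfolding continuous_map_in_subtopology euclidean_product_topology[symmetric]
      continuous_map_componentwise_UNIV
  proof (intro conjI allI)
    fix k show "continuous_map (subtopology (powertop_real K) S) euclideanreal (\<lambda>x. id x k)"
    proof (cases "k \<in> K")
      case True
      then show ?thesis by (auto intro: continuous_map_from_subtopology continuous_map_product_projection)
    next
      case False
      have "continuous_map (subtopology (powertop_real K) S) euclideanreal (\<lambda>x. undefined)" by simp
      then show ?thesis
        by (rule continuous_map_eq) (use assms False in \<open>auto simp: PiE_def extensional_def\<close>)
    qed
  qed auto
  ultimately show ?thesis
    by (metis comp_id continuous_map_compose)
qed

lemma continuous_map_powertop_real_iff: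
  assumes "S \<subseteq> coord_space K"
  shows "continuous_map (subtopology (powertop_real K) S) euclideanreal F \<longleftrightarrow> continuous_on S F"
  using continuous_map_powertop_iff[OF assms, of euclidean F] by simp

lemma openin_imp_openin_top_of_set:
  assumes "openin (powertop_real K) N" "N \<subseteq> S" "S \<subseteq> coord_space K"
  shows "openin (top_of_set S) N"
proof -
  have "continuous_map (top_of_set S) (powertop_real K) id"
    unfolding continuous_map_in_subtopology continuous_map_componentwise
    using assms by (auto intro!: continuous_intros simp: extensional_def PiE_def
        continuous_on_subset[OF continuous_on_product_coordinates])
  from openin_continuous_map_preimage[OF this assms(1)]
  show ?thesis using assms(2) by (auto simp: Int_absorb1 Int_def[symmetric] Collect_conj_eq)
qed

lemma continuous_on_box:
  assumes K: "finite K" and S: "openin (powertop_real K) S" and F: "continuous_on S F"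
    and p: "p \<in> S" and "e > 0"
  obtains d where "d > 0" "box_at K p d \<subseteq> S" "\<And>q. q \<in> box_at K p d \<Longrightarrow> \<bar>F q - F p\<bar> < (e::real)"
proof -
  have sub: "S \<subseteq> coord_space K" using openin_subset[OF S] by simp
  have "continuous_map (subtopology (powertop_real K) S) euclideanreal F"
    using F sub by (simp add: continuous_map_powertop_real_iff)
  from openin_continuous_map_preimage[OF this, of "ball (F p) e"]
  have "openin (powertop_real K) {q \<in> S. F q \<in> ball (F p) e}"
    using S sub openin_trans_full by (fastforce simp: Int_absorb1)
  moreover have "p \<in> {q \<in> S. F q \<in> ball (F p) e}" using p \<open>e > 0\<close> by simp
  ultimately obtain d where "d > 0" "box_at K p d \<subseteq> {q \<in> S. F q \<in> ball (F p) e}"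
    unfolding openin_powertop_iff[OF K] by blast
  then show thesis by (intro that[of d]) (auto simp: dist_real_def abs_minus_commute subset_iff)
qed


lemma continuous_on_local:
  assumes S: "S \<subseteq> coord_space K"
    and c: "\<And>p. p \<in> S \<Longrightarrow> \<exists>N. openin (powertop_real K) N \<and> p \<in> N \<and> N \<subseteq> S \<and> continuous_on N F"
  shows "continuous_on S (F :: ('k \<Rightarrow> real) \<Rightarrow> real)"
  unfolding continuous_on_def
proof
  fix p assume p: "p \<in> S"
  then obtain N where N: "openin (powertop_real K) N" "p \<in> N" "N \<subseteq> S" "continuous_on N F"
    using c by blast
  obtain T where T: "open T" "N = S \<inter> T"
    using openin_imp_openin_top_of_set[OF N(1,3) S] openin_open by blast
  have "at p within S = at p within N"
    by (rule at_within_nhd[of p T]) (use T N in auto)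
  then show "(F \<longlongrightarrow> F p) (at p within S)"
    using N by (metis continuous_on_def)
qed

text \<open>A partial derivative at a point of an open set thus sees only the values on that
  set.\<close>

lemma eventually_upd:
  assumes K: "finite K" and S: "openin (powertop_real K) S" and p: "p \<in> S" and k: "k \<in> K"
  shows "\<forall>\<^sub>F t in nhds (p k). p(k := t) \<in> S"
proof -
  obtain e where e: "e > 0" "box_at K p e \<subseteq> S"
    using S p unfolding openin_powertop_iff[OF K] by blast
  have "p \<in> coord_space K" using openin_subset[OF S] p by auto
  then have "p(k := t) \<in> S" if "\<bar>t - p k\<bar> < e" for t
    using e that k by (intro subsetD[OF e(2)]) (auto simp: box_at_def PiE_iff extensional_def)
  then show ?thesis
    using e(1) by (auto simp: eventually_nhds_metric dist_real_def)
qed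

section \<open>Functions of class \<open>Ck\<close> and their closure properties\<close>

text \<open>The finite-order version of \<open>smooth_on\<close>, which makes inductive closure proofs possible.\<close>

primrec Ck :: "nat \<Rightarrow> 'k set \<Rightarrow> ('k \<Rightarrow> real) set \<Rightarrow> (('k \<Rightarrow> real) \<Rightarrow> real) \<Rightarrow> bool" where
  "Ck 0 K S F \<longleftrightarrow> continuous_on S F"
| "Ck (Suc n) K S F \<longleftrightarrow> continuous_on S F \<and>
     (\<forall>k\<in>K. (\<forall>p\<in>S. (\<lambda>t. F (p(k := t))) differentiable (at (p k))) \<and> Ck n K S (partial k F))"

lemma Ck_Suc_D: "Ck (Suc n) K S F \<Longrightarrow> Ck n K S F"
  by (induction n arbitrary: F) auto

lemma Ck_cont: "Ck n K S F \<Longrightarrow> continuous_on S F"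
  by (cases n) auto

lemma Ck_subset: "Ck n K S F \<Longrightarrow> S' \<subseteq> S \<Longrightarrow> Ck n K S' F"
  by (induction n arbitrary: F) (auto intro: continuous_on_subset)

lemma iter_partial_append: "iter_partial (xs @ ys) F = iter_partial xs (iter_partial ys F)"
  by (induction xs) auto

text \<open>\<open>Ck\<close> peels off the innermost derivative, \<open>iter_partial\<close> adds
  derivatives on the outside; the induction therefore runs over all functions
  \<open>iter_partial ks F\<close> at once.\<close>

lemma smooth_on_iff_Ck:
  assumes S: "S \<subseteq> coord_space K"
  shows "smooth_on K S F \<longleftrightarrow> (\<forall>n. Ck n K S F)"
proof
  assume L: "smooth_on K S F"
  have "Ck n K S (iter_partial ks F)" if "ks \<in> lists K" for n ks
    using that
  proof (induction n arbitrary: ks)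
    case 0
    then show ?case using L S by (auto simp: smooth_on_def continuous_map_powertop_real_iff)
  next
    case (Suc n)
    have "Ck n K S (partial k (iter_partial ks F))" if "k \<in> K" for k
      using Suc.IH[of "k # ks"] Suc.prems that by auto
    then show ?case
      using L S Suc.prems by (auto simp: smooth_on_def continuous_map_powertop_real_iff)
  qed
  from this[of "[]"] show "\<forall>n. Ck n K S F" by simp
next
  assume R: "\<forall>n. Ck n K S F"
  have R': "\<forall>n. Ck n K S (iter_partial ks F)" if "ks \<in> lists K" for ks
    using that
  proof (induction ks)
    case (Cons k ks)
    then have *: "Ck (Suc n) K S (iter_partial ks F)" for n by blast
    have "k \<in> K" using Cons by simp
    then have "Ck n K S (partial k (iter_partial ks F))" for n
      using *[of n] by simp
    then show ?case by simp
  qed (use R in auto)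
  then have "Ck 1 K S (iter_partial ks F)" if "ks \<in> lists K" for ks using that by blast
  then show "smooth_on K S F"
    using S by (auto simp: smooth_on_def continuous_map_powertop_real_iff)
qed

lemma partial_eqI:
  "((\<lambda>t. F (p(k := t))) has_real_derivative D) (at (p k)) \<Longrightarrow> partial k F p = D"
  unfolding partial_def by (rule DERIV_imp_deriv)

lemma partial_has_derivative:
  "(\<lambda>t. F (p(k := t))) differentiable (at (p k)) \<Longrightarrow>
    ((\<lambda>t. F (p(k := t))) has_real_derivative partial k F p) (at (p k))"
  unfolding partial_def by (simp add: DERIV_deriv_iff_real_differentiable)

lemma Ck_has_derivative:
  assumes "Ck (Suc n) K S F" "k \<in> K" "p \<in> S"
  shows "((\<lambda>t. F (p(k := t))) has_real_derivative partial k F p) (at (p k))"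
  using assms by (intro partial_has_derivative) auto

lemma has_derivative_upd_cong:
  assumes K: "finite K" and S: "openin (powertop_real K) S" and p: "p \<in> S" and k: "k \<in> K"
    and eq: "\<And>q. q \<in> S \<Longrightarrow> F q = G q"
  shows "((\<lambda>t. F (p(k := t))) has_real_derivative D) (at (p k)) \<longleftrightarrow>
    ((\<lambda>t. G (p(k := t))) has_real_derivative D) (at (p k))"
  by (rule DERIV_cong_ev[OF refl _ refl])
    (use eventually_upd[OF K S p k] eq in \<open>auto elim: eventually_mono\<close>)

lemma partial_cong:
  assumes K: "finite K" and S: "openin (powertop_real K) S" and p: "p \<in> S" and k: "k \<in> K"
    and eq: "\<And>q. q \<in> S \<Longrightarrow> F q = G q"
  shows "partial k F p = partial k G p"
  unfolding partial_def deriv_def using has_derivative_upd_cong[OF K S p k, of F G] eq by simp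

lemma iter_partial_cong:
  assumes K: "finite K" and S: "openin (powertop_real K) S" and p: "p \<in> S" and ks: "ks \<in> lists K"
    and eq: "\<And>q. q \<in> S \<Longrightarrow> F q = G q"
  shows "iter_partial ks F p = iter_partial ks G p"
  using ks p
proof (induction ks arbitrary: p)
  case (Cons k ks)
  have "partial k (iter_partial ks F) p = partial k (iter_partial ks G) p"
    by (rule partial_cong[OF K S Cons.prems(1)]) (use Cons in auto)
  then show ?case by simp
qed (use eq in auto)

lemma Ck_cong:
  assumes K: "finite K" and S: "openin (powertop_real K) S"
  shows "Ck n K S F \<Longrightarrow> (\<And>q. q \<in> S \<Longrightarrow> F q = G q) \<Longrightarrow> Ck n K S G"
proof (induction n arbitrary: F G)
  case 0
  then show ?case by (auto cong: continuous_on_cong)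
next
  case (Suc n)
  show ?case
    unfolding Ck.simps
  proof (intro conjI ballI)
    show "continuous_on S G" using Suc.prems by (auto cong: continuous_on_cong)
    fix k assume k: "k \<in> K"
    show "Ck n K S (partial k G)"
    proof (rule Suc.IH)
      show "Ck n K S (partial k F)" using Suc.prems(1) k by simp
      show "partial k F q = partial k G q" if "q \<in> S" for q
        by (rule partial_cong[OF K S that k Suc.prems(2)])
    qed
    fix p assume p: "p \<in> S"
    show "(\<lambda>t. G (p(k := t))) differentiable at (p k)"
      using has_derivative_upd_cong[OF K S p k, of F G] Suc.prems k p
      by (fastforce simp: real_differentiable_def)
  qed
qed

text \<open>A formula \<open>D\<close> for the derivatives is known on \<open>S\<close> only, where
  it coincides with \<open>partial\<close>. Closure proofs can then work with the formulas of
  elementary calculus.\<close>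

lemma Ck_SucI:
  assumes K: "finite K" and S: "openin (powertop_real K) S" and "continuous_on S F"
    and "\<And>k p. k \<in> K \<Longrightarrow> p \<in> S \<Longrightarrow> ((\<lambda>t. F (p(k := t))) has_real_derivative D k p) (at (p k))"
    and "\<And>k. k \<in> K \<Longrightarrow> Ck n K S (D k)"
  shows "Ck (Suc n) K S F"
proof -
  have "Ck n K S (partial k F)" if "k \<in> K" for k
    by (rule Ck_cong[OF K S assms(5)[OF that]]) (simp add: partial_eqI[OF assms(4)] that)
  then show ?thesis using assms(3,4) by (auto simp: real_differentiable_def)
qed

lemma Ck_local:
  assumes K: "finite K" and S: "S \<subseteq> coord_space K"
    and "\<And>p. p \<in> S \<Longrightarrow> \<exists>N. openin (powertop_real K) N \<and> p \<in> N \<and> N \<subseteq> S \<and> Ck n K N F"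
  shows "Ck n K S F"
  using assms(3)
proof (induction n arbitrary: F)
  case 0
  then show ?case using continuous_on_local[OF S, of F] by simp
next
  case (Suc n)
  show ?case
    unfolding Ck.simps
  proof (intro conjI ballI)
    show "continuous_on S F" using Suc.prems by (intro continuous_on_local[OF S]) fastforce
    fix k assume k: "k \<in> K"
    show "Ck n K S (partial k F)" using Suc.prems k by (intro Suc.IH) fastforce
    fix p assume "p \<in> S"
    with Suc.prems[OF this] k show "(\<lambda>t. F (p(k := t))) differentiable at (p k)" by auto
  qed
qed

lemma Ck_const: "finite K \<Longrightarrow> openin (powertop_real K) S \<Longrightarrow> Ck n K S (\<lambda>_. c)"
proof (induction n arbitrary: c)
  case (Suc n)
  show ?case by (rule Ck_SucI[where D = "\<lambda>_ _. 0"]) (use Suc in auto)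
qed auto

lemma Ck_coord: "finite K \<Longrightarrow> openin (powertop_real K) S \<Longrightarrow> Ck n K S (\<lambda>p. p j)"
proof (cases n)
  case 0
  then show ?thesis by (auto intro: continuous_on_subset[OF continuous_on_product_coordinates])
next
  case (Suc n)
  assume *: "finite K" "openin (powertop_real K) S"
  show ?thesis unfolding Suc
    by (rule Ck_SucI[where D = "\<lambda>k _. if k = j then 1 else 0"])
      (use * in \<open>auto intro: Ck_const continuous_on_subset[OF continuous_on_product_coordinates]
         intro!: derivative_eq_intros\<close>)
qed

lemma Ck_add:
  assumes "finite K" "openin (powertop_real K) S"
  shows "Ck n K S F \<Longrightarrow> Ck n K S G \<Longrightarrow> Ck n K S (\<lambda>p. F p + G p)"
proof (induction n arbitrary: F G)
  case 0
  then show ?case by (auto intro: continuous_intros)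
next
  case (Suc n)
  show ?case
  proof (rule Ck_SucI[OF assms])
    show "((\<lambda>t. F (p(k := t)) + G (p(k := t))) has_real_derivative
        (partial k F p + partial k G p)) (at (p k))" if "k \<in> K" "p \<in> S" for k p
      by (rule DERIV_add[OF Ck_has_derivative[OF Suc.prems(1) that] Ck_has_derivative[OF Suc.prems(2) that]])
  qed (use Suc in \<open>auto intro!: continuous_intros\<close>)
qed

lemma Ck_mult:
  assumes "finite K" "openin (powertop_real K) S"
  shows "Ck n K S F \<Longrightarrow> Ck n K S G \<Longrightarrow> Ck n K S (\<lambda>p. F p * G p)"
proof (induction n arbitrary: F G)
  case 0
  then show ?case by (auto intro: continuous_intros)
next
  case (Suc n)
  have D: "((\<lambda>t. F (p(k := t)) * G (p(k := t))) has_real_derivative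
      (partial k F p * G p + F p * partial k G p)) (at (p k))" if "k \<in> K" "p \<in> S" for k p
    using DERIV_mult[OF Ck_has_derivative[OF Suc.prems(1) that] Ck_has_derivative[OF Suc.prems(2) that]]
    by (simp add: algebra_simps del: fun_upd_apply)
  show ?case
  proof (rule Ck_SucI[OF assms _ D])
    have FG: "Ck n K S F" "Ck n K S G" using Suc.prems by (auto intro: Ck_Suc_D)
    show "Ck n K S (\<lambda>p. partial k F p * G p + F p * partial k G p)" if "k \<in> K" for k
      by (intro Ck_add assms Suc.IH FG) (use Suc.prems that in auto)
  qed (use Suc.prems in \<open>auto intro!: continuous_intros\<close>)
qed

lemma Ck_sum:
  assumes "finite K" "openin (powertop_real K) S" "\<And>i. i \<in> I \<Longrightarrow> Ck n K S (F i)"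
  shows "Ck n K S (\<lambda>p. \<Sum>i\<in>I. F i p)"
  using assms(3)
  by (induction I rule: infinite_finite_induct) (auto intro: Ck_const Ck_add assms)

lemma Ck_prod:
  assumes "finite K" "openin (powertop_real K) S" "\<And>i. i \<in> I \<Longrightarrow> Ck n K S (F i)"
  shows "Ck n K S (\<lambda>p. \<Prod>i\<in>I. F i p)"
  using assms(3)
  by (induction I rule: infinite_finite_induct) (auto intro: Ck_const Ck_mult assms)

lemma Ck_inverse:
  assumes "finite K" "openin (powertop_real K) S" "\<And>p. p \<in> S \<Longrightarrow> F p \<noteq> 0"
  shows "Ck n K S F \<Longrightarrow> Ck n K S (\<lambda>p. inverse (F p))"
proof (induction n)
  case 0
  then show ?case using assms by (auto intro: continuous_intros)
next
  case (Suc n)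
  have D: "((\<lambda>t. inverse (F (p(k := t)))) has_real_derivative
      (- 1) * (inverse (F p) * (inverse (F p) * partial k F p))) (at (p k))" if "k \<in> K" "p \<in> S" for k p
    using DERIV_inverse'[OF Ck_has_derivative[OF Suc.prems that]] assms(3)[OF that(2)]
    by (simp add: mult_ac del: fun_upd_apply)
  show ?case
  proof (rule Ck_SucI[OF assms(1,2) _ D])
    have "Ck n K S (\<lambda>p. inverse (F p))" using Suc.IH Ck_Suc_D[OF Suc.prems] by blast
    then show "Ck n K S (\<lambda>p. (- 1) * (inverse (F p) * (inverse (F p) * partial k F p)))" if "k \<in> K" for k
      by (intro Ck_mult Ck_const assms) (use Suc.prems that in auto)
  qed (use Suc.prems assms in \<open>auto intro!: continuous_intros\<close>)
qed


section \<open>Mean value theorem and chain rule\<close>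

lemma mvt_segment:
  fixes f :: "real \<Rightarrow> real"
  assumes "\<And>x. x \<in> closed_segment a b \<Longrightarrow> (f has_real_derivative f' x) (at x)"
  obtains z where "z \<in> closed_segment a b" "f b - f a = (b - a) * f' z"
proof (cases a b rule: linorder_cases)
  case less
  then obtain z where "a < z" "z < b" "f b - f a = (b - a) * f' z"
    using MVT2[of a b f f'] assms by (auto simp: closed_segment_eq_real_ivl)
  then show thesis using less that[of z] by (auto simp: closed_segment_eq_real_ivl)
next
  case equal
  then show thesis using that[of a] by auto
next
  case greater
  then obtain z where "b < z" "z < a" "f a - f b = (a - b) * f' z"
    using MVT2[of b a f f'] assms by (auto simp: closed_segment_eq_real_ivl)
  then show thesis using greater that[of z] by (auto simp: closed_segment_eq_real_ivl algebra_simps)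
qed

text \<open>The increment is telescoped over the coordinates, one mean value theorem for each.\<close>

lemma increment_mean_value:
  assumes K: "finite K" and F: "Ck 1 K (box_at K p e) F" and p: "p \<in> coord_space K"
    and q: "q \<in> box_at K p e"
  shows "\<exists>\<xi>. (\<forall>k\<in>K. \<xi> k \<in> coord_space K \<and> (\<forall>j\<in>K. \<bar>\<xi> k j - p j\<bar> \<le> \<bar>q j - p j\<bar>)) \<and>
    F q - F p = (\<Sum>k\<in>K. (q k - p k) * partial k F (\<xi> k))"
proof -
  define m where "m L = (\<lambda>j. if j \<in> L then q j else p j)" for L
  have q': "q \<in> coord_space K" "\<And>j. j \<in> K \<Longrightarrow> \<bar>q j - p j\<bar> < e" using q by (auto simp: box_at_def)
  have "\<exists>\<xi>. (\<forall>k\<in>L. \<xi> k \<in> coord_space K \<and> (\<forall>j\<in>K. \<bar>\<xi> k j - p j\<bar> \<le> \<bar>q j - p j\<bar>)) \<and>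
      F (m L) - F p = (\<Sum>k\<in>L. (q k - p k) * partial k F (\<xi> k))" if "finite L" "L \<subseteq> K" for L
    using that
  proof (induction L rule: finite_induct)
    case empty
    then show ?case by (simp add: m_def)
  next
    case (insert l L)
    then have "\<exists>\<xi>. (\<forall>k\<in>L. \<xi> k \<in> coord_space K \<and> (\<forall>j\<in>K. \<bar>\<xi> k j - p j\<bar> \<le> \<bar>q j - p j\<bar>)) \<and>
        F (m L) - F p = (\<Sum>k\<in>L. (q k - p k) * partial k F (\<xi> k))" by simp
    then obtain \<xi> where \<xi>0: "(\<forall>k\<in>L. \<xi> k \<in> coord_space K \<and> (\<forall>j\<in>K. \<bar>\<xi> k j - p j\<bar> \<le> \<bar>q j - p j\<bar>)) \<and>
        F (m L) - F p = (\<Sum>k\<in>L. (q k - p k) * partial k F (\<xi> k))" by (rule exE)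
    then have \<xi>: "\<And>k. k \<in> L \<Longrightarrow> \<xi> k \<in> coord_space K \<and> (\<forall>j\<in>K. \<bar>\<xi> k j - p j\<bar> \<le> \<bar>q j - p j\<bar>)"
      "F (m L) - F p = (\<Sum>k\<in>L. (q k - p k) * partial k F (\<xi> k))"
      by simp_all
    have l: "l \<in> K" "l \<notin> L" using insert by auto
    define g where "g t = (m L)(l := t)" for t
    have seg: "\<bar>t - p l\<bar> \<le> \<bar>q l - p l\<bar>" if "t \<in> closed_segment (p l) (q l)" for t
      using that by (auto simp: closed_segment_eq_real_ivl split: if_splits)
    have gbox: "g t \<in> box_at K p e" if "t \<in> closed_segment (p l) (q l)" for t
      using p q' l seg[OF that] unfolding box_at_def g_def m_def
      by (auto simp: PiE_iff extensional_def) (smt (verit))+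
    have gle: "\<bar>g t j - p j\<bar> \<le> \<bar>q j - p j\<bar>" if "t \<in> closed_segment (p l) (q l)" for t j
      using seg[OF that] by (auto simp: g_def m_def)
    have "((\<lambda>t. F (g t)) has_real_derivative partial l F (g t)) (at t)"
      if "t \<in> closed_segment (p l) (q l)" for t
    proof -
      have "((\<lambda>s. F ((g t)(l := s))) has_real_derivative partial l F (g t)) (at (g t l))"
        using F by (intro Ck_has_derivative[where n = 0, OF _ l(1) gbox[OF that]]) simp
      then show ?thesis by (simp add: g_def del: fun_upd_apply) (simp add: g_def)
    qed
    then obtain z where z: "z \<in> closed_segment (p l) (q l)"
      "F (g (q l)) - F (g (p l)) = (q l - p l) * partial l F (g z)"
      by (rule mvt_segment)
    have "g (q l) = m (insert l L)" "g (p l) = m L"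
      using l by (auto simp: g_def m_def fun_eq_iff)
    then have eq: "F (m (insert l L)) - F p = (q l - p l) * partial l F (g z) +
        (\<Sum>k\<in>L. (q k - p k) * partial k F (\<xi> k))"
      using z(2) \<xi>(2) by simp
    have gz: "g z \<in> coord_space K" using gbox[OF z(1)] box_at_subset_space by blast
    show ?case
    proof (intro exI[of _ "\<xi>(l := g z)"] conjI ballI)
      fix k assume "k \<in> insert l L"
      then show "(\<xi>(l := g z)) k \<in> coord_space K"
        using \<xi>(1) gz by (metis fun_upd_apply insertE)
      fix j assume "j \<in> K"
      then show "\<bar>(\<xi>(l := g z)) k j - p j\<bar> \<le> \<bar>q j - p j\<bar>"
        using \<xi>(1) gle[OF z(1)] \<open>k \<in> insert l L\<close> by auto
    next
      have "(\<Sum>k\<in>L. (q k - p k) * partial k F ((\<xi>(l := g z)) k)) = (\<Sum>k\<in>L. (q k - p k) * partial k F (\<xi> k))"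
        using l by (intro sum.cong) auto
      then show "F (m (insert l L)) - F p = (\<Sum>k\<in>insert l L. (q k - p k) * partial k F ((\<xi>(l := g z)) k))"
        using eq insert by simp
    qed
  qed
  from this[OF K] obtain \<xi> where "\<forall>k\<in>K. \<xi> k \<in> coord_space K \<and> (\<forall>j\<in>K. \<bar>\<xi> k j - p j\<bar> \<le> \<bar>q j - p j\<bar>)"
      "F (m K) - F p = (\<Sum>k\<in>K. (q k - p k) * partial k F (\<xi> k))" by auto
  moreover have "m K = q"
    using p q' by (auto simp: m_def fun_eq_iff PiE_iff extensional_def)
  ultimately show ?thesis by auto
qed

text \<open>The mean value points \<open>\<xi> (\<gamma> t) k\<close> are coordinatewise no further
  from \<open>p\<close> than \<open>\<gamma> t\<close>, hence converge to \<open>p\<close>;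
  continuity of the partial derivatives then gives the limit of the difference quotient. Curves
  suffice because a partial derivative of a composite moves a single real parameter.\<close>

lemma chain_rule_path:
  assumes K: "finite K" and S: "openin (powertop_real K) S" and F: "Ck 1 K S F"
    and \<gamma>: "\<gamma> t0 \<in> S" "\<forall>\<^sub>F t in nhds t0. \<gamma> t \<in> coord_space K"
    and D: "\<And>k. k \<in> K \<Longrightarrow> ((\<lambda>t. \<gamma> t k) has_real_derivative D k) (at t0)"
  shows "((\<lambda>t. F (\<gamma> t)) has_real_derivative (\<Sum>k\<in>K. partial k F (\<gamma> t0) * D k)) (at t0)"
proof -
  define p where "p = \<gamma> t0"
  have p: "p \<in> S" "p \<in> coord_space K" using \<gamma> openin_subset[OF S] by (auto simp: p_def)
  obtain e where e: "e > 0" "box_at K p e \<subseteq> S" using S p unfolding openin_powertop_iff[OF K] by blast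
  have F': "Ck 1 K (box_at K p e) F" using F e(2) by (rule Ck_subset)
  have lim: "((\<lambda>t. \<gamma> t k) \<longlongrightarrow> p k) (at t0)" if "k \<in> K" for k
    using DERIV_isCont[OF D[OF that]] by (simp add: isCont_def p_def)
  have near: "\<forall>\<^sub>F t in at t0. \<gamma> t \<in> box_at K p d" if "d > 0" for d
  proof -
    have "\<forall>\<^sub>F t in at t0. \<forall>k\<in>K. \<bar>\<gamma> t k - p k\<bar> < d"
      using K lim that by (intro eventually_ball_finite) (auto simp: tendsto_iff dist_real_def)
    moreover have "\<forall>\<^sub>F t in at t0. \<gamma> t \<in> coord_space K" using \<gamma>(2) by (simp add: eventually_nhds_conv_at)
    ultimately show ?thesis by eventually_elim (auto simp: box_at_def)
  qed
  define \<xi> where "\<xi> q = (SOME \<xi>. (\<forall>k\<in>K. \<xi> k \<in> coord_space K \<and> (\<forall>j\<in>K. \<bar>\<xi> k j - p j\<bar> \<le> \<bar>q j - p j\<bar>)) \<and>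
    F q - F p = (\<Sum>k\<in>K. (q k - p k) * partial k F (\<xi> k)))" for q
  have \<xi>0: "(\<forall>k\<in>K. \<xi> q k \<in> coord_space K \<and> (\<forall>j\<in>K. \<bar>\<xi> q k j - p j\<bar> \<le> \<bar>q j - p j\<bar>)) \<and>
    F q - F p = (\<Sum>k\<in>K. (q k - p k) * partial k F (\<xi> q k))" if "q \<in> box_at K p e" for q
    using someI_ex[OF increment_mean_value[OF K F' p(2) that]] unfolding \<xi>_def .
  have \<xi>: "\<xi> q k \<in> coord_space K \<and> (\<forall>j\<in>K. \<bar>\<xi> q k j - p j\<bar> \<le> \<bar>q j - p j\<bar>)"
    if "q \<in> box_at K p e" "k \<in> K" for q k using \<xi>0[OF that(1)] that(2) by simp
  have \<xi>2: "F q - F p = (\<Sum>k\<in>K. (q k - p k) * partial k F (\<xi> q k))" if "q \<in> box_at K p e" for q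
    using \<xi>0[OF that] by simp
  have lim2: "((\<lambda>t. partial k F (\<xi> (\<gamma> t) k)) \<longlongrightarrow> partial k F p) (at t0)" if k: "k \<in> K" for k
  proof (rule tendstoI)
    fix r :: real assume "r > 0"
    have "continuous_on S (partial k F)" using F k by auto
    then obtain d where d: "d > 0" "box_at K p d \<subseteq> S"
      "\<And>q. q \<in> box_at K p d \<Longrightarrow> \<bar>partial k F q - partial k F p\<bar> < r"
      using continuous_on_box[OF K S _ p(1) \<open>r > 0\<close>] by metis
    have "\<forall>\<^sub>F t in at t0. \<gamma> t \<in> box_at K p (min d e)" using d e by (intro near) auto
    then show "\<forall>\<^sub>F t in at t0. dist (partial k F (\<xi> (\<gamma> t) k)) (partial k F p) < r"
    proof eventually_elim
      case (elim t)
      then have "\<gamma> t \<in> box_at K p e" by (auto simp: box_at_def)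
      from \<xi>[OF this k] elim have "\<xi> (\<gamma> t) k \<in> box_at K p d" by (force simp: box_at_def)
      then show ?case using d(3) by (simp add: dist_real_def)
    qed
  qed
  have "((\<lambda>t. \<Sum>k\<in>K. (\<gamma> t k - p k) / (t - t0) * partial k F (\<xi> (\<gamma> t) k)) \<longlongrightarrow>
      (\<Sum>k\<in>K. D k * partial k F p)) (at t0)"
    using D by (intro tendsto_sum tendsto_mult lim2) (auto simp: has_field_derivative_iff p_def)
  moreover have "\<forall>\<^sub>F t in at t0. (\<Sum>k\<in>K. (\<gamma> t k - p k) / (t - t0) * partial k F (\<xi> (\<gamma> t) k)) =
      (F (\<gamma> t) - F (\<gamma> t0)) / (t - t0)"
    using near[OF e(1)]
    by eventually_elim (simp add: \<xi>2 sum_divide_distrib p_def[symmetric])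
  ultimately have "((\<lambda>t. (F (\<gamma> t) - F (\<gamma> t0)) / (t - t0)) \<longlongrightarrow> (\<Sum>k\<in>K. D k * partial k F p)) (at t0)"
    by (rule Lim_transform_eventually)
  then show ?thesis by (simp add: has_field_derivative_iff p_def mult.commute)
qed

text \<open>The derivative of the composite contains \<open>partial l F\<close> after the same
  \<open>T\<close>, so the induction on the order keeps \<open>T\<close> fixed and \<open>F\<close>
  general.\<close>

lemma Ck_compose:
  assumes K: "finite K" and S: "openin (powertop_real K) S"
    and L: "finite L" and \<Omega>: "openin (powertop_real L) \<Omega>" and T: "T ` S \<subseteq> \<Omega>"
  shows "Ck n L \<Omega> F \<Longrightarrow> (\<And>l. l \<in> L \<Longrightarrow> Ck n K S (\<lambda>p. T p l)) \<Longrightarrow> Ck n K S (\<lambda>p. F (T p))"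
proof (induction n arbitrary: F)
  case 0
  have T2: "T ` S \<subseteq> coord_space L" using T openin_subset[OF \<Omega>] by auto
  have "continuous_on S T"
  proof (rule continuous_on_coordinatewise_then_product)
    fix l show "continuous_on S (\<lambda>p. T p l)"
    proof (cases "l \<in> L")
      case True
      then show ?thesis using 0 by simp
    next
      case False
      then have "\<And>p. p \<in> S \<Longrightarrow> T p l = undefined" using T2 by (force simp: PiE_iff extensional_def)
      then show ?thesis by (simp cong: continuous_on_cong)
    qed
  qed
  then show ?case using 0 T continuous_on_compose2[of \<Omega> F S T] by simp
next
  case (Suc n)
  have T2: "T ` S \<subseteq> coord_space L" using T openin_subset[OF \<Omega>] by auto
  show ?case
  proof (rule Ck_SucI[OF K S, where D = "\<lambda>k p. \<Sum>l\<in>L. partial l F (T p) * partial k (\<lambda>p. T p l) p"])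
    have Sn: "Ck n L \<Omega> F" "\<And>l. l \<in> L \<Longrightarrow> Ck n K S (\<lambda>p. T p l)"
      using Suc.prems by (auto intro: Ck_Suc_D)
    show "continuous_on S (\<lambda>p. F (T p))"
      using Ck_cont[OF Suc.IH[OF Sn]] by simp
    show "Ck n K S (\<lambda>p. \<Sum>l\<in>L. partial l F (T p) * partial k (\<lambda>p. T p l) p)" if k: "k \<in> K" for k
    proof (intro Ck_sum Ck_mult K S)
      fix l assume l: "l \<in> L"
      show "Ck n K S (\<lambda>p. partial l F (T p))" using Suc.prems(1) l by (intro Suc.IH[OF _ Sn(2)]) simp_all
      show "Ck n K S (partial k (\<lambda>p. T p l))" using Suc.prems(2)[OF l] k by simp
    qed
    fix k p assume k: "k \<in> K" and p: "p \<in> S"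
    have "Ck 1 L \<Omega> F" using Suc.prems(1) by (auto dest: Ck_cont)
    moreover have "\<forall>\<^sub>F t in nhds (p k). T (p(k := t)) \<in> coord_space L"
      using eventually_upd[OF K S p k] by (rule eventually_mono) (use T2 in auto)
    moreover have "((\<lambda>t. T (p(k := t)) l) has_real_derivative partial k (\<lambda>p. T p l) p) (at (p k))"
      if "l \<in> L" for l
      using Suc.prems(2)[OF that] k p by (rule Ck_has_derivative)
    ultimately show "((\<lambda>t. F (T (p(k := t)))) has_real_derivative
        (\<Sum>l\<in>L. partial l F (T p) * partial k (\<lambda>p. T p l) p)) (at (p k))"
      using chain_rule_path[OF L \<Omega>, of F "\<lambda>t. T (p(k := t))" "p k" "\<lambda>l. partial k (\<lambda>p. T p l) p"] T p
      by auto
  qed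
qed

lemma partial_compose:
  assumes K: "finite K" and S: "openin (powertop_real K) S"
    and L: "finite L" and \<Omega>: "openin (powertop_real L) \<Omega>" and T: "T ` S \<subseteq> \<Omega>"
    and F: "Ck 1 L \<Omega> F" and Tk: "\<And>l. l \<in> L \<Longrightarrow> Ck 1 K S (\<lambda>p. T p l)" and k: "k \<in> K" and p: "p \<in> S"
  shows "partial k (\<lambda>p. F (T p)) p = (\<Sum>l\<in>L. partial l F (T p) * partial k (\<lambda>p. T p l) p)"
proof (rule partial_eqI)
  have "\<forall>\<^sub>F t in nhds (p k). T (p(k := t)) \<in> coord_space L"
    using eventually_upd[OF K S p k] by (rule eventually_mono) (use T openin_subset[OF \<Omega>] in auto)
  moreover have "((\<lambda>t. T (p(k := t)) l) has_real_derivative partial k (\<lambda>p. T p l) p) (at (p k))"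
    if "l \<in> L" for l
    using Tk[OF that] k p by (intro Ck_has_derivative[where n = 0 and S = S]) auto
  ultimately show "((\<lambda>t. F (T (p(k := t)))) has_real_derivative
      (\<Sum>l\<in>L. partial l F (T p) * partial k (\<lambda>p. T p l) p)) (at (p k))"
    using chain_rule_path[OF L \<Omega> F, of "\<lambda>t. T (p(k := t))" "p k" "\<lambda>l. partial k (\<lambda>p. T p l) p"] T p
    by auto
qed

text \<open>Schwarz's theorem: the second difference \<open>\<Delta>\<close> over a square of side
  \<open>h\<close> is \<open>h * h\<close> times a value of either mixed derivative, by two mean
  value steps taken in either order. Both values are close to those at the corner
  \<open>(a, b)\<close>.\<close>

lemma mixed_derivatives_eq:
  fixes f fx fy fxy fyx :: "real \<Rightarrow> real \<Rightarrow> real"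
  assumes "e > 0"
    and fx: "\<And>s t. \<bar>s - a\<bar> < e \<Longrightarrow> \<bar>t - b\<bar> < e \<Longrightarrow> ((\<lambda>s. f s t) has_real_derivative fx s t) (at s)"
    and fy: "\<And>s t. \<bar>s - a\<bar> < e \<Longrightarrow> \<bar>t - b\<bar> < e \<Longrightarrow> ((\<lambda>t. f s t) has_real_derivative fy s t) (at t)"
    and fxy: "\<And>s t. \<bar>s - a\<bar> < e \<Longrightarrow> \<bar>t - b\<bar> < e \<Longrightarrow> ((\<lambda>t. fx s t) has_real_derivative fxy s t) (at t)"
    and fyx: "\<And>s t. \<bar>s - a\<bar> < e \<Longrightarrow> \<bar>t - b\<bar> < e \<Longrightarrow> ((\<lambda>s. fy s t) has_real_derivative fyx s t) (at s)"
    and cxy: "\<And>r. r > 0 \<Longrightarrow> \<exists>d>0. \<forall>s t. \<bar>s - a\<bar> < d \<longrightarrow> \<bar>t - b\<bar> < d \<longrightarrow> \<bar>fxy s t - fxy a b\<bar> < r"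
    and cyx: "\<And>r. r > 0 \<Longrightarrow> \<exists>d>0. \<forall>s t. \<bar>s - a\<bar> < d \<longrightarrow> \<bar>t - b\<bar> < d \<longrightarrow> \<bar>fyx s t - fyx a b\<bar> < r"
  shows "fxy a b = fyx a b"
proof -
  have "\<bar>fxy a b - fyx a b\<bar> \<le> r" if r: "r > 0" for r
  proof -
    obtain d1 where d1: "d1 > 0" "\<And>s t. \<bar>s - a\<bar> < d1 \<Longrightarrow> \<bar>t - b\<bar> < d1 \<Longrightarrow> \<bar>fxy s t - fxy a b\<bar> < r / 2"
      using cxy[OF half_gt_zero[OF r]] by blast
    obtain d2 where d2: "d2 > 0" "\<And>s t. \<bar>s - a\<bar> < d2 \<Longrightarrow> \<bar>t - b\<bar> < d2 \<Longrightarrow> \<bar>fyx s t - fyx a b\<bar> < r / 2"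
      using cyx[OF half_gt_zero[OF r]] by blast
    \<comment> \<open>Halving puts \<open>a + h\<close> and \<open>b + h\<close> strictly inside all
      three neighbourhoods.\<close>
    define h where "h = min e (min d1 d2) / 2"
    have h: "h > 0" "h < e" "h < d1" "h < d2" using \<open>e > 0\<close> d1(1) d2(1) by (auto simp: h_def)
    define \<Delta> where "\<Delta> = f (a + h) (b + h) - f (a + h) b - f a (b + h) + f a b"
    have "\<exists>x>a. x < a + h \<and> (f (a + h) (b + h) - f (a + h) b) - (f a (b + h) - f a b) = (a + h - a) * (fx x (b + h) - fx x b)"
      using h by (intro MVT2[where f = "\<lambda>s. f s (b + h) - f s b" and f' = "\<lambda>s. fx s (b + h) - fx s b"] DERIV_diff fx) auto
    then obtain x where x: "a < x" "x < a + h" "\<Delta> = h * (fx x (b + h) - fx x b)"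
      by (auto simp: \<Delta>_def algebra_simps)
    have "\<exists>y>b. y < b + h \<and> fx x (b + h) - fx x b = (b + h - b) * fxy x y"
      using h x by (intro MVT2 fxy) auto
    then obtain y where y: "b < y" "y < b + h" "\<Delta> = h * (h * fxy x y)"
      using x by auto
    have "\<exists>v>b. v < b + h \<and> (f (a + h) (b + h) - f a (b + h)) - (f (a + h) b - f a b) = (b + h - b) * (fy (a + h) v - fy a v)"
      using h by (intro MVT2[where f = "\<lambda>t. f (a + h) t - f a t" and f' = "\<lambda>t. fy (a + h) t - fy a t"] DERIV_diff fy) auto
    then obtain v where v: "b < v" "v < b + h" "\<Delta> = h * (fy (a + h) v - fy a v)"
      by (auto simp: \<Delta>_def algebra_simps)
    have "\<exists>u>a. u < a + h \<and> fy (a + h) v - fy a v = (a + h - a) * fyx u v"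
      using h v by (intro MVT2[where f = "\<lambda>s. fy s v"] fyx) auto
    then obtain u where u: "a < u" "u < a + h" "\<Delta> = h * (h * fyx u v)"
      using v by auto
    have "fxy x y = fyx u v" using y u h by simp
    moreover have "\<bar>fxy x y - fxy a b\<bar> < r / 2" using x y h by (intro d1) auto
    moreover have "\<bar>fyx u v - fyx a b\<bar> < r / 2" using u v h by (intro d2) auto
    ultimately show ?thesis by linarith
  qed
  then have "\<bar>fxy a b - fyx a b\<bar> \<le> 0" using field_le_epsilon[of "\<bar>fxy a b - fyx a b\<bar>" 0] by simp
  then show ?thesis by simp
qed

lemma partial_commute:
  assumes K: "finite K" and S: "openin (powertop_real K) S" and F: "Ck 2 K S F"
    and p: "p \<in> S" and k: "k \<in> K" and l: "l \<in> K"
  shows "partial k (partial l F) p = partial l (partial (k::'k) F) p"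
proof (cases "k = l")
  case False
  have pK: "p \<in> coord_space K" using openin_subset[OF S] p by auto
  have F1: "Ck 1 K S F" "Ck 1 K S (partial k F)" "Ck 1 K S (partial l F)"
    using F k l by (auto simp: numeral_2_eq_2)
  have c: "continuous_on S (partial k (partial l F))" "continuous_on S (partial l (partial k F))"
    using F1 k l by auto
  obtain e where e: "e > 0" "box_at K p e \<subseteq> S" using S p unfolding openin_powertop_iff[OF K] by blast
  define P where "P s t = p(k := s, l := t)" for s t
  have P: "P s t \<in> box_at K p d" if "\<bar>s - p k\<bar> < d" "\<bar>t - p l\<bar> < d" "d > 0" for s t d
    using that pK k l by (auto simp: box_at_def P_def PiE_iff extensional_def)
  have PS: "P s t \<in> S" if "\<bar>s - p k\<bar> < e" "\<bar>t - p l\<bar> < e" for s t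
    using P[OF that e(1)] e(2) by auto
  have pp: "P (p k) (p l) = p" by (simp add: P_def)
  have Dk: "((\<lambda>s. G (P s t)) has_real_derivative partial k G (P s t)) (at s)"
    if "Ck 1 K S G" "\<bar>s - p k\<bar> < e" "\<bar>t - p l\<bar> < e" for G s t
  proof -
    have "((\<lambda>u. G ((P s t)(k := u))) has_real_derivative partial k G (P s t)) (at (P s t k))"
      using Ck_has_derivative[of 0 K S G, OF _ k PS[OF that(2,3)]] that by simp
    moreover have "(P s t)(k := u) = P u t" for u using False by (auto simp: P_def)
    moreover have "P s t k = s" using False by (auto simp: P_def)
    ultimately show ?thesis by simp
  qed
  have Dl: "((\<lambda>t. G (P s t)) has_real_derivative partial l G (P s t)) (at t)"
    if "Ck 1 K S G" "\<bar>s - p k\<bar> < e" "\<bar>t - p l\<bar> < e" for G s t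
  proof -
    have "((\<lambda>u. G ((P s t)(l := u))) has_real_derivative partial l G (P s t)) (at (P s t l))"
      using Ck_has_derivative[of 0 K S G, OF _ l PS[OF that(2,3)]] that by simp
    moreover have "(P s t)(l := u) = P s u" for u using False by (auto simp: P_def)
    moreover have "P s t l = t" using False by (auto simp: P_def)
    ultimately show ?thesis by simp
  qed
  have cont: "\<exists>d>0. \<forall>s t. \<bar>s - p k\<bar> < d \<longrightarrow> \<bar>t - p l\<bar> < d \<longrightarrow> \<bar>G (P s t) - G (P (p k) (p l))\<bar> < r"
    if "continuous_on S G" "r > 0" for G :: "('k \<Rightarrow> real) \<Rightarrow> real" and r
    using continuous_on_box[OF K S that(1) p that(2)] P unfolding pp by metis
  show ?thesis
    using mixed_derivatives_eq[OF e(1), where f = "\<lambda>s t. F (P s t)" and fx = "\<lambda>s t. partial k F (P s t)"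
        and fy = "\<lambda>s t. partial l F (P s t)" and fxy = "\<lambda>s t. partial l (partial k F) (P s t)"
        and fyx = "\<lambda>s t. partial k (partial l F) (P s t)" and a = "p k" and b = "p l"]
      Dk Dl F1 cont c pp by simp
qed simp

subsection \<open>Smooth functions\<close>

lemma smooth_on_iff:
  "openin (powertop_real K) S \<Longrightarrow> smooth_on K S F \<longleftrightarrow> (\<forall>n. Ck n K S F)"
  using openin_subset[of "powertop_real K" S] by (intro smooth_on_iff_Ck) simp

lemma smooth_on_Ck: "openin (powertop_real K) S \<Longrightarrow> smooth_on K S F \<Longrightarrow> Ck n K S F"
  by (simp add: smooth_on_iff)

lemma smooth_on_continuous: "openin (powertop_real K) S \<Longrightarrow> smooth_on K S F \<Longrightarrow> continuous_on S F"
  by (rule Ck_cont[OF smooth_on_Ck])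

lemma smooth_on_has_derivative:
  "openin (powertop_real K) S \<Longrightarrow> smooth_on K S F \<Longrightarrow> k \<in> K \<Longrightarrow> p \<in> S \<Longrightarrow>
    ((\<lambda>t. F (p(k := t))) has_real_derivative partial k F p) (at (p k))"
  by (rule Ck_has_derivative[OF smooth_on_Ck])

lemma smooth_on_partial:
  "openin (powertop_real K) S \<Longrightarrow> smooth_on K S F \<Longrightarrow> k \<in> K \<Longrightarrow> smooth_on K S (partial k F)"
  unfolding smooth_on_iff
proof
  fix n assume *: "\<forall>n. Ck n K S F" and "k \<in> K"
  then show "Ck n K S (partial k F)" using spec[OF *, of "Suc n"] unfolding Ck.simps by blast
qed

lemma smooth_on_iter_partial:
  "openin (powertop_real K) S \<Longrightarrow> smooth_on K S F \<Longrightarrow> ks \<in> lists K \<Longrightarrow> smooth_on K S (iter_partial ks F)"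
  by (induction ks rule: list.induct) (auto intro: smooth_on_partial)

lemma smooth_on_subset: "smooth_on K S F \<Longrightarrow> S' \<subseteq> S \<Longrightarrow> smooth_on K S' F"
  unfolding smooth_on_def by (auto intro: continuous_map_from_subtopology_mono)

context
  fixes K :: "'k set" and S :: "('k \<Rightarrow> real) set"
  assumes K: "finite K" and S: "openin (powertop_real K) S"
begin

lemma smooth_on_cong: "smooth_on K S F \<Longrightarrow> (\<And>q. q \<in> S \<Longrightarrow> F q = G q) \<Longrightarrow> smooth_on K S G"
  using Ck_cong[OF K S, of _ F G] by (simp add: smooth_on_iff[OF S])

lemma smooth_on_const: "smooth_on K S (\<lambda>_. c)"
  by (simp add: smooth_on_iff[OF S] Ck_const[OF K S])

lemma smooth_on_coord: "smooth_on K S (\<lambda>p. p j)"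
  by (simp add: smooth_on_iff[OF S] Ck_coord[OF K S])

lemma smooth_on_add: "smooth_on K S F \<Longrightarrow> smooth_on K S G \<Longrightarrow> smooth_on K S (\<lambda>p. F p + G p)"
  by (simp add: smooth_on_iff[OF S] Ck_add[OF K S])

lemma smooth_on_mult: "smooth_on K S F \<Longrightarrow> smooth_on K S G \<Longrightarrow> smooth_on K S (\<lambda>p. F p * G p)"
  by (simp add: smooth_on_iff[OF S] Ck_mult[OF K S])

lemma smooth_on_diff:
  assumes "smooth_on K S F" "smooth_on K S G" shows "smooth_on K S (\<lambda>p. F p - G p)"
  using smooth_on_add[OF assms(1) smooth_on_mult[OF smooth_on_const[of "-1"] assms(2)]] by simp

lemma smooth_on_sum: "(\<And>i. i \<in> I \<Longrightarrow> smooth_on K S (F i)) \<Longrightarrow> smooth_on K S (\<lambda>p. \<Sum>i\<in>I. F i p)"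
  by (simp add: smooth_on_iff[OF S] Ck_sum[OF K S])

lemma smooth_on_prod: "(\<And>i. i \<in> I \<Longrightarrow> smooth_on K S (F i)) \<Longrightarrow> smooth_on K S (\<lambda>p. \<Prod>i\<in>I. F i p)"
  by (simp add: smooth_on_iff[OF S] Ck_prod[OF K S])

lemma smooth_on_inverse:
  "smooth_on K S F \<Longrightarrow> (\<And>p. p \<in> S \<Longrightarrow> F p \<noteq> 0) \<Longrightarrow> smooth_on K S (\<lambda>p. inverse (F p))"
  by (simp add: smooth_on_iff[OF S] Ck_inverse[OF K S])

lemma smooth_on_compose:
  assumes "finite L" "openin (powertop_real L) \<Omega>" "smooth_on L \<Omega> F" "T ` S \<subseteq> \<Omega>"
    "\<And>l. l \<in> L \<Longrightarrow> smooth_on K S (\<lambda>p. T p l)"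
  shows "smooth_on K S (\<lambda>p. F (T p))"
  unfolding smooth_on_iff[OF S]
proof
  fix n
  show "Ck n K S (\<lambda>p. F (T p))"
    by (rule Ck_compose[OF K S assms(1,2,4) smooth_on_Ck[OF assms(2,3)] smooth_on_Ck[OF S assms(5)]])
qed

text \<open>Commuting neighbouring derivatives moves \<open>k\<close> from its place in
  \<open>ks'\<close> to the front. This makes the sorted order in \<open>section_deriv\<close> a
  mere convention.\<close>

lemma iter_partial_perm:
  assumes F: "smooth_on K S F"
  shows "ks \<in> lists K \<Longrightarrow> mset ks = mset ks' \<Longrightarrow> p \<in> S \<Longrightarrow> iter_partial ks F p = iter_partial ks' F p"
proof (induction ks arbitrary: ks' p rule: list.induct)
  case (Cons k ks)
  have move: "iter_partial (us @ k # vs) F p = iter_partial (k # us @ vs) F p"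
    if "us @ vs \<in> lists K" "p \<in> S" for us vs p
    using that
  proof (induction us arbitrary: p rule: list.induct)
    case (Cons u us)
    have sm: "smooth_on K S (iter_partial (us @ vs) F)"
      using Cons.prems by (intro smooth_on_iter_partial[OF S F]) auto
    have "iter_partial ((u # us) @ k # vs) F p = partial u (iter_partial (k # us @ vs) F) p"
      using Cons by (auto intro!: partial_cong[OF K S, of p u "iter_partial (us @ k # vs) F"])
    also have "\<dots> = partial k (iter_partial (u # us @ vs) F) p"
      using Cons.prems \<open>k # ks \<in> lists K\<close> by (auto intro!: partial_commute[OF K S smooth_on_Ck[OF S sm]])
    finally show ?case by simp
  qed simp
  have "k \<in> set ks'" using Cons.prems(2) by (metis list.set_intros(1) set_mset_mset)
  then obtain us vs where ks': "ks' = us @ k # vs" by (meson split_list)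
  then have ms: "mset ks = mset (us @ vs)" using Cons.prems(2) by simp
  have "set (us @ vs) = set ks" using ms by (metis set_mset_mset)
  then have l: "us @ vs \<in> lists K" using Cons.prems(1) by (auto simp: lists_eq_set)
  have "iter_partial (k # ks) F p = partial k (iter_partial (us @ vs) F) p"
    using Cons.prems Cons.IH[OF _ ms] by (auto intro!: partial_cong[OF K S, of p k "iter_partial ks F"])
  then show ?case using move[OF l Cons.prems(3)] by (simp add: ks')
qed simp

end

lemma smooth_on_local:
  assumes K: "finite K" and S: "S \<subseteq> coord_space K"
    and "\<And>p. p \<in> S \<Longrightarrow> \<exists>N. openin (powertop_real K) N \<and> p \<in> N \<and> N \<subseteq> S \<and> smooth_on K N F"
  shows "smooth_on K S F"
  unfolding smooth_on_iff_Ck[OF S]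
proof (intro allI Ck_local[OF K S])
  fix n p assume "p \<in> S"
  from assms(3)[OF this] obtain N where N: "openin (powertop_real K) N" "p \<in> N" "N \<subseteq> S" "smooth_on K N F"
    by (elim exE conjE)
  show "\<exists>N. openin (powertop_real K) N \<and> p \<in> N \<and> N \<subseteq> S \<and> Ck n K N F"
    using N(1-3) smooth_on_Ck[OF N(1,4)] by (intro exI[of _ N] conjI)
qed

lemma smooth_on_local_cong:
  assumes K: "finite K" and S: "S \<subseteq> coord_space K"
    and "\<And>p. p \<in> S \<Longrightarrow> \<exists>N G. openin (powertop_real K) N \<and> p \<in> N \<and> N \<subseteq> S \<and> smooth_on K N G \<and> (\<forall>q\<in>N. G q = F q)"
  shows "smooth_on K S F"
proof (rule smooth_on_local[OF K S])
  fix p assume "p \<in> S"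
  from assms(3)[OF this] obtain N G where N: "openin (powertop_real K) N" "p \<in> N" "N \<subseteq> S"
    "smooth_on K N G" "\<forall>q\<in>N. G q = F q"
    by (elim exE conjE)
  have "smooth_on K N F" by (rule smooth_on_cong[OF K N(1,4)]) (use N in simp)
  then show "\<exists>N. openin (powertop_real K) N \<and> p \<in> N \<and> N \<subseteq> S \<and> smooth_on K N F"
    using N(1-3) by (intro exI[of _ N] conjI)
qed

subsection \<open>Bump functions\<close>

text \<open>The exponent \<open>m\<close> makes the family closed under differentiation, so that
  smoothness is one induction for all \<open>m\<close> at once.\<close>

definition flat_exp :: "nat \<Rightarrow> real \<Rightarrow> real" where
  "flat_exp m x = (if x > 0 then (1 / x) ^ m * exp (- (1 / x)) else 0)"

lemma flat_exp_pos: "x > 0 \<Longrightarrow> flat_exp m x > 0"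
  and flat_exp_nonpos: "x \<le> 0 \<Longrightarrow> flat_exp m x = 0"
  by (auto simp: flat_exp_def)

lemma flat_exp_has_derivative:
  "(flat_exp m has_real_derivative flat_exp (m + 2) x - real m * flat_exp (m + 1) x) (at x)"
proof (cases x "0 :: real" rule: linorder_cases)
  case less
  have "((\<lambda>_. 0) has_real_derivative flat_exp (m + 2) x - real m * flat_exp (m + 1) x) (at x)"
    using less by (simp add: flat_exp_def)
  then show ?thesis
    by (rule has_field_derivative_transform_within_open[where S = "{..<0}"])
      (use less in \<open>auto simp: flat_exp_def\<close>)
next
  case greater
  have "((\<lambda>x. (1 / x) ^ m * exp (- (1 / x))) has_real_derivative
      flat_exp (m + 2) x - real m * flat_exp (m + 1) x) (at x)"
    using greater
    by (cases m) (auto intro!: derivative_eq_intros simp: flat_exp_def field_simps power2_eq_square,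
        metis One_nat_def power_eq_if)
  then show ?thesis
    by (rule has_field_derivative_transform_within_open[where S = "{0<..}"])
      (use greater in \<open>auto simp: flat_exp_def\<close>)
next
  case equal
  \<comment> \<open>The difference quotient at zero from the right has the same form with exponent
    \<open>m + 1\<close>, and the exponential in \<open>1 / x\<close> beats every power.\<close>
  have "((\<lambda>x. inverse x ^ (m + 1) / exp (inverse x)) \<longlongrightarrow> (0::real)) (at_right 0)"
    by (rule filterlim_compose[OF tendsto_power_div_exp_0 filterlim_inverse_at_top_right])
  then have R: "((\<lambda>x. flat_exp m x / x) \<longlongrightarrow> 0) (at_right 0)"
    by (rule tendsto_cong[THEN iffD1, rotated])
      (auto simp: eventually_at_filter flat_exp_def exp_minus field_simps)
  have L: "((\<lambda>x. flat_exp m x / x) \<longlongrightarrow> 0) (at_left 0)"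
    by (rule tendsto_cong[THEN iffD1, OF _ tendsto_const])
      (auto simp: eventually_at_filter flat_exp_def)
  have "((\<lambda>x. flat_exp m x / x) \<longlongrightarrow> 0) (at 0)"
    using L R by (simp add: filterlim_split_at)
  then show ?thesis using equal by (simp add: has_field_derivative_iff flat_exp_def)
qed

lemma Ck_flat_exp:
  assumes "finite K" "openin (powertop_real K) S"
  shows "Ck n K S G \<Longrightarrow> Ck n K S (\<lambda>p. flat_exp m (G p))"
proof (induction n arbitrary: m)
  have cont: "continuous_on UNIV (flat_exp m)" for m
    by (rule DERIV_continuous_on[OF has_field_derivative_at_within[OF flat_exp_has_derivative]])
  {
    case 0
    then show ?case by (simp add: continuous_on_compose2[OF cont])
  next
    case (Suc n)
    have D: "((\<lambda>t. flat_exp m (G (p(k := t)))) has_real_derivative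
        (flat_exp (m + 2) (G p) + (- real m) * flat_exp (m + 1) (G p)) * partial k G p) (at (p k))"
      if "k \<in> K" "p \<in> S" for k p
      using DERIV_chain2[OF _ Ck_has_derivative[OF Suc.prems that], of "flat_exp m"]
        flat_exp_has_derivative[of m "G p"] by (simp del: fun_upd_apply)
    show ?case
    proof (rule Ck_SucI[OF assms _ D])
      show "continuous_on S (\<lambda>p. flat_exp m (G p))"
        by (rule continuous_on_compose2[OF cont Ck_cont[OF Suc.prems] subset_UNIV])
      show "Ck n K S (\<lambda>p. (flat_exp (m + 2) (G p) + (- real m) * flat_exp (m + 1) (G p)) * partial k G p)"
        if "k \<in> K" for k
        by (intro Ck_mult Ck_add Ck_const Suc.IH assms Ck_Suc_D[OF Suc.prems]) (use Suc.prems that in auto)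
    qed
  }
qed

text \<open>For finite \<open>K\<close> and \<open>e > 0\<close>, positive exactly where all
  coordinates in \<open>K\<close> are within \<open>e\<close> of those of \<open>a\<close>. The
  squares keep the arguments of \<open>flat_exp\<close> smooth.\<close>

definition bump :: "'k set \<Rightarrow> ('k \<Rightarrow> real) \<Rightarrow> real \<Rightarrow> ('k \<Rightarrow> real) \<Rightarrow> real" where
  "bump K a e p = (\<Prod>k\<in>K. flat_exp 0 (e\<^sup>2 - (p k - a k)\<^sup>2))"

lemma smooth_on_bump:
  assumes L: "finite L" and S: "openin (powertop_real L) S"
  shows "smooth_on L S (bump K a e)"
proof -
  have "smooth_on L S (\<lambda>p. flat_exp 0 (e\<^sup>2 - (p k - a k)\<^sup>2))" for k
    unfolding smooth_on_iff[OF S]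
  proof (intro allI Ck_flat_exp L S)
    fix n
    have "smooth_on L S (\<lambda>p. e\<^sup>2 - (p k - a k)\<^sup>2)"
      unfolding power2_eq_square[of "_ - _"]
      by (intro smooth_on_diff[OF L S] smooth_on_mult[OF L S] smooth_on_const[OF L S] smooth_on_coord[OF L S])
    then show "Ck n L S (\<lambda>p. e\<^sup>2 - (p k - a k)\<^sup>2)" by (rule smooth_on_Ck[OF S])
  qed
  then show ?thesis unfolding bump_def by (intro smooth_on_prod[OF L S])
qed

lemma bump_nonneg: "bump K a e p \<ge> 0"
  unfolding bump_def by (intro prod_nonneg) (auto simp: flat_exp_def)

lemma bump_pos: "(\<And>k. k \<in> K \<Longrightarrow> \<bar>p k - a k\<bar> < e) \<Longrightarrow> bump K a e p > 0"
  unfolding bump_def by (intro prod_pos flat_exp_pos) (metis abs_ge_zero diff_gt_0_iff_gt power2_abs power_strict_mono zero_less_numeral)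

lemma bump_zero:
  assumes "finite K" "k \<in> K" "\<bar>p k - a k\<bar> \<ge> e" "e \<ge> 0" shows "bump K a e p = 0"
  unfolding bump_def
proof (rule prod_zero)
  have "e\<^sup>2 \<le> (p k - a k)\<^sup>2" using assms by (metis power2_abs power_mono)
  then show "\<exists>k\<in>K. flat_exp 0 (e\<^sup>2 - (p k - a k)\<^sup>2) = 0"
    using assms by (intro bexI[of _ k] flat_exp_nonpos) auto
qed (use assms in auto)

subsection \<open>Series of smooth functions\<close>

lemma cbox_at_eq: "cbox_at K a e = PiE K (\<lambda>k. {a k - e .. a k + e})"
  unfolding cbox_at_def PiE_def Pi_def by (auto simp: abs_le_iff algebra_simps)

text \<open>Compactness is used in both topologies: in this one for images under maps into
  manifolds, in that of the function type (next lemma) for bounds on continuous functions.\<close>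

lemma compactin_cbox_at: "compactin (powertop_real K) (cbox_at K a e)"
  unfolding cbox_at_eq by (auto simp: compactin_PiE)

lemma compact_cbox_at: "compact (cbox_at K a e)"
proof -
  \<comment> \<open>Outside \<open>K\<close> the factor is the single point
    \<open>undefined\<close>, so the box is a product of compact sets over the whole index
    type.\<close>
  have "cbox_at K a e = PiE UNIV (\<lambda>k. if k \<in> K then {a k - e .. a k + e} else {undefined})"
    unfolding cbox_at_eq by (auto simp: PiE_def Pi_def extensional_def split: if_splits)
  then have "compactin (product_topology (\<lambda>_. euclidean) UNIV) (cbox_at K a e)"
    by (auto simp: compactin_PiE)
  then show ?thesis by (simp add: euclidean_product_topology)
qed

lemma box_at_subset_cbox_at: "box_at K a e \<subseteq> cbox_at K a e"
  by (force simp: box_at_def cbox_at_def)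

text \<open>For open \<open>S\<close>, a countable family of compact boxes whose open parts cover
  \<open>S\<close>; bounds on these stand for bounds on all compact subsets.\<close>

definition rat_boxes :: "'k set \<Rightarrow> ('k \<Rightarrow> real) set \<Rightarrow> (('k \<Rightarrow> real) \<times> real) set" where
  "rat_boxes K S = {(a, e). a \<in> PiE K (\<lambda>_. \<rat>) \<and> e \<in> \<rat> \<and> e > 0 \<and> cbox_at K a e \<subseteq> S}"

lemma countable_rat_boxes: "finite K \<Longrightarrow> countable (rat_boxes K S)"
  by (rule countable_subset[of _ "PiE K (\<lambda>_. \<rat>) \<times> \<rat>"])
    (auto simp: rat_boxes_def intro!: countable_SIGMA countable_PiE countable_rat)

lemma rat_boxes_cover:
  assumes K: "finite K" and S: "openin (powertop_real K) S" and p: "p \<in> S"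
  obtains a e where "(a, e) \<in> rat_boxes K S" "p \<in> box_at K a e"
proof -
  obtain d where d: "d > 0" "box_at K p d \<subseteq> S" using S p unfolding openin_powertop_iff[OF K] by blast
  \<comment> \<open>The closed box around \<open>a\<close> then reaches less than
    \<open>2 * e < d\<close> from \<open>p\<close>.\<close>
  obtain e where e: "e \<in> \<rat>" "0 < e" "e < d / 2" using Rats_dense_in_real[of 0 "d / 2"] d(1) by auto
  have "\<exists>x\<in>\<rat>. \<bar>p k - x\<bar> < e" for k
  proof -
    obtain x where "x \<in> \<rat>" "p k - e < x" "x < p k + e"
      using Rats_dense_in_real[of "p k - e" "p k + e"] e(2) by auto
    then show ?thesis by (intro bexI[of _ x]) (auto simp: abs_less_iff)
  qed
  then obtain x where x: "\<And>k. x k \<in> \<rat>" "\<And>k. \<bar>p k - x k\<bar> < e" by metis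
  define a where "a = restrict x K"
  have pK: "p \<in> coord_space K" using openin_subset[OF S] p by auto
  show thesis
  proof (rule that[of a e])
    have "q \<in> box_at K p d" if q: "q \<in> cbox_at K a e" for q
    proof -
      have "\<bar>q k - p k\<bar> < d" if "k \<in> K" for k
        using q x(2)[of k] that e(3) unfolding cbox_at_def a_def by auto
      then show ?thesis using q by (auto simp: cbox_at_def box_at_def)
    qed
    then show "(a, e) \<in> rat_boxes K S" using d e x by (auto simp: rat_boxes_def a_def)
    show "p \<in> box_at K a e" using x pK by (auto simp: box_at_def a_def)
  qed
qed

lemma iter_partial_cmult:
  assumes K: "finite K" and S: "openin (powertop_real K) S" and F: "smooth_on K S F"
    and "ks \<in> lists K" "p \<in> S"
  shows "iter_partial ks (\<lambda>p. c * F p) p = c * iter_partial ks F p"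
  using assms(4,5)
proof (induction ks arbitrary: p rule: list.induct)
  case (Cons k ks)
  then have k: "k \<in> K" "ks \<in> lists K" by auto
  have "iter_partial (k # ks) (\<lambda>p. c * F p) p = partial k (\<lambda>p. c * iter_partial ks F p) p"
    using partial_cong[OF K S Cons.prems(2) k(1), of "iter_partial ks (\<lambda>p. c * F p)"] Cons.IH[OF k(2)] by simp
  also have "\<dots> = c * partial k (iter_partial ks F) p"
    by (rule partial_eqI, rule DERIV_cmult)
      (rule smooth_on_has_derivative[OF S smooth_on_iter_partial[OF S F k(2)] k(1) Cons.prems(2)])
  finally show ?case by simp
qed simp

text \<open>Each bound is only required from some index on, which may depend on the box and on the
  derivative. This is what one sequence of weights can achieve for countably many bounds.\<close>

definition rapidly_summable :: "'k set \<Rightarrow> ('k \<Rightarrow> real) set \<Rightarrow> (nat \<Rightarrow> ('k \<Rightarrow> real) \<Rightarrow> real) \<Rightarrow> bool" where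
  "rapidly_summable K S f \<longleftrightarrow> (\<forall>n. smooth_on K S (f n)) \<and>
    (\<forall>(a, e)\<in>rat_boxes K S. \<forall>ks\<in>lists K. \<forall>\<^sub>F n in sequentially.
       \<forall>p\<in>cbox_at K a e. \<bar>iter_partial ks (f n) p\<bar> \<le> (1 / 2) ^ n)"

text \<open>The derivative along \<open>ks\<close> of \<open>partial k (f n)\<close> is the one
  along \<open>ks @ [k]\<close> of \<open>f n\<close>, for which a bound is already assumed.\<close>

lemma rapidly_summable_partial:
  assumes S: "openin (powertop_real K) S" and f: "rapidly_summable K S f" and k: "k \<in> K"
  shows "rapidly_summable K S (\<lambda>n. partial k (f n))"
  unfolding rapidly_summable_def
proof (intro conjI allI ballI, goal_cases)
  case (1 n)
  then show ?case using smooth_on_partial[OF S _ k] f by (auto simp: rapidly_summable_def)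
next
  case (2 ae)
  have *: "iter_partial ks (partial k F) = iter_partial (ks @ [k]) F" for ks F
    by (simp add: iter_partial_append)
  obtain a e where ae: "ae = (a, e)" "(a, e) \<in> rat_boxes K S" using 2 by (cases ae) auto
  have "\<forall>\<^sub>F n in sequentially. \<forall>p\<in>cbox_at K a e. \<bar>iter_partial ks (f n) p\<bar> \<le> (1 / 2) ^ n"
    if "ks \<in> lists K" for ks
    using f ae(2) that unfolding rapidly_summable_def by blast
  from this[of "_ @ [k]"] show ?case
    unfolding ae(1) prod.case * using k by simp
qed

lemma rapidly_summable_uniform:
  assumes f: "rapidly_summable K S f" and ae: "(a, e) \<in> rat_boxes K S"
  shows "uniform_limit (cbox_at K a e) (\<lambda>n p. \<Sum>i<n. f i p) (\<lambda>p. \<Sum>i. f i p) sequentially"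
    and "p \<in> cbox_at K a e \<Longrightarrow> summable (\<lambda>n. f n p)"
proof -
  have ev: "\<forall>\<^sub>F n in sequentially. \<forall>p\<in>cbox_at K a e. \<bar>iter_partial [] (f n) p\<bar> \<le> (1 / 2) ^ n"
    using f ae unfolding rapidly_summable_def by blast
  have s: "summable (\<lambda>n. (1 / 2 :: real) ^ n)" by (simp add: summable_geometric)
  show "uniform_limit (cbox_at K a e) (\<lambda>n p. \<Sum>i<n. f i p) (\<lambda>p. \<Sum>i. f i p) sequentially"
    by (rule Weierstrass_m_test_ev[OF _ s]) (use ev in simp)
  show "p \<in> cbox_at K a e \<Longrightarrow> summable (\<lambda>n. f n p)"
    by (rule summable_comparison_test_ev[OF _ s]) (use ev in \<open>auto elim: eventually_mono\<close>)
qed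

text \<open>By Weierstrass's test the series and the series of derivatives converge uniformly on
  each box, so the sum may be differentiated term by term. The derived series is again rapidly
  summable, which keeps the induction going.\<close>

lemma rapidly_summable_Ck:
  assumes K: "finite K" and S: "openin (powertop_real K) S"
  shows "rapidly_summable K S f \<Longrightarrow> Ck N K S (\<lambda>p. \<Sum>n. f n p)"
proof (induction N arbitrary: f)
  have cont: "continuous_on S (\<lambda>p. \<Sum>n. f n p)" if f: "rapidly_summable K S f" for f
  proof (rule continuous_on_local)
    show SK: "S \<subseteq> coord_space K" using openin_subset[OF S] by simp
    fix p assume "p \<in> S"
    then obtain a e where ae: "(a, e) \<in> rat_boxes K S" "p \<in> box_at K a e" by (rule rat_boxes_cover[OF K S])
    have sub: "box_at K a e \<subseteq> S" "cbox_at K a e \<subseteq> S"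
      using ae(1) box_at_subset_cbox_at[of K a e] by (auto simp: rat_boxes_def)
    have "continuous_on (cbox_at K a e) (\<lambda>p. \<Sum>n. f n p)"
    proof (rule uniform_limit_theorem[OF _ rapidly_summable_uniform(1)[OF f ae(1)]])
      show "\<forall>\<^sub>F n in sequentially. continuous_on (cbox_at K a e) (\<lambda>p. \<Sum>i<n. f i p)"
        using f continuous_on_subset[OF smooth_on_continuous[OF S] sub(2)]
        by (auto simp: rapidly_summable_def intro!: always_eventually continuous_on_sum)
    qed simp
    then show "\<exists>N. openin (powertop_real K) N \<and> p \<in> N \<and> N \<subseteq> S \<and> continuous_on N (\<lambda>p. \<Sum>n. f n p)"
      using openin_box_at[OF K] ae(2) sub continuous_on_subset box_at_subset_cbox_at by metis
  qed
  {
    case 0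
    then show ?case using cont by simp
  next
    case (Suc N)
    show ?case
    proof (rule Ck_SucI[OF K S cont[OF Suc.prems], where D = "\<lambda>k p. \<Sum>n. partial k (f n) p"])
      fix k assume k: "k \<in> K"
      have f': "rapidly_summable K S (\<lambda>n. partial k (f n))" by (rule rapidly_summable_partial[OF S Suc.prems k])
      show "Ck N K S (\<lambda>p. \<Sum>n. partial k (f n) p)" by (rule Suc.IH[OF f'])
      fix p assume "p \<in> S"
      then obtain a e where ae: "(a, e) \<in> rat_boxes K S" "p \<in> box_at K a e" by (rule rat_boxes_cover[OF K S])
      have sub: "cbox_at K a e \<subseteq> S" using ae(1) by (auto simp: rat_boxes_def)
      define J where "J = {a k - e .. a k + e}"
      have J: "p(k := t) \<in> cbox_at K a e" if "t \<in> J" for t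
        using ae(2) k that unfolding J_def box_at_def cbox_at_def
        by (auto simp: PiE_iff extensional_def abs_le_iff)
      have pk: "p k \<in> interior J"
        using ae(2) k by (auto simp: J_def box_at_def abs_less_iff interior_atLeastAtMost_real)
      have p': "(p(k := t)) k = t" "(p(k := t))(k := u) = p(k := u)" for t u by auto
      show "((\<lambda>t. \<Sum>n. f n (p(k := t))) has_real_derivative (\<Sum>n. partial k (f n) p)) (at (p k))"
      proof -
        have "((\<lambda>t. \<Sum>n. f n (p(k := t))) has_real_derivative (\<Sum>n. partial k (f n) (p(k := p k)))) (at (p k))"
        proof (rule has_field_derivative_series'(2)[of J])
          show "convex J" by (simp add: J_def)
          show "p k \<in> J" using pk interior_subset by blast
          show "p k \<in> interior J" by (rule pk)
          show "summable (\<lambda>n. f n (p(k := p k)))"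
            using rapidly_summable_uniform(2)[OF Suc.prems ae(1)] ae(2) box_at_subset_cbox_at[of K a e] by auto
          show "((\<lambda>t. f n (p(k := t))) has_real_derivative partial k (f n) (p(k := t))) (at t within J)"
            if "t \<in> J" for n t
          proof -
            have "smooth_on K S (f n)" using Suc.prems by (simp add: rapidly_summable_def)
            moreover have "p(k := t) \<in> S" using J[OF that] sub by auto
            ultimately have "((\<lambda>u. f n ((p(k := t))(k := u))) has_real_derivative partial k (f n) (p(k := t)))
                (at ((p(k := t)) k))"
              by (intro smooth_on_has_derivative[OF S _ k])
            then show ?thesis unfolding p' by (rule has_field_derivative_at_within)
          qed
          have "uniform_limit J (\<lambda>n t. \<Sum>i<n. partial k (f i) (p(k := t))) (\<lambda>t. \<Sum>i. partial k (f i) (p(k := t))) sequentially"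
            by (rule uniform_limit_compose'[OF rapidly_summable_uniform(1)[OF f' ae(1)]]) (use J in auto)
          then show "uniformly_convergent_on J (\<lambda>n t. \<Sum>i<n. partial k (f i) (p(k := t)))"
            unfolding uniformly_convergent_on_def by blast
        qed
        then show ?thesis by simp
      qed
    qed
  }
qed

text \<open>A diagonal argument: the denominator at \<open>n\<close> dominates the bounds numbered
  up to \<open>n\<close>, hence the bound numbered \<open>j\<close> as soon as
  \<open>n \<ge> j\<close>. The summand \<open>1\<close> keeps it positive.\<close>

lemma ex_weights:
  fixes B :: "'q \<Rightarrow> nat \<Rightarrow> real"
  assumes Q: "countable Q" and B: "\<And>q n. q \<in> Q \<Longrightarrow> B q n \<ge> 0"
  shows "\<exists>w. (\<forall>n. w n > 0) \<and> (\<forall>q\<in>Q. \<forall>\<^sub>F n in sequentially. w n * B q n \<le> (1 / 2) ^ n)"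
proof (cases "Q = {}")
  case True
  then show ?thesis by (intro exI[of _ "\<lambda>_. 1"]) auto
next
  case False
  define T where "T n = (\<Sum>j\<le>n. B (from_nat_into Q j) n)" for n
  define w where "w n = (1 / 2) ^ n / (1 + T n)" for n
  have fQ: "from_nat_into Q j \<in> Q" for j using False by (simp add: from_nat_into)
  have T: "T n \<ge> 0" for n using B fQ unfolding T_def by (intro sum_nonneg) auto
  have "w n > 0" for n using T[of n] by (simp add: w_def)
  moreover have "\<forall>\<^sub>F n in sequentially. w n * B q n \<le> (1 / 2) ^ n" if qQ: "q \<in> Q" for q
  proof -
    obtain j where j: "q = from_nat_into Q j" using from_nat_into_surj[OF Q qQ] by metis
    have "w n * B q n \<le> (1 / 2) ^ n" if "n \<ge> j" for n
    proof -
      have "B q n \<le> T n" unfolding T_def j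
        using that B fQ by (intro member_le_sum[of j "{..n}" "\<lambda>j. B (from_nat_into Q j) n"]) auto
      then have "(1 / 2) ^ n * B q n \<le> (1 / 2) ^ n * (1 + T n)" by (intro mult_left_mono) auto
      then show ?thesis using T[of n] by (simp add: w_def pos_divide_le_eq)
    qed
    then show ?thesis by (auto simp: eventually_sequentially)
  qed
  ultimately show ?thesis by blast
qed

text \<open>One sequence of weights serves countably many series simultaneously: the suprema of all
  derivatives over all rational boxes form a countable family of bounds.\<close>

lemma ex_smooth_weighted_series:
  fixes F :: "'i \<Rightarrow> nat \<Rightarrow> ('k \<Rightarrow> real) \<Rightarrow> real"
  assumes K: "finite K" and I: "countable I" and S: "\<And>i. i \<in> I \<Longrightarrow> openin (powertop_real K) (S i)"
    and F: "\<And>i n. i \<in> I \<Longrightarrow> smooth_on K (S i) (F i n)"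
  obtains w :: "nat \<Rightarrow> real" where "\<And>n. w n > 0"
    "\<And>i. i \<in> I \<Longrightarrow> smooth_on K (S i) (\<lambda>p. \<Sum>n. w n * F i n p)"
    "\<And>i p. i \<in> I \<Longrightarrow> p \<in> S i \<Longrightarrow> summable (\<lambda>n. w n * F i n p)"
proof -
  define P where "P i a e ks n b \<longleftrightarrow> (b \<ge> 0 \<and> (\<forall>p\<in>cbox_at K a e. \<bar>iter_partial ks (F i n) p\<bar> \<le> (b::real)))" for i a e ks n b
  define B where "B = (\<lambda>(i, (a, e), ks) n. SOME b. P i a e ks n b)"
  define Q where "Q = (SIGMA i:I. rat_boxes K (S i) \<times> lists K)"
  have BP: "P i a e ks n (B (i, (a, e), ks) n)" if "(i, (a, e), ks) \<in> Q" for i a e ks n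
  proof -
    have i: "i \<in> I" "cbox_at K a e \<subseteq> S i" "ks \<in> lists K" using that by (auto simp: Q_def rat_boxes_def)
    have "continuous_on (cbox_at K a e) (iter_partial ks (F i n))"
      using smooth_on_continuous[OF S[OF i(1)] smooth_on_iter_partial[OF S[OF i(1)] F[OF i(1)] i(3)]] i(2)
        continuous_on_subset by blast
    from compact_imp_bounded[OF compact_continuous_image[OF this compact_cbox_at]]
    obtain b where "\<forall>p\<in>cbox_at K a e. \<bar>iter_partial ks (F i n) p\<bar> \<le> b"
      unfolding bounded_iff by auto
    then have "P i a e ks n (max 0 b)" unfolding P_def by force
    then show ?thesis unfolding B_def prod.case by (rule someI)
  qed
  have Qc: "countable Q"
    unfolding Q_def using I countable_rat_boxes[OF K] K
    by (intro countable_SIGMA countable_lists) (auto intro: countable_finite)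
  have B0: "B q n \<ge> 0" if "q \<in> Q" for q n
    using BP[of "fst q" "fst (fst (snd q))" "snd (fst (snd q))" "snd (snd q)"] that by (simp add: P_def)
  obtain w where w: "\<And>n. w n > 0" "\<And>q. q \<in> Q \<Longrightarrow> \<forall>\<^sub>F n in sequentially. w n * B q n \<le> (1 / 2) ^ n"
    using ex_weights[of Q B, OF Qc B0] by blast
  have rap: "rapidly_summable K (S i) (\<lambda>n p. w n * F i n p)" if i: "i \<in> I" for i
    unfolding rapidly_summable_def
  proof (intro conjI allI ballI, goal_cases)
    case (1 n)
    show ?case by (intro smooth_on_mult[OF K S[OF i]] smooth_on_const[OF K S[OF i]] F i)
  next
    case (2 ae)
    obtain a e where ae: "ae = (a, e)" "(a, e) \<in> rat_boxes K (S i)" using 2 by (cases ae) auto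
    have "\<forall>\<^sub>F n in sequentially. \<forall>p\<in>cbox_at K a e. \<bar>iter_partial ks (\<lambda>p. w n * F i n p) p\<bar> \<le> (1 / 2) ^ n"
      if ks: "ks \<in> lists K" for ks
    proof -
      have q: "(i, (a, e), ks) \<in> Q" using i ae ks by (auto simp: Q_def)
      show ?thesis using w(2)[OF q]
      proof eventually_elim
        case (elim n)
        show ?case
        proof
          fix p assume p: "p \<in> cbox_at K a e"
          then have "p \<in> S i" using ae(2) by (auto simp: rat_boxes_def)
          then have "\<bar>iter_partial ks (\<lambda>p. w n * F i n p) p\<bar> = w n * \<bar>iter_partial ks (F i n) p\<bar>"
            using iter_partial_cmult[OF K S[OF i] F[OF i] ks] w(1)[of n] by (simp add: abs_mult)
          also have "\<dots> \<le> w n * B (i, (a, e), ks) n"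
            using BP[OF q, of n] p w(1)[of n] by (intro mult_left_mono) (auto simp: P_def)
          finally show "\<bar>iter_partial ks (\<lambda>p. w n * F i n p) p\<bar> \<le> (1 / 2) ^ n" using elim by simp
        qed
      qed
    qed
    then show ?case by (simp add: ae)
  qed
  show thesis
  proof (rule that[of w])
    fix i assume i: "i \<in> I"
    show "smooth_on K (S i) (\<lambda>p. \<Sum>n. w n * F i n p)"
      using rapidly_summable_Ck[OF K S[OF i] rap[OF i]] by (simp add: smooth_on_iff[OF S[OF i]])
    fix p assume "p \<in> S i"
    then obtain a e where "(a, e) \<in> rat_boxes K (S i)" "p \<in> box_at K a e" by (rule rat_boxes_cover[OF K S[OF i]])
    then show "summable (\<lambda>n. w n * F i n p)"
      using rapidly_summable_uniform(2)[OF rap[OF i]] box_at_subset_cbox_at[of K a e] by blast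
  qed (rule w(1))
qed

subsection \<open>Hadamard's lemma\<close>

definition homothety :: "'k set \<Rightarrow> ('k \<Rightarrow> real) \<Rightarrow> real \<Rightarrow> ('k \<Rightarrow> real) \<Rightarrow> 'k \<Rightarrow> real" where
  "homothety K p t q = (\<lambda>k\<in>K. p k + t * (q k - p k))"

lemma continuous_on_homothety:
  assumes F: "continuous_on S F" and star: "\<And>q t. q \<in> S \<Longrightarrow> 0 \<le> t \<Longrightarrow> t \<le> 1 \<Longrightarrow> homothety K p t q \<in> S"
  shows "continuous_on (S \<times> {0..1}) (\<lambda>x. F (homothety K p (snd x) (fst x)))"
proof (rule continuous_on_compose2[OF F])
  show "continuous_on (S \<times> {0..1}) (\<lambda>x. homothety K p (snd x) (fst x))"
  proof (rule continuous_on_coordinatewise_then_product)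
    fix k
    have "continuous_on (S \<times> {0..1 :: real}) (\<lambda>x. fst x k)"
      by (rule continuous_on_product_then_coordinatewise) (auto intro: continuous_intros)
    then show "continuous_on (S \<times> {0..1}) (\<lambda>x. homothety K p (snd x) (fst x) k)"
      by (cases "k \<in> K") (auto simp: homothety_def intro!: continuous_intros)
  qed
qed (use star in auto)

lemma continuous_on_Pair_const: "continuous_on A (Pair x)"
  using continuous_on_Pair[OF continuous_on_const[of A x] continuous_on_id[of A]] by simp

text \<open>Differentiating in a coordinate of \<open>q\<close> brings out a factor
  \<open>t\<close>. Carrying the power \<open>t ^ m\<close> makes the derivative an integral of the
  same form, with \<open>Suc m\<close> and \<open>partial k F\<close>.\<close>

lemma Ck_integral_homothety:
  assumes K: "finite K" and S: "openin (powertop_real K) S"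
    and star: "\<And>q t. q \<in> S \<Longrightarrow> 0 \<le> t \<Longrightarrow> t \<le> 1 \<Longrightarrow> homothety K p t q \<in> S"
  shows "Ck n K S F \<Longrightarrow> Ck n K S (\<lambda>q. integral {0..1} (\<lambda>t. t ^ m * F (homothety K p t q)))"
proof (induction n arbitrary: F m)
  have cont: "continuous_on (S \<times> {0..1}) (\<lambda>(q, t). t ^ m * F (homothety K p t q))"
    if "continuous_on S F" for F and m :: nat
    unfolding case_prod_beta
    by (intro continuous_intros continuous_on_homothety[OF that star]) auto
  have icont: "continuous_on S (\<lambda>q. integral {0..1} (\<lambda>t. t ^ m * F (homothety K p t q)))"
    if "continuous_on S F" for F and m :: nat
  proof -
    have "continuous_on (S \<times> cbox 0 1) (\<lambda>(q, t). t ^ m * F (homothety K p t q))"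
      using cont[OF that] by simp
    from integral_continuous_on_param[OF this] show ?thesis by simp
  qed
  {
    case 0
    then show ?case using icont by simp
  next
    case (Suc n)
    note F = Suc.prems
    show ?case
    proof (rule Ck_SucI[OF K S icont[OF Ck_cont[OF F]],
          where D = "\<lambda>k q. integral {0..1} (\<lambda>t. t ^ Suc m * partial k F (homothety K p t q))"])
      fix k assume k: "k \<in> K"
      have F': "Ck n K S (partial k F)" using F k by simp
      show "Ck n K S (\<lambda>q. integral {0..1} (\<lambda>t. t ^ Suc m * partial k F (homothety K p t q)))"
        by (rule Suc.IH[OF F'])
      fix q assume q: "q \<in> S"
      have qK: "q \<in> coord_space K" using openin_subset[OF S] q by auto
      obtain e where e: "e > 0" "box_at K q e \<subseteq> S" using S q unfolding openin_powertop_iff[OF K] by blast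
      define U where "U = {q k - e <..< q k + e}"
      have U: "q(k := s) \<in> S" if "s \<in> U" for s
        using that qK k by (intro subsetD[OF e(2)]) (auto simp: box_at_def U_def PiE_iff extensional_def abs_less_iff)
      have "((\<lambda>s. integral (cbox 0 1) (\<lambda>t. t ^ m * F (homothety K p t (q(k := s))))) has_real_derivative
          integral (cbox 0 1) (\<lambda>t. t ^ Suc m * partial k F (homothety K p t (q(k := q k))))) (at (q k) within U)"
      proof (rule leibniz_rule_field_derivative[where fx = "\<lambda>s t. t ^ Suc m * partial k F (homothety K p t (q(k := s)))"])
        fix s t assume s: "s \<in> U" and t: "t \<in> cbox 0 (1 :: real)"
        \<comment> \<open>Putting \<open>u\<close> for coordinate \<open>k\<close> of
          \<open>q\<close> puts \<open>p k + t * (u - p k)\<close> for that of \<open>r\<close>;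
          this is the source of the factor \<open>t\<close>.\<close>
        define r where "r = homothety K p t (q(k := s))"
        have r: "r \<in> S" using star[OF U[OF s]] t by (auto simp: r_def)
        have eq: "homothety K p t (q(k := u)) = r(k := p k + t * (u - p k))" for u
          using k by (auto simp: homothety_def r_def fun_eq_iff)
        have rk: "r k = p k + t * (s - p k)" using k by (simp add: r_def homothety_def)
        have "((\<lambda>v. F (r(k := v))) has_real_derivative partial k F r) (at (p k + t * (s - p k)))"
          using Ck_has_derivative[OF F k r] by (simp add: rk del: fun_upd_apply)
        moreover have "((\<lambda>u. p k + t * (u - p k)) has_real_derivative t) (at s within U)"
          by (auto intro!: derivative_eq_intros)
        ultimately have "((\<lambda>u. F (r(k := p k + t * (u - p k)))) has_real_derivative partial k F r * t) (at s within U)"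
          by (rule DERIV_chain2)
        then have "((\<lambda>u. t ^ m * F (r(k := p k + t * (u - p k)))) has_real_derivative t ^ m * (partial k F r * t)) (at s within U)"
          by (rule DERIV_cmult)
        then show "((\<lambda>s. t ^ m * F (homothety K p t (q(k := s)))) has_real_derivative
            t ^ Suc m * partial k F (homothety K p t (q(k := s)))) (at s within U)"
          unfolding eq[symmetric] r_def[symmetric] by (simp add: mult_ac)
      next
        fix s assume s: "s \<in> U"
        have "continuous_on (cbox 0 1) (\<lambda>t. t ^ m * F (homothety K p t (q(k := s))))"
          using continuous_on_compose2[OF cont[OF Ck_cont[OF F], of m], of "cbox 0 1" "\<lambda>t. (q(k := s), t)"] U[OF s]
          by (auto intro: continuous_on_Pair_const)
        then show "(\<lambda>t. t ^ m * F (homothety K p t (q(k := s)))) integrable_on cbox 0 1"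
          by (rule integrable_continuous)
      next
        have upd: "continuous_on (U \<times> cbox 0 (1 :: real)) (\<lambda>x. (q(k := fst x), snd x))"
        proof (intro continuous_on_Pair)
          show "continuous_on (U \<times> cbox 0 (1 :: real)) (\<lambda>x. q(k := fst x))"
          proof (rule continuous_on_coordinatewise_then_product)
            fix j show "continuous_on (U \<times> cbox 0 (1 :: real)) (\<lambda>x. (q(k := fst x)) j)"
              by (cases "j = k") (auto intro: continuous_intros)
          qed
        qed (auto intro: continuous_intros)
        show "continuous_on (U \<times> cbox 0 1) (\<lambda>(s, t). t ^ Suc m * partial k F (homothety K p t (q(k := s))))"
        proof -
          have "(\<lambda>x. (q(k := fst x), snd x)) ` (U \<times> cbox 0 (1 :: real)) \<subseteq> S \<times> {0..1}"
            using U by (auto simp del: fun_upd_apply)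
          from continuous_on_compose2[OF cont[OF Ck_cont[OF F'], of "Suc m"] upd this]
          show ?thesis by (simp add: case_prod_beta del: fun_upd_apply)
        qed
      qed (use e in \<open>auto simp: U_def\<close>)
      moreover have "at (q k) within U = at (q k)"
        by (rule at_within_open) (use e in \<open>auto simp: U_def\<close>)
      ultimately show "((\<lambda>s. integral {0..1} (\<lambda>t. t ^ m * F (homothety K p t (q(k := s))))) has_real_derivative
          integral {0..1} (\<lambda>t. t ^ Suc m * partial k F (homothety K p t q))) (at (q k))"
        by (simp del: fun_upd_apply)
    qed
  }
qed

text \<open>Integrate the derivative of \<open>F\<close> along the segment from \<open>p\<close> to
  \<open>q\<close>. \<open>G k\<close> is the mean of \<open>partial k F\<close> over the segment;
  for \<open>q = p\<close> its integrand is constant.\<close>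

lemma hadamard:
  assumes K: "finite K" and S: "openin (powertop_real K) S" and p: "p \<in> S"
    and star: "\<And>q t. q \<in> S \<Longrightarrow> 0 \<le> t \<Longrightarrow> t \<le> 1 \<Longrightarrow> homothety K p t q \<in> S"
    and F: "smooth_on K S F"
  obtains G where "\<And>k. k \<in> K \<Longrightarrow> smooth_on K S (G k)" "\<And>k. k \<in> K \<Longrightarrow> G k p = partial k F p"
    "\<And>q. q \<in> S \<Longrightarrow> F q = F p + (\<Sum>k\<in>K. (q k - p k) * G k q)"
proof
  \<comment> \<open>The factor \<open>t ^ 0\<close> gives \<open>G\<close> the shape treated by
    \<open>Ck_integral_homothety\<close>.\<close>
  define G where "G k q = integral {0..1} (\<lambda>t. t ^ 0 * partial k F (homothety K p t q))" for k q
  have pK: "p \<in> coord_space K" using openin_subset[OF S] p by auto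
  have hp: "homothety K p t p = p" for t using pK by (auto simp: homothety_def PiE_iff extensional_def)
  show "smooth_on K S (G k)" if "k \<in> K" for k
    unfolding smooth_on_iff[OF S] G_def
    using Ck_integral_homothety[OF K S star] smooth_on_Ck[OF S smooth_on_partial[OF S F that]] by blast
  show "G k p = partial k F p" for k by (simp add: G_def hp)
  show "F q = F p + (\<Sum>k\<in>K. (q k - p k) * G k q)" if q: "q \<in> S" for q
  proof -
    have qK: "q \<in> coord_space K" using openin_subset[OF S] q by auto
    have h: "homothety K p 0 q = p" "homothety K p 1 q = q"
      using pK qK by (auto simp: homothety_def PiE_iff extensional_def)
    have "((\<lambda>t. F (homothety K p t q)) has_vector_derivative
        (\<Sum>k\<in>K. partial k F (homothety K p t q) * (q k - p k))) (at t within {0..1})" if "t \<in> {0..1}" for t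
    proof -
      have "((\<lambda>t. F (homothety K p t q)) has_real_derivative
          (\<Sum>k\<in>K. partial k F (homothety K p t q) * (q k - p k))) (at t)"
      proof (rule chain_rule_path[OF K S])
        show "Ck 1 K S F" by (rule smooth_on_Ck[OF S F])
        show "homothety K p t q \<in> S" using star[OF q] that by simp
        show "\<forall>\<^sub>F t in nhds t. homothety K p t q \<in> coord_space K"
          by (simp add: homothety_def)
        show "((\<lambda>t. homothety K p t q k) has_real_derivative q k - p k) (at t)" if "k \<in> K" for k
          using that by (auto simp: homothety_def intro!: derivative_eq_intros)
      qed
      then show ?thesis
        by (simp add: has_real_derivative_iff_has_vector_derivative has_vector_derivative_at_within)
    qed
    then have "((\<lambda>t. \<Sum>k\<in>K. partial k F (homothety K p t q) * (q k - p k)) has_integral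
        F (homothety K p 1 q) - F (homothety K p 0 q)) {0..1}"
      by (intro fundamental_theorem_of_calculus) auto
    then have I: "((\<lambda>t. \<Sum>k\<in>K. partial k F (homothety K p t q) * (q k - p k)) has_integral F q - F p) {0..1}"
      by (simp add: h)
    have "((\<lambda>t. \<Sum>k\<in>K. partial k F (homothety K p t q) * (q k - p k)) has_integral
        (\<Sum>k\<in>K. G k q * (q k - p k))) {0..1}"
    proof (intro has_integral_sum K has_integral_mult_left)
      fix k assume k: "k \<in> K"
      have "continuous_on S (partial k F)" by (rule smooth_on_continuous[OF S smooth_on_partial[OF S F k]])
      then have "continuous_on {0..1} (\<lambda>t. partial k F (homothety K p t q))"
        using continuous_on_compose2[OF continuous_on_homothety[OF _ star], of "partial k F" "{0..1}" "\<lambda>t. (q, t)"] q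
        by (auto intro: continuous_on_Pair_const)
      then show "((\<lambda>t. partial k F (homothety K p t q)) has_integral G k q) {0..1}"
        unfolding G_def by (simp add: integrable_continuous_real integrable_integral)
    qed
    then have "F q - F p = (\<Sum>k\<in>K. G k q * (q k - p k))" by (rule has_integral_unique[OF I])
    then show ?thesis by (simp add: mult.commute algebra_simps)
  qed
qed

section \<open>Charts\<close>

lemma in_chart_cmap: "inj_on (cmap c) (cdom c) \<Longrightarrow> a \<in> cdom c \<Longrightarrow> in_chart c f (cmap c a) = f a"
  by (simp add: in_chart_def)

context
  fixes T :: "'a topology" and n :: nat and c :: "('a, nat) chart"
  assumes c: "top_chart T n c"
begin

lemma top_chart_open: "openin T (cdom c)"
  using c by (simp add: top_chart_def)

lemma top_chart_topspace: "topspace (subtopology T (cdom c)) = cdom c"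
  using openin_subset[OF top_chart_open] by auto

lemma top_chart_inj: "inj_on (cmap c) (cdom c)"
  using c homeomorphic_imp_injective_map top_chart_topspace unfolding top_chart_def by metis

lemma top_chart_image_open:
  assumes "openin T W" shows "openin (powertop_real {..<n}) (cmap c ` (cdom c \<inter> W))"
proof -
  have "openin (subtopology T (cdom c)) (cdom c \<inter> W)"
    using assms by (auto simp: openin_subtopology)
  then have "openin (subtopology (powertop_real {..<n}) (cmap c ` cdom c)) (cmap c ` (cdom c \<inter> W))"
    using c homeomorphic_imp_open_map unfolding top_chart_def open_map_def by blast
  then show ?thesis using c unfolding top_chart_def by (meson openin_trans_full)
qed

lemma top_chart_image_open': "openin T W \<Longrightarrow> W \<subseteq> cdom c \<Longrightarrow> openin (powertop_real {..<n}) (cmap c ` W)"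
  using top_chart_image_open[of W] by (simp add: Int_absorb1)

lemma top_chart_continuous: "continuous_map (subtopology T (cdom c)) (powertop_real {..<n}) (cmap c)"
  using c homeomorphic_imp_continuous_map continuous_map_into_fulltopology
  unfolding top_chart_def by blast

text \<open>\<open>in_chart\<close> inverts a chart by \<open>inv_into\<close>, a homeomorphism
  comes with an abstract inverse; injectivity makes them agree on the image.\<close>

lemma top_chart_inv_continuous:
  "continuous_map (subtopology (powertop_real {..<n}) (cmap c ` cdom c)) T (inv_into (cdom c) (cmap c))"
proof -
  obtain g where g: "homeomorphic_maps (subtopology T (cdom c))
      (subtopology (powertop_real {..<n}) (cmap c ` cdom c)) (cmap c) g"
    using c unfolding top_chart_def homeomorphic_map_maps by blast
  have "continuous_map (subtopology (powertop_real {..<n}) (cmap c ` cdom c)) T g"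
    using g continuous_map_into_fulltopology unfolding homeomorphic_maps_def by blast
  moreover have "g q = inv_into (cdom c) (cmap c) q"
    if "q \<in> topspace (subtopology (powertop_real {..<n}) (cmap c ` cdom c))" for q
  proof -
    obtain a where "a \<in> cdom c" "q = cmap c a" using \<open>q \<in> _\<close> by auto
    then show ?thesis using g top_chart_inj top_chart_topspace by (simp add: homeomorphic_maps_def)
  qed
  ultimately show ?thesis by (rule continuous_map_eq)
qed

lemma top_chart_space: "a \<in> cdom c \<Longrightarrow> cmap c a \<in> coord_space {..<n}"
  using openin_subset[OF top_chart_image_open[OF top_chart_open]] by auto

end

text \<open>The expression of \<open>f\<close> in \<open>c\<close> is its expression in
  \<open>e\<close> after the transition map from \<open>c\<close> to \<open>e\<close>.\<close>

lemma smooth_on_chart_change: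
  assumes c: "top_chart T n c" and e: "top_chart T n e" and W: "openin T W" "W \<subseteq> cdom c \<inter> cdom e"
    and ce: "\<And>k. k < n \<Longrightarrow> smooth_on {..<n} (cmap c ` (cdom c \<inter> cdom e)) (in_chart c (\<lambda>a. cmap e a k))"
    and f: "smooth_on {..<n} (cmap e ` W) (in_chart e f)"
  shows "smooth_on {..<n} (cmap c ` W) (in_chart c f)"
proof -
  note op = top_chart_image_open'[OF c W(1)] top_chart_image_open'[OF e W(1)]
  have inv: "inv_into (cdom c) (cmap c) (cmap c a) = a" if "a \<in> W" for a
    using W(2) that top_chart_inj[OF c] by auto
  have "smooth_on {..<n} (cmap c ` W) (\<lambda>p. in_chart e f (cmap e (inv_into (cdom c) (cmap c) p)))"
  proof (rule smooth_on_compose[OF _ _ _ _ f])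
    show "smooth_on {..<n} (cmap c ` W) (\<lambda>p. cmap e (inv_into (cdom c) (cmap c) p) k)" if "k \<in> {..<n}" for k
      using smooth_on_subset[OF ce, of k "cmap c ` W"] that W(2) by (auto simp: in_chart_def)
  qed (use op W(2) inv in auto)
  then show ?thesis
    by (rule smooth_on_cong[rotated 2])
      (use op W(2) inv top_chart_inj[OF e] in \<open>auto simp: in_chart_def\<close>)
qed

lemma matlas_charts:
  assumes "smooth_structure M"
  shows "c \<in> matlas M \<Longrightarrow> top_chart (mtop M) (mdim M) c"
    and "a \<in> topspace (mtop M) \<Longrightarrow> \<exists>c\<in>matlas M. a \<in> cdom c"
  using assms by (auto simp: smooth_structure_def)

lemma manifold_chart_top: "manifold_chart M c \<Longrightarrow> top_chart (mtop M) (mdim M) c"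
  by (simp add: manifold_chart_def)

lemma manifold_chart_matlas:
  assumes "manifold_chart M c" "e \<in> matlas M" "k < mdim M"
  shows "smooth_on {..<mdim M} (cmap c ` (cdom c \<inter> cdom e)) (in_chart c (\<lambda>a. cmap e a k))"
    and "smooth_on {..<mdim M} (cmap e ` (cdom c \<inter> cdom e)) (in_chart e (\<lambda>a. cmap c a k))"
  using assms by (auto simp: manifold_chart_def compatible_def smooth_fun_def Int_commute)

text \<open>\<open>smooth_fun\<close> tests in the given atlas, but bundle charts are only known to
  be charts of the maximal one. Near each point one passes to an atlas chart, with which
  \<open>c\<close> is compatible.\<close>

lemma smooth_fun_in_chart:
  assumes M: "smooth_structure M" and c: "manifold_chart M c" and W: "openin (mtop M) W"
    and f: "smooth_fun (matlas M) {..<mdim M} W f"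
  shows "smooth_on {..<mdim M} (cmap c ` (cdom c \<inter> W)) (in_chart c f)"
proof (rule smooth_on_local)
  note ct = manifold_chart_top[OF c]
  show "cmap c ` (cdom c \<inter> W) \<subseteq> coord_space {..<mdim M}" using top_chart_space[OF ct] by blast
  fix p assume "p \<in> cmap c ` (cdom c \<inter> W)"
  then obtain a where a: "a \<in> cdom c" "a \<in> W" "p = cmap c a" by auto
  obtain e where e: "e \<in> matlas M" "a \<in> cdom e"
    using matlas_charts(2)[OF M] openin_subset[OF W] a by blast
  note et = matlas_charts(1)[OF M e(1)]
  have W': "openin (mtop M) (cdom c \<inter> cdom e \<inter> W)"
    using W top_chart_open[OF ct] top_chart_open[OF et] by auto
  have "smooth_on {..<mdim M} (cmap c ` (cdom c \<inter> cdom e \<inter> W)) (in_chart c f)"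
  proof (rule smooth_on_chart_change[OF ct et W'])
    show "smooth_on {..<mdim M} (cmap e ` (cdom c \<inter> cdom e \<inter> W)) (in_chart e f)"
      by (rule smooth_on_subset[OF bspec[OF f[unfolded smooth_fun_def] e(1)]]) auto
  qed (use manifold_chart_matlas[OF c e(1)] in auto)
  then show "\<exists>N. openin (powertop_real {..<mdim M}) N \<and> p \<in> N \<and> N \<subseteq> cmap c ` (cdom c \<inter> W) \<and>
      smooth_on {..<mdim M} N (in_chart c f)"
    using top_chart_image_open'[OF ct W'] a e(2)
    by (intro exI[of _ "cmap c ` (cdom c \<inter> cdom e \<inter> W)"]) auto
qed simp

text \<open>Each of the two charts is only assumed compatible with the atlas. This makes the
  coordinates of \<open>d\<close> smooth functions in the sense of the atlas, and the previous lemma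
  reads them in \<open>c\<close>.\<close>

lemma manifold_chart_transition:
  assumes M: "smooth_structure M" and c: "manifold_chart M c" and d: "manifold_chart M d" and "k < mdim M"
  shows "smooth_on {..<mdim M} (cmap c ` (cdom c \<inter> cdom d)) (in_chart c (\<lambda>a. cmap d a k))"
proof (rule smooth_fun_in_chart[OF M c])
  show "openin (mtop M) (cdom d)" by (rule top_chart_open[OF manifold_chart_top[OF d]])
  show "smooth_fun (matlas M) {..<mdim M} (cdom d) (\<lambda>a. cmap d a k)"
    using manifold_chart_matlas(2)[OF d _ assms(4)] by (auto simp: smooth_fun_def Int_commute)
qed

section \<open>Smooth maps in charts of the maximal atlases\<close>

lemma openin_smooth_map_preimage:
  assumes "openin (mtop M) W" "smooth_map M W N s" "openin (mtop N) U"
  shows "openin (mtop M) {a \<in> W. s a \<in> U}"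
proof -
  have "openin (subtopology (mtop M) W) {a \<in> topspace (subtopology (mtop M) W). s a \<in> U}"
    using assms(2,3) unfolding smooth_map_def by (blast intro: openin_continuous_map_preimage)
  moreover have "topspace (subtopology (mtop M) W) = W" using openin_subset[OF assms(1)] by auto
  ultimately show ?thesis using assms(1) openin_trans_full by fastforce
qed

lemma smooth_on_chart_expr:
  assumes c: "top_chart TM n c" and d: "top_chart TN m d" and W: "openin TM W" "W \<subseteq> cdom c"
    and U: "openin TN U" "U \<subseteq> cdom d" "s ` W \<subseteq> U"
    and f: "smooth_on {..<m} (cmap d ` U) (in_chart d f)"
    and s: "\<And>l. l < m \<Longrightarrow> smooth_on {..<n} (cmap c ` W) (in_chart c (\<lambda>a. cmap d (s a) l))"
  shows "smooth_on {..<n} (cmap c ` W) (in_chart c (\<lambda>a. f (s a)))"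
proof -
  note op = top_chart_image_open'[OF c W] top_chart_image_open'[OF d U(1,2)]
  have inv: "inv_into (cdom c) (cmap c) (cmap c a) = a" if "a \<in> W" for a
    using W(2) that top_chart_inj[OF c] by auto
  have 1: "smooth_on {..<n} (cmap c ` W) (\<lambda>p. in_chart d f (cmap d (s (inv_into (cdom c) (cmap c) p))))"
    by (rule smooth_on_compose[OF _ _ _ _ f]) (use op U(3) inv s in \<open>auto simp: in_chart_def\<close>)
  have inv': "inv_into (cdom d) (cmap d) (cmap d (s a)) = s a" if "a \<in> W" for a
  proof -
    have "s a \<in> cdom d" using U that by blast
    then show ?thesis using top_chart_inj[OF d] by simp
  qed
  show ?thesis
    by (rule smooth_on_cong[OF _ op(1) 1]) (use inv inv' in \<open>auto simp: in_chart_def\<close>)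
qed

text \<open>The target chart is changed first, near each point, while the source is still an atlas
  chart; \<open>smooth_fun_in_chart\<close> then changes the source chart.\<close>

lemma smooth_map_in_charts:
  assumes M: "smooth_structure M" and N: "smooth_structure N"
    and c: "manifold_chart M c" and d: "manifold_chart N d"
    and W: "openin (mtop M) W" and s: "smooth_map M W N s" and k: "k < mdim N"
  shows "smooth_on {..<mdim M} (cmap c ` (cdom c \<inter> {a \<in> W. s a \<in> cdom d})) (in_chart c (\<lambda>a. cmap d (s a) k))"
proof (rule smooth_fun_in_chart[OF M c])
  note dt = manifold_chart_top[OF d]
  show "openin (mtop M) {a \<in> W. s a \<in> cdom d}"
    by (rule openin_smooth_map_preimage[OF W s top_chart_open[OF dt]])
  show "smooth_fun (matlas M) {..<mdim M} {a \<in> W. s a \<in> cdom d} (\<lambda>a. cmap d (s a) k)"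
    unfolding smooth_fun_def
  proof
    fix c' assume c': "c' \<in> matlas M"
    note ct = matlas_charts(1)[OF M c']
    show "smooth_on {..<mdim M} (cmap c' ` (cdom c' \<inter> {a \<in> W. s a \<in> cdom d})) (in_chart c' (\<lambda>a. cmap d (s a) k))"
    proof (rule smooth_on_local)
      show "cmap c' ` (cdom c' \<inter> {a \<in> W. s a \<in> cdom d}) \<subseteq> coord_space {..<mdim M}"
        using top_chart_space[OF ct] by blast
      fix p assume "p \<in> cmap c' ` (cdom c' \<inter> {a \<in> W. s a \<in> cdom d})"
      then obtain a where a: "a \<in> cdom c'" "a \<in> W" "s a \<in> cdom d" "p = cmap c' a" by auto
      obtain e where e: "e \<in> matlas N" "s a \<in> cdom e"
        using matlas_charts(2)[OF N] openin_subset[OF top_chart_open[OF dt]] a(3) by blast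
      note et = matlas_charts(1)[OF N e(1)]
      define W' where "W' = cdom c' \<inter> {a \<in> W. s a \<in> cdom e \<inter> cdom d}"
      have U: "openin (mtop N) (cdom e \<inter> cdom d)" using top_chart_open[OF dt] top_chart_open[OF et] by auto
      have W': "openin (mtop M) W'"
        unfolding W'_def using openin_smooth_map_preimage[OF W s U] top_chart_open[OF ct] by (rule openin_Int[rotated])
      have "smooth_on {..<mdim M} (cmap c' ` W') (in_chart c' (\<lambda>a. cmap d (s a) k))"
      proof (rule smooth_on_chart_expr[OF ct et W' _ U])
        show "smooth_on {..<mdim N} (cmap e ` (cdom e \<inter> cdom d)) (in_chart e (\<lambda>a. cmap d a k))"
          using manifold_chart_matlas(2)[OF d e(1) k] by (simp add: Int_commute)
        fix l assume "l < mdim N"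
        then have "smooth_on {..<mdim M} (cmap c' ` (cdom c' \<inter> {a \<in> W. s a \<in> cdom e})) (in_chart c' (\<lambda>a. cmap e (s a) l))"
          using s c' e(1) by (auto simp: smooth_map_def smooth_fun_def)
        then show "smooth_on {..<mdim M} (cmap c' ` W') (in_chart c' (\<lambda>a. cmap e (s a) l))"
          by (rule smooth_on_subset) (auto simp: W'_def)
      qed (auto simp: W'_def)
      then show "\<exists>N. openin (powertop_real {..<mdim M}) N \<and> p \<in> N \<and> N \<subseteq> cmap c' ` (cdom c' \<inter> {a \<in> W. s a \<in> cdom d}) \<and>
          smooth_on {..<mdim M} N (in_chart c' (\<lambda>a. cmap d (s a) k))"
        using top_chart_image_open'[OF ct W'] a e(2)
        by (intro exI[of _ "cmap c' ` W'"]) (auto simp: W'_def)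
    qed simp
  qed
qed

text \<open>For a map between the domains of two single charts, continuity comes from the chart
  homeomorphisms and smoothness in all other charts from chart changes. The sections with prescribed
  jets are recognised as smooth in this way.\<close>

lemma smooth_mapI_charts:
  assumes M: "smooth_structure M" and N: "smooth_structure N"
    and c: "manifold_chart M c" and d: "manifold_chart N d"
    and W: "openin (mtop M) W" "W \<subseteq> cdom c" and sW: "s ` W \<subseteq> cdom d"
    and s: "\<And>k. k < mdim N \<Longrightarrow> smooth_on {..<mdim M} (cmap c ` W) (in_chart c (\<lambda>a. cmap d (s a) k))"
  shows "smooth_map M W N s"
proof -
  note ct = manifold_chart_top[OF c] and dt = manifold_chart_top[OF d]
  have inv: "inv_into (cdom c) (cmap c) (cmap c a) = a" if "a \<in> W" for a
    using W(2) that top_chart_inj[OF ct] by auto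
  note op = top_chart_image_open'[OF ct W]
  define P where "P = subtopology (powertop_real {..<mdim M}) (cmap c ` W)"
  have 1: "continuous_map (subtopology (mtop M) W) P (cmap c)"
    unfolding P_def using continuous_map_from_subtopology_mono[OF top_chart_continuous[OF ct] W(2)]
    by (auto simp: continuous_map_in_subtopology)
  have 2: "continuous_map P (subtopology (powertop_real {..<mdim N}) (cmap d ` cdom d))
      (\<lambda>q. cmap d (s (inv_into (cdom c) (cmap c) q)))"
    unfolding continuous_map_in_subtopology continuous_map_componentwise
  proof (intro conjI ballI)
    show "continuous_map P euclideanreal (\<lambda>q. cmap d (s (inv_into (cdom c) (cmap c) q)) k)" if "k \<in> {..<mdim N}" for k
    proof -
      have "continuous_map P euclideanreal (iter_partial [] (in_chart c (\<lambda>a. cmap d (s a) k)))"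
        using s[of k] that unfolding smooth_on_def P_def by blast
      then show ?thesis by (simp add: in_chart_def)
    qed
    have "cmap d (s a) \<in> extensional {..<mdim N}" if "a \<in> W" for a
      using top_chart_space[OF dt] sW that by (auto simp: PiE_def)
    then show "(\<lambda>q. cmap d (s (inv_into (cdom c) (cmap c) q))) ` topspace P \<subseteq> extensional {..<mdim N}"
      using inv by (auto simp: P_def)
    show "(\<lambda>q. cmap d (s (inv_into (cdom c) (cmap c) q))) \<in> topspace P \<rightarrow> cmap d ` cdom d"
      using inv sW by (auto simp: P_def)
  qed
  have "continuous_map (subtopology (mtop M) W) (mtop N)
      (inv_into (cdom d) (cmap d) \<circ> ((\<lambda>q. cmap d (s (inv_into (cdom c) (cmap c) q))) \<circ> cmap c))"
    by (rule continuous_map_compose[OF continuous_map_compose[OF 1 2] top_chart_inv_continuous[OF dt]])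
  then have cont: "continuous_map (subtopology (mtop M) W) (mtop N) s"
    by (rule continuous_map_eq) (use inv sW top_chart_inj[OF dt] in auto)
  have "smooth_on {..<mdim M} (cmap c' ` (cdom c' \<inter> {a \<in> W. s a \<in> cdom e})) (in_chart c' (\<lambda>a. cmap e (s a) k))"
    if e: "e \<in> matlas N" and k: "k < mdim N" and c': "c' \<in> matlas M" for e k c'
  proof -
    note et = matlas_charts(1)[OF N e] and ct' = matlas_charts(1)[OF M c']
    define W' where "W' = cdom c' \<inter> {a \<in> W. s a \<in> cdom e}"
    have "openin (subtopology (mtop M) W) {a \<in> topspace (subtopology (mtop M) W). s a \<in> cdom e}"
      by (rule openin_continuous_map_preimage[OF cont top_chart_open[OF et]])
    then have "openin (mtop M) {a \<in> W. s a \<in> cdom e}"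
      using W(1) openin_subset[OF W(1)] openin_trans_full by (fastforce simp: Int_absorb1)
    then have W': "openin (mtop M) W'"
      unfolding W'_def using top_chart_open[OF ct'] by blast
    have "smooth_on {..<mdim M} (cmap c' ` W') (in_chart c' (\<lambda>a. cmap e (s a) k))"
    proof (rule smooth_on_chart_change[OF ct' ct W'])
      show "W' \<subseteq> cdom c' \<inter> cdom c" using W by (auto simp: W'_def)
      show "smooth_on {..<mdim M} (cmap c' ` (cdom c' \<inter> cdom c)) (in_chart c' (\<lambda>a. cmap c a k))" if "k < mdim M" for k
        using manifold_chart_matlas(2)[OF c c' that] by (simp add: Int_commute)
      show "smooth_on {..<mdim M} (cmap c ` W') (in_chart c (\<lambda>a. cmap e (s a) k))"
      proof (rule smooth_on_chart_expr[OF ct dt W'])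
        show "W' \<subseteq> cdom c" using W by (auto simp: W'_def)
        show "openin (mtop N) (cdom d \<inter> cdom e)" using top_chart_open[OF dt] top_chart_open[OF et] by auto
        show "s ` W' \<subseteq> cdom d \<inter> cdom e" using sW by (auto simp: W'_def)
        show "smooth_on {..<mdim N} (cmap d ` (cdom d \<inter> cdom e)) (in_chart d (\<lambda>a. cmap e a k))"
          by (rule manifold_chart_matlas(1)[OF d e k])
        show "smooth_on {..<mdim M} (cmap c ` W') (in_chart c (\<lambda>a. cmap d (s a) l))" if "l < mdim N" for l
          by (rule smooth_on_subset[OF s[OF that]]) (auto simp: W'_def)
      qed simp
    qed
    then show ?thesis by (simp add: W'_def)
  qed
  then show ?thesis using cont by (auto simp: smooth_map_def smooth_fun_def)
qed

section \<open>Jet coordinates\<close>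

text \<open>Jet coordinates read off from a representative. Calculations are done at this level and
  transferred to classes by \<open>jet_coord_class\<close>.\<close>

definition sec_coord :: "('x, 'y) bundle_chart \<Rightarrow> ('x, 'y) pointed_section \<Rightarrow> jet_index \<Rightarrow> real" where
  "sec_coord c q k = (case k of Bas l \<Rightarrow> cmap (bbase c) (fst q) l | Fib i \<Lambda> \<Rightarrow> section_deriv c i \<Lambda> q)"

definition sec_coords ::
    "('x, 'y) fibration \<Rightarrow> nat \<Rightarrow> ('x, 'y) bundle_chart \<Rightarrow> ('x, 'y) pointed_section \<Rightarrow> jet_index \<Rightarrow> real" where
  "sec_coords Y r c q = restrict (sec_coord c q) (jet_indices Y r)"

text \<open>Prepending an index is one more derivative here, whereas in a sorted list the new index
  may belong further inside. Induction on the order therefore uses lists.\<close>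

definition section_deriv_list ::
    "('x, 'y) bundle_chart \<Rightarrow> nat \<Rightarrow> nat list \<Rightarrow> ('x, 'y) pointed_section \<Rightarrow> real" where
  "section_deriv_list c i ls q =
     iter_partial ls (in_chart (bbase c) (\<lambda>x. bfib c (snd q x) i)) (cmap (bbase c) (fst q))"

text \<open>The coordinates \<open>(x\<^sup>\<lambda>, y\<^sup>i)\<close> of the projection to \<open>Y\<close> of the jet with coordinates \<open>p\<close>.\<close>

definition total_part :: "('x, 'y) fibration \<Rightarrow> (jet_index \<Rightarrow> real) \<Rightarrow> nat \<Rightarrow> real" where
  "total_part Y p = append_coords (base_dim Y) (fib_dim Y) (\<lambda>l. p (Bas l)) (\<lambda>i. p (Fib i {#}))"

definition base_part :: "('x, 'y) fibration \<Rightarrow> (jet_index \<Rightarrow> real) \<Rightarrow> nat \<Rightarrow> real" where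
  "base_part Y p = (\<lambda>l\<in>{..<base_dim Y}. p (Bas l))"

text \<open>The part over \<open>U\<close> of the image of a jet chart
  (\<open>jet_chart_image\<close>): only the coordinates of the underlying point of \<open>Y\<close>
  are restricted. That every such point occurs is \<open>ex_section_coords\<close>.\<close>

definition jet_image ::
    "('x, 'y) fibration \<Rightarrow> nat \<Rightarrow> ('x, 'y) bundle_chart \<Rightarrow> 'y set \<Rightarrow> (jet_index \<Rightarrow> real) set" where
  "jet_image Y r c U =
     {p \<in> coord_space (jet_indices Y r). total_part Y p \<in> cmap (total_chart Y c) ` (bdom c \<inter> U)}"

lemma finite_multi_indices_le: "finite {\<Lambda>. \<Lambda> \<in> multi_indices n \<and> size \<Lambda> \<le> r}"
proof (rule finite_subset)
  show "{\<Lambda>. \<Lambda> \<in> multi_indices n \<and> size \<Lambda> \<le> r} \<subseteq> mset ` {xs. set xs \<subseteq> {..<n} \<and> length xs \<le> r}"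
    by (auto simp: multi_indices_def) (metis (mono_tags, lifting) ex_mset image_eqI mem_Collect_eq set_mset_mset size_mset)
qed (auto intro: finite_lists_length_le)

lemma finite_jet_indices: "finite (jet_indices Y r)"
proof -
  have "{Fib i \<Lambda> | i \<Lambda>. i < fib_dim Y \<and> \<Lambda> \<in> multi_indices (base_dim Y) \<and> size \<Lambda> \<le> r} =
    case_prod Fib ` ({..<fib_dim Y} \<times> {\<Lambda>. \<Lambda> \<in> multi_indices (base_dim Y) \<and> size \<Lambda> \<le> r})"
    by auto
  then show ?thesis
    unfolding jet_indices_def using finite_multi_indices_le[of "base_dim Y" r] by simp
qed

lemma jet_indices_simps [simp]:
  "Bas l \<in> jet_indices Y r \<longleftrightarrow> l < base_dim Y"
  "Fib i \<Lambda> \<in> jet_indices Y r \<longleftrightarrow> i < fib_dim Y \<and> \<Lambda> \<in> multi_indices (base_dim Y) \<and> size \<Lambda> \<le> r"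
  by (auto simp: jet_indices_def)

lemma jet_indices_mono: "r \<le> r' \<Longrightarrow> jet_indices Y r \<subseteq> jet_indices Y r'"
  by (auto simp: jet_indices_def)

lemma multi_indices_empty [simp]: "{#} \<in> multi_indices n"
  by (simp add: multi_indices_def)

lemma multi_indices_add [simp]: "add_mset l \<Lambda> \<in> multi_indices n \<longleftrightarrow> l < n \<and> \<Lambda> \<in> multi_indices n"
  by (auto simp: multi_indices_def)

lemma append_coords_apply:
  "append_coords n m p q k = (if k < n + m then if k < n then p k else q (k - n) else undefined)"
  by (simp add: append_coords_def)

lemma total_part_in_space: "total_part Y p \<in> coord_space {..<base_dim Y + fib_dim Y}"
  by (simp add: total_part_def append_coords_def)

lemma total_part_cong:
  "(\<And>l. l < base_dim Y \<Longrightarrow> p (Bas l) = p' (Bas l)) \<Longrightarrow> (\<And>i. i < fib_dim Y \<Longrightarrow> p (Fib i {#}) = p' (Fib i {#}))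
    \<Longrightarrow> total_part Y p = total_part Y p'"
  by (auto simp: total_part_def append_coords_apply fun_eq_iff)

lemma total_part_restrict: "total_part Y (restrict p (jet_indices Y r)) = total_part Y p"
  by (rule total_part_cong) auto

lemma jet_image_mono: "U \<subseteq> U' \<Longrightarrow> jet_image Y r c U \<subseteq> jet_image Y r c U'"
  by (auto simp: jet_image_def)

lemma jet_image_subset_space: "jet_image Y r c U \<subseteq> coord_space (jet_indices Y r)"
  by (auto simp: jet_image_def)

lemma restrict_jet_image: "p \<in> jet_image Y r' c U \<Longrightarrow> restrict p (jet_indices Y r) \<in> jet_image Y r c U"
  by (auto simp: jet_image_def total_part_restrict)

lemma cdom_total_chart [simp]: "cdom (total_chart Y c) = bdom c"
  by (simp add: total_chart_def)

lemma cmap_total_chart: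
  "cmap (total_chart Y c) y = append_coords (base_dim Y) (fib_dim Y) (cmap (bbase c) (proj Y y)) (bfib c y)"
  by (simp add: total_chart_def)

text \<open>The last fact lets the base point of a section move, as differentiating its jet
  coordinates requires.\<close>

lemma pointed_sectionsE:
  assumes "q \<in> pointed_sections Y"
  obtains W where "openin (mtop (base_mfd Y)) W" "fst q \<in> W" "smooth_map (base_mfd Y) W (total_mfd Y) (snd q)"
    "\<forall>x'\<in>W. proj Y (snd q x') = x'" "\<forall>x'\<in>W. (x', snd q) \<in> pointed_sections Y"
proof -
  obtain W where "openin (mtop (base_mfd Y)) W" "fst q \<in> W" "smooth_map (base_mfd Y) W (total_mfd Y) (snd q)"
    "\<forall>x'\<in>W. proj Y (snd q x') = x'"
    using assms by (auto simp: pointed_sections_def)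
  then show thesis by (intro that[of W]) (auto simp: pointed_sections_def)
qed

lemma continuous_map_total_part:
  "continuous_map (powertop_real (jet_indices Y r)) (powertop_real {..<base_dim Y + fib_dim Y}) (total_part Y)"
  unfolding continuous_map_componentwise
proof (intro conjI ballI)
  show "total_part Y ` topspace (powertop_real (jet_indices Y r)) \<subseteq> extensional {..<base_dim Y + fib_dim Y}"
    using total_part_in_space by (auto simp: PiE_def)
  fix k assume k: "k \<in> {..<base_dim Y + fib_dim Y}"
  show "continuous_map (powertop_real (jet_indices Y r)) euclideanreal (\<lambda>p. total_part Y p k)"
    using k by (cases "k < base_dim Y")
      (auto simp: total_part_def append_coords_apply intro!: continuous_map_product_projection)
qed

locale smooth_fibration =
  fixes Y :: "('x, 'y) fibration" and V :: "'v manifold"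
  assumes is_fiber_bundle: "fiber_bundle Y V"
begin

lemma base_structure: "smooth_structure (base_mfd Y)"
  and total_structure: "smooth_structure (total_mfd Y)"
  and total_dim: "mdim (total_mfd Y) = base_dim Y + fib_dim Y"
  using is_fiber_bundle by (auto simp: fiber_bundle_def smooth_manifold_def fib_dim_def)

context
  fixes c :: "('x, 'y) bundle_chart"
  assumes c: "is_bundle_chart Y c"
begin

lemma base_chart: "manifold_chart (base_mfd Y) (bbase c)"
  and total_chart_manifold: "manifold_chart (total_mfd Y) (total_chart Y c)"
  and proj_bdom: "y \<in> bdom c \<Longrightarrow> proj Y y \<in> cdom (bbase c)"
  using c by (auto simp: is_bundle_chart_def)

lemma base_top_chart: "top_chart (mtop (base_mfd Y)) (base_dim Y) (bbase c)"
  by (rule manifold_chart_top[OF base_chart])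

lemma total_top_chart: "top_chart (mtop (total_mfd Y)) (base_dim Y + fib_dim Y) (total_chart Y c)"
  using manifold_chart_top[OF total_chart_manifold] by (simp add: total_dim)

lemma openin_bdom: "openin (mtop (total_mfd Y)) (bdom c)"
  using top_chart_open[OF total_top_chart] by simp

lemma openin_jet_image:
  assumes "openin (mtop (total_mfd Y)) U"
  shows "openin (powertop_real (jet_indices Y r)) (jet_image Y r c U)"
  unfolding jet_image_def
  using openin_continuous_map_preimage[OF continuous_map_total_part top_chart_image_open[OF total_top_chart assms]] by simp

lemma section_deriv_empty:
  "proj Y (snd q (fst q)) = fst q \<Longrightarrow> snd q (fst q) \<in> bdom c \<Longrightarrow> section_deriv c i {#} q = bfib c (snd q (fst q)) i"
  using proj_bdom[of "snd q (fst q)"]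
  by (simp add: section_deriv_def in_chart_cmap[OF top_chart_inj[OF base_top_chart]])

lemma total_part_sec_coord:
  assumes "q \<in> pointed_sections Y" "snd q (fst q) \<in> bdom c"
  shows "total_part Y (sec_coord c q) = cmap (total_chart Y c) (snd q (fst q))"
proof -
  have "proj Y (snd q (fst q)) = fst q" using assms(1) by (elim pointed_sectionsE) simp
  then show ?thesis
    using assms(2) by (simp add: total_part_def cmap_total_chart sec_coord_def section_deriv_empty)
qed

lemma sec_coords_in_jet_image:
  assumes "q \<in> pointed_sections Y" "snd q (fst q) \<in> bdom c \<inter> U"
  shows "sec_coords Y r c q \<in> jet_image Y r c U"
  using assms total_part_sec_coord[of q]
  by (auto simp: jet_image_def sec_coords_def total_part_restrict)

lemma section_coordinate_smooth:
  assumes W: "openin (mtop (base_mfd Y)) W" and s: "smooth_map (base_mfd Y) W (total_mfd Y) s"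
    and ps: "\<forall>x\<in>W. proj Y (s x) = x" and i: "i < fib_dim Y"
  shows "openin (mtop (base_mfd Y)) {x \<in> W. s x \<in> bdom c}"
    and "{x \<in> W. s x \<in> bdom c} \<subseteq> cdom (bbase c)"
    and "smooth_on {..<base_dim Y} (cmap (bbase c) ` {x \<in> W. s x \<in> bdom c}) (in_chart (bbase c) (\<lambda>x. bfib c (s x) i))"
proof -
  show op: "openin (mtop (base_mfd Y)) {x \<in> W. s x \<in> bdom c}"
    by (rule openin_smooth_map_preimage[OF W s openin_bdom])
  show sub: "{x \<in> W. s x \<in> bdom c} \<subseteq> cdom (bbase c)" using proj_bdom ps by force
  have "smooth_on {..<base_dim Y} (cmap (bbase c) ` (cdom (bbase c) \<inter> {x \<in> W. s x \<in> bdom c}))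
      (in_chart (bbase c) (\<lambda>x. cmap (total_chart Y c) (s x) (base_dim Y + i)))"
    using smooth_map_in_charts[OF base_structure total_structure base_chart total_chart_manifold W s, of "base_dim Y + i"]
      i total_dim by simp
  then show "smooth_on {..<base_dim Y} (cmap (bbase c) ` {x \<in> W. s x \<in> bdom c}) (in_chart (bbase c) (\<lambda>x. bfib c (s x) i))"
    using sub i by (simp add: Int_absorb1 cmap_total_chart append_coords_apply)
qed

lemma section_deriv_perm:
  assumes q: "q \<in> pointed_sections Y" and v: "snd q (fst q) \<in> bdom c" and i: "i < fib_dim Y"
    and ls: "ls \<in> lists {..<base_dim Y}"
  shows "section_deriv_list c i ls q = section_deriv c i (mset ls) q"
proof -
  obtain W where W: "openin (mtop (base_mfd Y)) W" "fst q \<in> W" "smooth_map (base_mfd Y) W (total_mfd Y) (snd q)"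
    "\<forall>x'\<in>W. proj Y (snd q x') = x'" "\<forall>x'\<in>W. (x', snd q) \<in> pointed_sections Y"
    by (rule pointed_sectionsE[OF q])
  note s = section_coordinate_smooth[OF W(1,3,4) i]
  show ?thesis
    unfolding section_deriv_list_def section_deriv_def
    by (rule iter_partial_perm[OF _ top_chart_image_open'[OF base_top_chart s(1,2)] s(3)])
      (use ls v W(2) in auto)
qed

end

lemma base_part_in_image:
  assumes c: "is_bundle_chart Y c" and c': "is_bundle_chart Y c'" and P: "P \<in> jet_image Y r c (bdom c')"
  shows "base_part Y P \<in> cmap (bbase c) ` (cdom (bbase c) \<inter> cdom (bbase c'))"
proof -
  obtain y where y: "y \<in> bdom c" "y \<in> bdom c'" "total_part Y P = cmap (total_chart Y c) y"
    using P by (auto simp: jet_image_def)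
  have "P (Bas l) = cmap (bbase c) (proj Y y) l" if "l < base_dim Y" for l
    using fun_cong[OF y(3), of l] that by (simp add: total_part_def cmap_total_chart append_coords_apply)
  then have "base_part Y P = cmap (bbase c) (proj Y y)"
    using top_chart_space[OF base_top_chart[OF c] proj_bdom[OF c y(1)]]
    by (auto simp: base_part_def PiE_iff extensional_def fun_eq_iff)
  then show ?thesis using proj_bdom[OF c y(1)] proj_bdom[OF c' y(2)] by auto
qed

text \<open>Prolongation of the transition functions by total differentiation: if \<open>y'\<^sup>i\<^sub>\<Lambda> = T\<close> then
  \<open>y'\<^sup>i\<^sub>l\<^sub>+\<^sub>\<Lambda> = (\<partial>x\<^sup>\<mu>/\<partial>x'\<^sup>l) d\<^sub>\<mu> T\<close>.\<close>

lemma section_deriv_list_transition: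
  assumes c: "is_bundle_chart Y c" and c': "is_bundle_chart Y c'" and i: "i < fib_dim Y"
    and ls: "ls \<in> lists {..<base_dim Y}"
  shows "\<exists>T. smooth_on (jet_indices Y (length ls)) (jet_image Y (length ls) c (bdom c')) T \<and>
    (\<forall>q\<in>pointed_sections Y. snd q (fst q) \<in> bdom c \<inter> bdom c' \<longrightarrow>
       section_deriv_list c' i ls q = T (sec_coords Y (length ls) c q))"
  using ls
proof (induction ls rule: list.induct)
  case Nil
  \<comment> \<open>At order zero, \<open>T\<close> is a component of the transition map of
    \<open>Y\<close>.\<close>
  define \<Omega> where "\<Omega> = cmap (total_chart Y c) ` (bdom c \<inter> bdom c')"
  define F where "F = in_chart (total_chart Y c) (\<lambda>y. cmap (total_chart Y c') y (base_dim Y + i))"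
  have F: "smooth_on {..<base_dim Y + fib_dim Y} \<Omega> F"
    unfolding F_def \<Omega>_def
    using manifold_chart_transition[OF total_structure total_chart_manifold[OF c] total_chart_manifold[OF c'], of "base_dim Y + i"]
      i by (simp add: total_dim)
  have \<Omega>: "openin (powertop_real {..<base_dim Y + fib_dim Y}) \<Omega>"
    unfolding \<Omega>_def using top_chart_image_open[OF total_top_chart[OF c] openin_bdom[OF c']] by simp
  note K = finite_jet_indices[of Y 0] openin_jet_image[OF c openin_bdom[OF c'], of 0]
  have "smooth_on (jet_indices Y 0) (jet_image Y 0 c (bdom c')) (\<lambda>p. F (total_part Y p))"
  proof (rule smooth_on_compose[OF K _ \<Omega> F])
    show "total_part Y ` jet_image Y 0 c (bdom c') \<subseteq> \<Omega>" by (auto simp: jet_image_def \<Omega>_def)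
    show "smooth_on (jet_indices Y 0) (jet_image Y 0 c (bdom c')) (\<lambda>p. total_part Y p l)"
      if "l \<in> {..<base_dim Y + fib_dim Y}" for l
      using that smooth_on_coord[OF K] by (cases "l < base_dim Y") (auto simp: total_part_def append_coords_apply)
  qed simp
  moreover have "section_deriv_list c' i [] q = F (total_part Y (sec_coords Y 0 c q))"
    if q: "q \<in> pointed_sections Y" "snd q (fst q) \<in> bdom c \<inter> bdom c'" for q
  proof -
    have "proj Y (snd q (fst q)) = fst q" using q(1) by (elim pointed_sectionsE) simp
    then have "section_deriv_list c' i [] q = bfib c' (snd q (fst q)) i"
      using section_deriv_empty[OF c', of q i] q(2) by (simp add: section_deriv_list_def section_deriv_def)
    moreover have "F (total_part Y (sec_coords Y 0 c q)) = cmap (total_chart Y c') (snd q (fst q)) (base_dim Y + i)"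
      using q total_part_sec_coord[OF c q(1)] top_chart_inj[OF total_top_chart[OF c]]
      by (simp add: sec_coords_def total_part_restrict F_def in_chart_cmap)
    ultimately show ?thesis using i by (simp add: cmap_total_chart append_coords_apply)
  qed
  ultimately show ?case by auto
next
  case (Cons l ls)
  define r where "r = length ls"
  have l: "l < base_dim Y" and ls: "ls \<in> lists {..<base_dim Y}" using Cons.prems by auto
  obtain T where T: "smooth_on (jet_indices Y r) (jet_image Y r c (bdom c')) T"
    and TT: "\<And>q. q \<in> pointed_sections Y \<Longrightarrow> snd q (fst q) \<in> bdom c \<inter> bdom c' \<Longrightarrow>
       section_deriv_list c' i ls q = T (sec_coords Y r c q)"
    using Cons.IH[OF ls] unfolding r_def by blast
  let ?K = "jet_indices Y r" and ?K' = "jet_indices Y (Suc r)"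
  let ?D = "jet_image Y r c (bdom c')" and ?D' = "jet_image Y (Suc r) c (bdom c')"
  define b where "b = bbase c"
  define b' where "b' = bbase c'"
  note bt = base_top_chart[OF c, folded b_def] and bt' = base_top_chart[OF c', folded b'_def]
  define B where "B = cdom b \<inter> cdom b'"
  have B: "openin (mtop (base_mfd Y)) B" unfolding B_def using top_chart_open[OF bt] top_chart_open[OF bt'] by auto
  have BB: "B \<subseteq> cdom b" "B \<subseteq> cdom b'" by (auto simp: B_def)
  note Kf = finite_jet_indices[of Y r] and Kf' = finite_jet_indices[of Y "Suc r"]
  note Do = openin_jet_image[OF c openin_bdom[OF c'], of r] and Do' = openin_jet_image[OF c openin_bdom[OF c'], of "Suc r"]
  define X where "X \<mu> = in_chart b' (\<lambda>x. cmap b x \<mu>)" for \<mu>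
  have X: "smooth_on {..<base_dim Y} (cmap b' ` B) (X \<mu>)" if "\<mu> < base_dim Y" for \<mu>
    using manifold_chart_transition[OF base_structure base_chart[OF c'] base_chart[OF c] that]
    by (simp add: X_def b_def b'_def B_def Int_commute)
  note Bo' = top_chart_image_open'[OF bt' B BB(2)] and Bo = top_chart_image_open'[OF bt B BB(1)]
  \<comment> \<open>The Jacobian entry \<partial>x^\<mu>/\<partial>x'^l as a function of the point
    of the base, so that it can be rewritten in the unprimed coordinates.\<close>
  define J where "J \<mu> x = partial l (X \<mu>) (cmap b' x)" for \<mu> x
  have J: "smooth_on {..<base_dim Y} (cmap b ` B) (in_chart b (J \<mu>))" if \<mu>: "\<mu> < base_dim Y" for \<mu>
  proof (rule smooth_on_chart_change[OF bt bt' B])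
    have "smooth_on {..<base_dim Y} (cmap b' ` B) (partial l (X \<mu>))"
      using smooth_on_partial[OF Bo' X[OF \<mu>]] l by simp
    then show "smooth_on {..<base_dim Y} (cmap b' ` B) (in_chart b' (J \<mu>))"
      by (rule smooth_on_cong[OF finite_lessThan Bo']) (use top_chart_inj[OF bt'] BB in \<open>auto simp: in_chart_cmap J_def\<close>)
    show "smooth_on {..<base_dim Y} (cmap b ` (cdom b \<inter> cdom b')) (in_chart b (\<lambda>a. cmap b' a k))" if "k < base_dim Y" for k
      using manifold_chart_transition[OF base_structure base_chart[OF c] base_chart[OF c'] that]
      by (simp add: b_def b'_def)
  qed (simp add: B_def)
  define Jt where "Jt \<mu> P = in_chart b (J \<mu>) (base_part Y P)" for \<mu> P
  have Jt: "smooth_on ?K' ?D' (Jt \<mu>)" if "\<mu> < base_dim Y" for \<mu>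
    unfolding Jt_def
  proof (rule smooth_on_compose[OF Kf' Do' _ Bo J[OF that]])
    show "base_part Y ` ?D' \<subseteq> cmap b ` B"
      using base_part_in_image[OF c c'] by (auto simp: b_def b'_def B_def)
    show "smooth_on ?K' ?D' (\<lambda>p. base_part Y p l)" if "l \<in> {..<base_dim Y}" for l
      using smooth_on_coord[OF Kf' Do'] that by (simp add: base_part_def)
  qed simp
  \<comment> \<open>The value of \<open>d\<^sub>\<mu>\<close> on the coordinate \<open>k\<close>. On
    fibre coordinates it raises the order by one, hence the passage to \<open>Suc r\<close>.\<close>
  define dco :: "nat \<Rightarrow> jet_index \<Rightarrow> (jet_index \<Rightarrow> real) \<Rightarrow> real" where
    "dco \<mu> k P = (case k of Bas m \<Rightarrow> if m = \<mu> then 1 else 0 | Fib j \<Sigma> \<Rightarrow> P (Fib j (add_mset \<mu> \<Sigma>)))" for \<mu> k P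
  have dco: "smooth_on ?K' ?D' (dco \<mu> k)" for \<mu> k
    using smooth_on_coord[OF Kf' Do'] smooth_on_const[OF Kf' Do'] by (cases k) (auto simp: dco_def[abs_def])
  have pT: "smooth_on ?K' ?D' (\<lambda>P. partial k T (restrict P ?K))" if k: "k \<in> ?K" for k
  proof (rule smooth_on_compose[OF Kf' Do' Kf Do smooth_on_partial[OF Do T k]])
    show "(\<lambda>P. restrict P ?K) ` ?D' \<subseteq> ?D" using restrict_jet_image by blast
    show "smooth_on ?K' ?D' (\<lambda>p. restrict p ?K l)" if "l \<in> ?K" for l
      using smooth_on_coord[OF Kf' Do'] that by simp
  qed
  define T' where "T' P = (\<Sum>\<mu><base_dim Y. Jt \<mu> P * (\<Sum>k\<in>?K. partial k T (restrict P ?K) * dco \<mu> k P))" for P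
  have T': "smooth_on ?K' ?D' T'"
    unfolding T'_def[abs_def]
    by (intro smooth_on_sum[OF Kf' Do'] smooth_on_mult[OF Kf' Do'] Jt dco pT) auto
  have "section_deriv_list c' i (l # ls) q = T' (sec_coords Y (Suc r) c q)"
    if q: "q \<in> pointed_sections Y" and v: "snd q (fst q) \<in> bdom c \<inter> bdom c'" for q
  proof -
    define s where "s = snd q"
    define x0 where "x0 = fst q"
    obtain W where W: "openin (mtop (base_mfd Y)) W" "x0 \<in> W" "smooth_map (base_mfd Y) W (total_mfd Y) s"
      "\<forall>x'\<in>W. proj Y (s x') = x'" "\<forall>x'\<in>W. (x', s) \<in> pointed_sections Y"
      by (rule pointed_sectionsE[OF q, folded s_def x0_def])
    note sc = section_coordinate_smooth[OF c W(1,3,4), folded b_def]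
    note sc' = section_coordinate_smooth[OF c' W(1,3,4), folded b'_def]
    define W0 where "W0 = {x \<in> W. s x \<in> bdom c} \<inter> {x \<in> W. s x \<in> bdom c'}"
    have W0: "openin (mtop (base_mfd Y)) W0" unfolding W0_def using sc(1)[OF i] sc'(1)[OF i] by (rule openin_Int)
    have W0B: "W0 \<subseteq> cdom b'" "W0 \<subseteq> cdom b" "W0 \<subseteq> B"
      using sc(2)[OF i] sc'(2)[OF i] by (auto simp: W0_def B_def)
    have x0: "x0 \<in> W0" using W(2) v by (auto simp: W0_def s_def x0_def)
    define S where "S = cmap b' ` W0"
    have S: "openin (powertop_real {..<base_dim Y}) S" unfolding S_def by (rule top_chart_image_open'[OF bt' W0 W0B(1)])
    define p where "p = cmap b' x0"
    have p: "p \<in> S" using x0 by (simp add: S_def p_def)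
    define iv where "iv = inv_into (cdom b') (cmap b')"
    have iv: "iv (cmap b' x) = x" if "x \<in> W0" for x
      using that W0B(1) top_chart_inj[OF bt'] by (auto simp: iv_def)
    \<comment> \<open>The jet coordinates of the fixed section while its base point runs through the
      primed chart. Along this map the total derivative of \<open>T\<close> is an ordinary
      derivative, given by the chain rule.\<close>
    define \<gamma> where "\<gamma> u = sec_coords Y r c (iv u, s)" for u
    have \<gamma>D: "\<gamma> ` S \<subseteq> ?D"
      using W0B W(5) by (auto simp: S_def \<gamma>_def iv W0_def intro!: sec_coords_in_jet_image[OF c])
    have lK: "l \<in> {..<base_dim Y}" using l by simp
    have XB: "Ck 1 {..<base_dim Y} S (\<lambda>u. cmap b (iv u) \<mu>)" if "\<mu> < base_dim Y" for \<mu>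
    proof -
      have "Ck 1 {..<base_dim Y} S (X \<mu>)"
        using smooth_on_Ck[OF Bo' X[OF that]] W0B(3) Ck_subset unfolding S_def by (metis image_mono)
      then show ?thesis by (simp add: X_def in_chart_def iv_def)
    qed
    have pX: "partial l (\<lambda>u. cmap b (iv u) \<mu>) p = J \<mu> x0" for \<mu>
      by (simp add: J_def X_def in_chart_def p_def iv_def)
    have key: "Ck 1 {..<base_dim Y} S (\<lambda>u. \<gamma> u k) \<and>
        partial l (\<lambda>u. \<gamma> u k) p = (\<Sum>\<mu><base_dim Y. J \<mu> x0 * dco \<mu> k (sec_coord c q))" if k: "k \<in> ?K" for k
    proof (cases k)
      case (Bas m)
      then have "(\<lambda>u. \<gamma> u k) = (\<lambda>u. cmap b (iv u) m)" and m: "m < base_dim Y"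
        using k by (auto simp: \<gamma>_def sec_coords_def sec_coord_def b_def fun_eq_iff)
      then show ?thesis using XB[OF m] pX[of m] m by (simp add: Bas dco_def if_distrib cong: if_cong)
    next
      case (Fib j \<Sigma>)
      then have j: "j < fib_dim Y" and \<Sigma>: "\<Sigma> \<in> multi_indices (base_dim Y)" using k by auto
      define ks where "ks = sorted_list_of_multiset \<Sigma>"
      have ks: "ks \<in> lists {..<base_dim Y}" "mset ks = \<Sigma>"
        using \<Sigma> by (auto simp: ks_def multi_indices_def)
      define h where "h = iter_partial ks (in_chart b (\<lambda>x. bfib c (s x) j))"
      define \<Omega> where "\<Omega> = cmap b ` {x \<in> W. s x \<in> bdom c}"
      have \<Omega>: "openin (powertop_real {..<base_dim Y}) \<Omega>"
        unfolding \<Omega>_def by (rule top_chart_image_open'[OF bt sc(1,2)[OF j]])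
      have h: "smooth_on {..<base_dim Y} \<Omega> h"
        unfolding h_def \<Omega>_def by (rule smooth_on_iter_partial[OF \<Omega>[unfolded \<Omega>_def] sc(3)[OF j] ks(1)])
      have eq: "(\<lambda>u. \<gamma> u k) = (\<lambda>u. h (cmap b (iv u)))"
        using k by (simp add: \<gamma>_def sec_coords_def sec_coord_def Fib section_deriv_def h_def ks_def b_def)
      have img: "(\<lambda>u. cmap b (iv u)) ` S \<subseteq> \<Omega>" by (auto simp: S_def iv \<Omega>_def W0_def)
      have C: "Ck 1 {..<base_dim Y} S (\<lambda>u. h (cmap b (iv u)))"
        by (rule Ck_compose[OF _ S _ \<Omega> img smooth_on_Ck[OF \<Omega> h] XB]) auto
      have "partial l (\<lambda>u. h (cmap b (iv u))) p =
          (\<Sum>\<mu><base_dim Y. partial \<mu> h (cmap b (iv p)) * partial l (\<lambda>u. cmap b (iv u) \<mu>) p)"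
        by (rule partial_compose[OF _ S _ \<Omega> img smooth_on_Ck[OF \<Omega> h] XB lK p]) auto
      also have "\<dots> = (\<Sum>\<mu><base_dim Y. J \<mu> x0 * dco \<mu> k (sec_coord c q))"
      proof (rule sum.cong[OF refl])
        fix \<mu> assume \<mu>: "\<mu> \<in> {..<base_dim Y}"
        have "partial \<mu> h (cmap b (iv p)) = section_deriv_list c j (\<mu> # ks) q"
          using x0 by (simp add: section_deriv_list_def h_def p_def iv b_def s_def x0_def)
        \<comment> \<open>\<open>ks\<close> is sorted but \<open>\<mu> # ks\<close> need not be;
          symmetry of derivatives identifies it with the coordinate of the multi-index
          \<open>add_mset \<mu> \<Sigma>\<close>.\<close>
        also have "\<dots> = section_deriv c j (add_mset \<mu> \<Sigma>) q"
          using section_deriv_perm[OF c q _ j, of "\<mu> # ks"] v ks \<mu> by simp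
        finally show "partial \<mu> h (cmap b (iv p)) * partial l (\<lambda>u. cmap b (iv u) \<mu>) p =
            J \<mu> x0 * dco \<mu> k (sec_coord c q)"
          by (simp add: pX dco_def Fib sec_coord_def)
      qed
      finally show ?thesis using C by (simp add: eq)
    qed
    have \<gamma>p: "\<gamma> p = sec_coords Y r c q" using x0 by (simp add: \<gamma>_def p_def iv s_def x0_def)
    have "section_deriv_list c' i (l # ls) q = partial l (iter_partial ls (in_chart b' (\<lambda>x. bfib c' (s x) i))) p"
      by (simp add: section_deriv_list_def b'_def s_def p_def x0_def)
    also have "\<dots> = partial l (\<lambda>u. T (\<gamma> u)) p"
    proof (rule partial_cong[OF _ S p lK])
      fix u assume "u \<in> S"
      then obtain x where x: "x \<in> W0" "u = cmap b' x" by (auto simp: S_def)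
      have "(x, s) \<in> pointed_sections Y" using W(5) x by (auto simp: W0_def)
      from TT[OF this] x show "iter_partial ls (in_chart b' (\<lambda>x. bfib c' (s x) i)) u = T (\<gamma> u)"
        by (simp add: W0_def section_deriv_list_def b'_def[symmetric] \<gamma>_def iv)
    qed simp
    also have "\<dots> = (\<Sum>k\<in>?K. partial k T (\<gamma> p) * partial l (\<lambda>u. \<gamma> u k) p)"
      by (rule partial_compose[OF _ S Kf Do \<gamma>D smooth_on_Ck[OF Do T] _ lK p]) (use key in auto)
    also have "\<dots> = (\<Sum>k\<in>?K. \<Sum>\<mu><base_dim Y. J \<mu> x0 * (partial k T (\<gamma> p) * dco \<mu> k (sec_coord c q)))"
      using key by (simp add: sum_distrib_left mult_ac)
    also have "\<dots> = (\<Sum>\<mu><base_dim Y. J \<mu> x0 * (\<Sum>k\<in>?K. partial k T (\<gamma> p) * dco \<mu> k (sec_coord c q)))"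
      by (subst sum.swap) (simp add: sum_distrib_left)
    also have "\<dots> = T' (sec_coords Y (Suc r) c q)"
      unfolding T'_def
    proof (intro sum.cong refl arg_cong2[of _ _ _ _ "(*)"])
      fix \<mu> assume \<mu>: "\<mu> \<in> {..<base_dim Y}"
      have "base_part Y (sec_coords Y (Suc r) c q) = cmap b x0"
        using top_chart_space[OF bt, of x0] x0 W0B(2)
        by (auto simp: base_part_def sec_coords_def sec_coord_def b_def x0_def PiE_iff extensional_def fun_eq_iff)
      then show "J \<mu> x0 = Jt \<mu> (sec_coords Y (Suc r) c q)"
        using x0 W0B(2) top_chart_inj[OF bt] by (auto simp: Jt_def in_chart_cmap)
      have "restrict (sec_coords Y (Suc r) c q) ?K = \<gamma> p"
        using jet_indices_mono[of r "Suc r" Y] unfolding \<gamma>p by (auto simp: sec_coords_def restrict_def fun_eq_iff)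
      then show "partial k T (\<gamma> p) = partial k T (restrict (sec_coords Y (Suc r) c q) ?K)" for k by simp
      show "dco \<mu> k (sec_coord c q) = dco \<mu> k (sec_coords Y (Suc r) c q)" if "k \<in> ?K" for k
        using that \<mu> by (cases k) (auto simp: dco_def sec_coords_def)
    qed
    finally show ?thesis .
  qed
  then show ?case using T' by (auto simp: r_def intro!: exI[of _ T'])
qed

end

subsection \<open>Sections with prescribed jets\<close>

definition taylor_monomial :: "nat \<Rightarrow> (nat \<Rightarrow> real) \<Rightarrow> nat multiset \<Rightarrow> (nat \<Rightarrow> real) \<Rightarrow> real" where
  "taylor_monomial n a \<Lambda> u = (\<Prod>l<n. (u l - a l) ^ count \<Lambda> l / fact (count \<Lambda> l))"

text \<open>The derivative along \<open>ls\<close>: thanks to the factorials, each derivative just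
  removes one index from \<open>\<Lambda>\<close>, without a numerical factor.\<close>

definition taylor_monomial_deriv ::
    "nat \<Rightarrow> (nat \<Rightarrow> real) \<Rightarrow> nat list \<Rightarrow> nat multiset \<Rightarrow> (nat \<Rightarrow> real) \<Rightarrow> real" where
  "taylor_monomial_deriv n a ls \<Lambda> u =
     (if mset ls \<subseteq># \<Lambda> then taylor_monomial n a (\<Lambda> - mset ls) u else 0)"

lemma taylor_monomial_has_derivative:
  assumes "l < n"
  shows "((\<lambda>t. taylor_monomial n a \<Lambda> (u(l := t))) has_real_derivative
    (if l \<in># \<Lambda> then taylor_monomial n a (\<Lambda> - {#l#}) u else 0)) (at (u l))"
proof -
  define R where "R = (\<Prod>k\<in>{..<n} - {l}. (u k - a k) ^ count \<Lambda> k / fact (count \<Lambda> k))"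
  define c where "c = count \<Lambda> l"
  have split: "taylor_monomial n a \<Lambda> (u(l := t)) = (t - a l) ^ c / fact c * R" for t
    unfolding taylor_monomial_def R_def c_def using assms
    by (subst prod.remove[of _ l]) (auto intro!: arg_cong2[of _ _ _ _ "(*)"] prod.cong)
  have split': "taylor_monomial n a (\<Lambda> - {#l#}) u = (u l - a l) ^ (c - 1) / fact (c - 1) * R"
    unfolding taylor_monomial_def R_def c_def using assms
    by (subst prod.remove[of _ l]) (auto intro!: arg_cong2[of _ _ _ _ "(*)"] prod.cong)
  have fact: "real c / fact c = 1 / fact (c - 1)" if "c > 0"
    using that by (simp add: fact_reduce)
  have "((\<lambda>t. (t - a l) ^ c / fact c * R) has_real_derivative
      (real c / fact c) * (u l - a l) ^ (c - 1) * R) (at (u l))"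
    by (auto intro!: derivative_eq_intros)
  moreover have "(real c / fact c) * (u l - a l) ^ (c - 1) * R =
      (if l \<in># \<Lambda> then taylor_monomial n a (\<Lambda> - {#l#}) u else 0)"
  proof (cases "c = 0")
    case True
    then show ?thesis by (simp add: c_def count_eq_zero_iff)
  next
    case False
    then have "l \<in># \<Lambda>" unfolding c_def by (meson count_eq_zero_iff)
    then show ?thesis using fact False by (simp add: split')
  qed
  ultimately show ?thesis by (simp add: split)
qed

lemma taylor_monomial_deriv_has_derivative:
  assumes "l < n"
  shows "((\<lambda>t. taylor_monomial_deriv n a ls \<Lambda> (u(l := t))) has_real_derivative
    taylor_monomial_deriv n a (l # ls) \<Lambda> u) (at (u l))"
proof (cases "mset ls \<subseteq># \<Lambda>")
  case True
  have "mset (l # ls) \<subseteq># \<Lambda> \<longleftrightarrow> l \<in># \<Lambda> - mset ls"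
    using True by (metis add_mset_add_single insert_subset_eq_iff mset.simps(2) single_subset_iff subset_mset.le_diff_conv2 union_commute)
  moreover have "\<Lambda> - mset ls - {#l#} = \<Lambda> - mset (l # ls)" by simp
  ultimately show ?thesis
    using True taylor_monomial_has_derivative[OF assms, of a "\<Lambda> - mset ls" u]
    by (auto simp: taylor_monomial_deriv_def)
next
  case False
  then have "\<not> mset (l # ls) \<subseteq># \<Lambda>" by (auto dest: mset_subset_eq_insertD)
  then show ?thesis using False by (simp add: taylor_monomial_deriv_def)
qed

lemma iter_partial_taylor:
  assumes "ls \<in> lists {..<n}"
  shows "iter_partial ls (\<lambda>u. \<Sum>\<Lambda>\<in>I. w \<Lambda> * taylor_monomial n a \<Lambda> u) =
    (\<lambda>u. \<Sum>\<Lambda>\<in>I. w \<Lambda> * taylor_monomial_deriv n a ls \<Lambda> u)"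
  using assms
proof (induction ls rule: list.induct)
  case Nil
  then show ?case by (simp add: taylor_monomial_deriv_def)
next
  case (Cons l ls)
  then have l: "l < n" and IH: "iter_partial ls (\<lambda>u. \<Sum>\<Lambda>\<in>I. w \<Lambda> * taylor_monomial n a \<Lambda> u) =
    (\<lambda>u. \<Sum>\<Lambda>\<in>I. w \<Lambda> * taylor_monomial_deriv n a ls \<Lambda> u)" by auto
  show ?case
    unfolding iter_partial.simps IH
    by (rule ext, rule partial_eqI, intro DERIV_sum DERIV_cmult taylor_monomial_deriv_has_derivative[OF l])
qed

lemma taylor_monomial_centre:
  assumes "\<Lambda> \<in> multi_indices n"
  shows "taylor_monomial n a \<Lambda> a = (if \<Lambda> = {#} then 1 else 0)"
proof (cases "\<Lambda> = {#}")
  case False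
  then obtain l where l: "l \<in># \<Lambda>" by blast
  then have "l \<in> {..<n}" using assms by (auto simp: multi_indices_def)
  then show ?thesis
    using False l unfolding taylor_monomial_def by (auto intro!: prod_zero bexI[of _ l])
qed (simp add: taylor_monomial_def)

text \<open>At the centre the derivative along \<open>\<Lambda>\<close> of the monomial of
  \<open>\<Lambda>'\<close> is a Kronecker delta: it is zero unless \<open>\<Lambda>\<close> is
  contained in \<open>\<Lambda>'\<close> and nothing remains.\<close>

lemma iter_partial_taylor_centre:
  assumes "finite I" "I \<subseteq> multi_indices n" "\<Lambda> \<in> I"
  shows "iter_partial (sorted_list_of_multiset \<Lambda>) (\<lambda>u. \<Sum>\<Lambda>\<in>I. w \<Lambda> * taylor_monomial n a \<Lambda> u) a = w \<Lambda>"
proof -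
  have ls: "sorted_list_of_multiset \<Lambda> \<in> lists {..<n}"
    using subsetD[OF assms(2,3)] by (auto simp: multi_indices_def)
  have "taylor_monomial_deriv n a (sorted_list_of_multiset \<Lambda>) \<Lambda>' a = (if \<Lambda>' = \<Lambda> then 1 else 0)" if "\<Lambda>' \<in> I" for \<Lambda>'
  proof -
    have "\<Lambda>' - \<Lambda> \<in> multi_indices n"
      using assms(2) that by (auto simp: multi_indices_def dest: in_diffD)
    then show ?thesis
      using taylor_monomial_centre[of "\<Lambda>' - \<Lambda>" n a] taylor_monomial_centre[OF multi_indices_empty, of n a]
      by (auto simp: taylor_monomial_deriv_def Diff_eq_empty_iff_mset subset_mset.antisym)
  qed
  then have "(\<Sum>\<Lambda>'\<in>I. w \<Lambda>' * taylor_monomial_deriv n a (sorted_list_of_multiset \<Lambda>) \<Lambda>' a) =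
      (\<Sum>\<Lambda>'\<in>I. if \<Lambda>' = \<Lambda> then w \<Lambda> else 0)"
    by (intro sum.cong) auto
  then show ?thesis using assms by (simp add: iter_partial_taylor[OF ls])
qed

lemma smooth_on_taylor:
  assumes "openin (powertop_real {..<n}) S"
  shows "smooth_on {..<n} S (\<lambda>u. \<Sum>\<Lambda>\<in>I. w \<Lambda> * taylor_monomial n a \<Lambda> u)"
proof -
  note K = finite_lessThan[of n] assms
  have "smooth_on {..<n} S (\<lambda>u. (u l - a l) ^ m)" for l m
    by (induction m) (auto intro!: smooth_on_const[OF K] smooth_on_mult[OF K] smooth_on_diff[OF K] smooth_on_coord[OF K])
  then have "smooth_on {..<n} S (\<lambda>u. (u l - a l) ^ m * (1 / fact m))" for l m
    by (intro smooth_on_mult[OF K] smooth_on_const[OF K])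
  then have "smooth_on {..<n} S (taylor_monomial n a \<Lambda>)" for \<Lambda>
    unfolding taylor_monomial_def by (intro smooth_on_prod[OF K]) simp
  then show ?thesis by (intro smooth_on_sum[OF K] smooth_on_mult[OF K] smooth_on_const[OF K])
qed

context smooth_fibration
begin

text \<open>In the chart, take as fibre coordinates the polynomials whose Taylor coefficients at the
  base point are the numbers \<open>p (Fib i \<Lambda>)\<close>. Jet coordinates thus satisfy no
  relation beyond lying over the chart.\<close>

lemma ex_section_coords:
  assumes c: "is_bundle_chart Y c" and p: "p \<in> jet_image Y r c U"
  obtains q where "q \<in> pointed_sections Y" "snd q (fst q) \<in> bdom c \<inter> U" "sec_coords Y r c q = p"
proof -
  let ?n = "base_dim Y" and ?m = "fib_dim Y"
  define b where "b = bbase c"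
  define tc where "tc = total_chart Y c"
  note bt = base_top_chart[OF c, folded b_def] and tt = total_top_chart[OF c, folded tc_def]
  obtain y where y: "y \<in> bdom c" "y \<in> U" "total_part Y p = cmap tc y"
    using p by (auto simp: jet_image_def tc_def)
  define x0 where "x0 = proj Y y"
  have x0: "x0 \<in> cdom b" using proj_bdom[OF c y(1)] by (simp add: x0_def b_def)
  define a where "a = cmap b x0"
  define I where "I = {\<Lambda>. \<Lambda> \<in> multi_indices ?n \<and> size \<Lambda> \<le> r}"
  have I: "finite I" "I \<subseteq> multi_indices ?n" using finite_multi_indices_le by (auto simp: I_def)
  define f where "f i u = (\<Sum>\<Lambda>\<in>I. p (Fib i \<Lambda>) * taylor_monomial ?n a \<Lambda> u)" for i u
  define \<Phi> where "\<Phi> u = append_coords ?n ?m u (\<lambda>i. f i u)" for u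
  define s where "s x = inv_into (bdom c) (cmap tc) (\<Phi> (cmap b x))" for x
  note B = top_chart_image_open'[OF bt top_chart_open[OF bt] order_refl]
  have \<Phi>: "smooth_on {..<?n} (cmap b ` cdom b) (\<lambda>u. \<Phi> u k)" if "k < ?n + ?m" for k
    using that smooth_on_coord[OF _ B] smooth_on_taylor[OF B]
    by (cases "k < ?n") (auto simp: \<Phi>_def append_coords_apply f_def)
  have \<Phi>s: "\<Phi> u \<in> coord_space {..<?n + ?m}" for u by (simp add: \<Phi>_def append_coords_def)
  \<comment> \<open>The polynomials are defined over the whole base chart, but their graph may leave
    the image of the chart of \<open>Y\<close>.\<close>
  define W where "W = {x \<in> cdom b. \<Phi> (cmap b x) \<in> cmap tc ` bdom c}"
  have cf: "continuous_map (subtopology (mtop (base_mfd Y)) (cdom b)) (powertop_real {..<?n + ?m}) (\<lambda>x. \<Phi> (cmap b x))"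
    unfolding continuous_map_componentwise
  proof (intro conjI ballI)
    fix k assume k: "k \<in> {..<?n + ?m}"
    have 1: "continuous_map (subtopology (powertop_real {..<?n}) (cmap b ` cdom b)) euclideanreal (iter_partial [] (\<lambda>u. \<Phi> u k))"
      using \<Phi>[of k] k unfolding smooth_on_def by blast
    have 2: "continuous_map (subtopology (mtop (base_mfd Y)) (cdom b)) (subtopology (powertop_real {..<?n}) (cmap b ` cdom b)) (cmap b)"
      using top_chart_continuous[OF bt] by (auto simp: continuous_map_in_subtopology)
    show "continuous_map (subtopology (mtop (base_mfd Y)) (cdom b)) euclideanreal (\<lambda>x. \<Phi> (cmap b x) k)"
      using continuous_map_compose[OF 2 1] by (simp add: o_def)
  qed (use \<Phi>s in \<open>auto simp: PiE_def\<close>)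
  have topb: "topspace (subtopology (mtop (base_mfd Y)) (cdom b)) = cdom b"
    by (rule top_chart_topspace[OF bt])
  have "openin (powertop_real {..<?n + ?m}) (cmap tc ` bdom c)"
    using top_chart_image_open'[OF tt openin_bdom[OF c]] by (simp add: tc_def)
  from openin_continuous_map_preimage[OF cf this]
  have W: "openin (mtop (base_mfd Y)) W"
    unfolding topb W_def using top_chart_open[OF bt] openin_trans_full by blast
  have tcs: "cmap tc (s x) = \<Phi> (cmap b x)" "s x \<in> bdom c" if "x \<in> W" for x
    using that unfolding W_def s_def by (auto simp: f_inv_into_f inv_into_into)
  have WB: "W \<subseteq> cdom b" by (auto simp: W_def)
  have Wop: "openin (powertop_real {..<?n}) (cmap b ` W)" by (rule top_chart_image_open'[OF bt W WB])
  have inv: "inv_into (cdom b) (cmap b) (cmap b x) = x" if "x \<in> W" for x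
    using that WB top_chart_inj[OF bt] by auto
  have sm: "smooth_map (base_mfd Y) W (total_mfd Y) s"
  proof (rule smooth_mapI_charts[OF base_structure total_structure base_chart[OF c] total_chart_manifold[OF c] W])
    show "W \<subseteq> cdom (bbase c)" using WB by (simp add: b_def)
    show "s ` W \<subseteq> cdom (total_chart Y c)" using tcs by auto
    fix k assume k: "k < mdim (total_mfd Y)"
    have "smooth_on {..<?n} (cmap b ` W) (\<lambda>u. \<Phi> u k)"
      using smooth_on_subset[OF \<Phi>] k WB by (simp add: total_dim image_mono)
    then show "smooth_on {..<?n} (cmap (bbase c) ` W) (in_chart (bbase c) (\<lambda>a. cmap (total_chart Y c) (s a) k))"
      unfolding b_def[symmetric] tc_def[symmetric]
      by (rule smooth_on_cong[OF _ Wop, rotated]) (auto simp: in_chart_def inv tcs)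
  qed
  have ps: "proj Y (s x) = x" if x: "x \<in> W" for x
  proof -
    have pd: "proj Y (s x) \<in> cdom b" using proj_bdom[OF c tcs(2)[OF x]] by (simp add: b_def)
    have xB: "x \<in> cdom b" using x WB by auto
    have "cmap b (proj Y (s x)) l = cmap b x l" if "l < ?n" for l
      using fun_cong[OF tcs(1)[OF x], of l] that
      by (simp add: tc_def cmap_total_chart append_coords_apply \<Phi>_def b_def)
    then have "cmap b (proj Y (s x)) = cmap b x"
      by (intro PiE_ext[OF top_chart_space[OF bt pd] top_chart_space[OF bt xB]]) auto
    then show ?thesis using top_chart_inj[OF bt] pd x WB by (auto dest: inj_onD)
  qed
  have fc: "iter_partial (sorted_list_of_multiset \<Lambda>) (f i) a = p (Fib i \<Lambda>)" if "\<Lambda> \<in> I" for i \<Lambda>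
    using iter_partial_taylor_centre[OF I that, of "\<lambda>\<Lambda>. p (Fib i \<Lambda>)" a] by (simp add: f_def[abs_def])
  have pB: "p (Bas l) = a l" if "l < ?n" for l
    using fun_cong[OF y(3), of l] that
    by (simp add: total_part_def tc_def cmap_total_chart append_coords_apply a_def b_def x0_def)
  have \<Phi>a: "\<Phi> a = cmap tc y"
    unfolding y(3)[symmetric] using pB fc[of "{#}"]
    by (auto simp: \<Phi>_def total_part_def append_coords_apply fun_eq_iff I_def)
  have x0W: "x0 \<in> W" using x0 y(1) by (auto simp: W_def a_def[symmetric] \<Phi>a)
  have sx0: "s x0 = y" using y(1) top_chart_inj[OF tt] by (simp add: s_def a_def[symmetric] \<Phi>a tc_def)
  have q: "(x0, s) \<in> pointed_sections Y"
    unfolding pointed_sections_def using W x0W sm ps by auto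
  show thesis
  proof (rule that[OF q])
    show "snd (x0, s) (fst (x0, s)) \<in> bdom c \<inter> U" using y sx0 by simp
    have pK: "p \<in> coord_space (jet_indices Y r)" using p by (simp add: jet_image_def)
    have "sec_coord c (x0, s) k = p k" if k: "k \<in> jet_indices Y r" for k
    proof (cases k)
      case (Bas l)
      then show ?thesis using k pB by (simp add: sec_coord_def a_def b_def)
    next
      case (Fib i \<Lambda>)
      then have i: "i < ?m" and \<Lambda>: "\<Lambda> \<in> I" using k by (auto simp: I_def)
      have "iter_partial (sorted_list_of_multiset \<Lambda>) (in_chart b (\<lambda>x. bfib c (s x) i)) a = iter_partial (sorted_list_of_multiset \<Lambda>) (f i) a"
      proof (rule iter_partial_cong[OF _ Wop])
        show "a \<in> cmap b ` W" using x0W by (simp add: a_def)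
        show "sorted_list_of_multiset \<Lambda> \<in> lists {..<?n}" using subsetD[OF I(2) \<Lambda>] by (auto simp: multi_indices_def)
        fix u assume "u \<in> cmap b ` W"
        then obtain x where x: "x \<in> W" "u = cmap b x" by auto
        then show "in_chart b (\<lambda>x. bfib c (s x) i) u = f i u"
          using fun_cong[OF tcs(1)[OF x(1)], of "?n + i"] i
          by (simp add: in_chart_def inv tc_def cmap_total_chart append_coords_apply \<Phi>_def)
      qed simp
      then show ?thesis
        using fc[OF \<Lambda>] by (simp add: Fib sec_coord_def section_deriv_def b_def[symmetric] a_def[symmetric])
    qed
    then show "sec_coords Y r c (x0, s) = p"
      using pK by (auto simp: sec_coords_def PiE_iff extensional_def fun_eq_iff)
  qed
qed

section \<open>Jets and infinite jets in coordinates\<close>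

lemma section_deriv_transition:
  assumes c: "is_bundle_chart Y c" and c': "is_bundle_chart Y c'" and i: "i < fib_dim Y"
    and \<Lambda>: "\<Lambda> \<in> multi_indices (base_dim Y)"
  obtains T where "smooth_on (jet_indices Y (size \<Lambda>)) (jet_image Y (size \<Lambda>) c (bdom c')) T"
    "\<And>q. q \<in> pointed_sections Y \<Longrightarrow> snd q (fst q) \<in> bdom c \<inter> bdom c' \<Longrightarrow>
       section_deriv c' i \<Lambda> q = T (sec_coords Y (size \<Lambda>) c q)"
proof -
  have ls: "sorted_list_of_multiset \<Lambda> \<in> lists {..<base_dim Y}" using \<Lambda> by (auto simp: multi_indices_def)
  have len: "length (sorted_list_of_multiset \<Lambda>) = size \<Lambda>" by (metis mset_sorted_list_of_multiset size_mset)
  show thesis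
    using section_deriv_list_transition[OF c c' i ls] that
    unfolding len section_deriv_list_def section_deriv_def by blast
qed

lemma restrict_sec_coords:
  "r \<le> r' \<Longrightarrow> restrict (sec_coords Y r' c q) (jet_indices Y r) = sec_coords Y r c q"
  using jet_indices_mono[of r r' Y] by (auto simp: sec_coords_def restrict_def fun_eq_iff)

text \<open>\<open>jet_rel\<close> compares derivatives in all charts; one chart suffices because a
  transition function of order up to \<open>r\<close> involves only coordinates of order up to
  \<open>r\<close>.\<close>

lemma jet_rel_iff:
  assumes c: "is_bundle_chart Y c" and q: "q \<in> pointed_sections Y" "snd q (fst q) \<in> bdom c"
    and q': "q' \<in> pointed_sections Y" "snd q' (fst q') \<in> bdom c"
  shows "(q, q') \<in> jet_rel Y r \<longleftrightarrow> sec_coords Y r c q = sec_coords Y r c q'"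
proof
  assume L: "(q, q') \<in> jet_rel Y r"
  have "sec_coord c q k = sec_coord c q' k" if "k \<in> jet_indices Y r" for k
    using L c q(2) that by (cases k) (auto simp: jet_rel_def sec_coord_def)
  then show "sec_coords Y r c q = sec_coords Y r c q'"
    by (auto simp: sec_coords_def restrict_def fun_eq_iff)
next
  assume R: "sec_coords Y r c q = sec_coords Y r c q'"
  have p: "proj Y (snd q (fst q)) = fst q" "proj Y (snd q' (fst q')) = fst q'"
    using q(1) q'(1) by (elim pointed_sectionsE, simp)+
  have "total_part Y (sec_coord c q) = total_part Y (sec_coord c q')"
    using arg_cong[OF R, of "total_part Y"] by (simp add: sec_coords_def total_part_restrict)
  then have v: "snd q (fst q) = snd q' (fst q')"
    using total_part_sec_coord[OF c] q q' top_chart_inj[OF total_top_chart[OF c]]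
    by (auto dest: inj_onD)
  then have f: "fst q = fst q'" using p by metis
  have "section_deriv c' i \<Lambda> q = section_deriv c' i \<Lambda> q'"
    if c': "is_bundle_chart Y c'" "snd q (fst q) \<in> bdom c'" and i: "i < fib_dim Y"
      and \<Lambda>: "\<Lambda> \<in> multi_indices (base_dim Y)" "size \<Lambda> \<le> r" for c' i \<Lambda>
  proof -
    obtain T where T: "smooth_on (jet_indices Y (size \<Lambda>)) (jet_image Y (size \<Lambda>) c (bdom c')) T"
      "\<And>q. q \<in> pointed_sections Y \<Longrightarrow> snd q (fst q) \<in> bdom c \<inter> bdom c' \<Longrightarrow>
         section_deriv c' i \<Lambda> q = T (sec_coords Y (size \<Lambda>) c q)"
      using section_deriv_transition[OF c c'(1) i \<Lambda>(1)] by metis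
    have "sec_coords Y (size \<Lambda>) c q = sec_coords Y (size \<Lambda>) c q'"
      using R restrict_sec_coords[OF \<Lambda>(2)] by metis
    then show ?thesis using T(2)[OF q(1)] T(2)[OF q'(1)] q q' v c'(2) by simp
  qed
  then show "(q, q') \<in> jet_rel Y r"
    using q(1) q'(1) f v unfolding jet_rel_def by blast
qed

lemma jet_class_eq:
  assumes "q \<in> pointed_sections Y" "q' \<in> pointed_sections Y"
  shows "jet_rel Y r `` {q} = jet_rel Y r `` {q'} \<longleftrightarrow> (q, q') \<in> jet_rel Y r"
  using eq_equiv_class_iff[OF jet_rel_equiv assms] .

text \<open>\<open>jet_value\<close> and \<open>jet_coord\<close> choose a representative of the
  class. It has the same jet as \<open>q\<close>, so both can be computed from
  \<open>q\<close>.\<close>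

lemma some_in_jet_class:
  assumes "q \<in> pointed_sections Y"
  shows "(q, SOME q'. q' \<in> jet_rel Y r `` {q}) \<in> jet_rel Y r"
proof -
  have "q \<in> jet_rel Y r `` {q}" using equiv_class_self[OF jet_rel_equiv assms] .
  then show ?thesis by (metis Image_singleton_iff someI)
qed

lemma jet_value_class:
  assumes "q \<in> pointed_sections Y"
  shows "jet_value (jet_rel Y r `` {q}) = snd q (fst q)"
  using some_in_jet_class[OF assms, of r] by (auto simp: jet_value_def jet_rel_def Let_def)

lemma jet_coord_class:
  assumes "is_bundle_chart Y c" "q \<in> pointed_sections Y" "snd q (fst q) \<in> bdom c" "k \<in> jet_indices Y r"
  shows "jet_coord c (jet_rel Y r `` {q}) k = sec_coord c q k"
  using some_in_jet_class[OF assms(2), of r] assms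
  by (cases k) (auto simp: jet_coord_def sec_coord_def jet_rel_def Let_def)

lemma section_value_in_total:
  assumes "q \<in> pointed_sections Y" shows "snd q (fst q) \<in> total_space Y"
proof -
  obtain W where W: "openin (mtop (base_mfd Y)) W" "fst q \<in> W" "smooth_map (base_mfd Y) W (total_mfd Y) (snd q)"
    "\<forall>x'\<in>W. proj Y (snd q x') = x'" "\<forall>x'\<in>W. (x', snd q) \<in> pointed_sections Y"
    by (rule pointed_sectionsE[OF assms])
  have "fst q \<in> topspace (subtopology (mtop (base_mfd Y)) W)" using W(1,2) openin_subset by auto
  then show ?thesis using W(3) unfolding smooth_map_def continuous_map_def by blast
qed

text \<open>A section chosen at order \<open>r\<close> represents all lower components of
  \<open>z\<close> too, since these are projections of the component of order
  \<open>r\<close>.\<close>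

lemma inf_jets_rep:
  assumes z: "z \<in> inf_jets Y"
  obtains q where "q \<in> pointed_sections Y" "\<And>r'. r' \<le> r \<Longrightarrow> z r' = jet_rel Y r' `` {q}"
proof -
  have "z r \<in> jets Y r" using z by (auto simp: inf_jets_def)
  then obtain q where q: "q \<in> pointed_sections Y" "z r = jet_rel Y r `` {q}"
    by (auto simp: jets_def elim: quotientE)
  \<comment> \<open>Downward induction on the order \<open>r - d\<close>; once
    \<open>d \<ge> r\<close>, truncated subtraction leaves the order at zero.\<close>
  have *: "z (r - d) = jet_rel Y (r - d) `` {q}" for d
  proof (induction d)
    case (Suc d)
    show ?case
    proof (cases "d < r")
      case True
      then have eq: "Suc (r - Suc d) = r - d" by simp
      have "jet_proj Y (r - Suc d) (z (Suc (r - Suc d))) = z (r - Suc d)"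
        using z unfolding inf_jets_def by blast
      then have "z (r - Suc d) = jet_proj Y (r - Suc d) (jet_rel Y (r - d) `` {q})"
        unfolding eq Suc.IH by (rule sym)
      also have "\<dots> = jet_rel Y (r - Suc d) `` {q}" by (rule jet_proj_class[OF q(1)]) simp
      finally show ?thesis .
    next
      case False
      then have "r - Suc d = r - d" by simp
      then show ?thesis using Suc.IH by simp
    qed
  qed (use q in simp)
  have "z r' = jet_rel Y r' `` {q}" if "r' \<le> r" for r' using *[of "r - r'"] that by simp
  then show thesis by (rule that[OF q(1)])
qed

definition inf_coords :: "nat \<Rightarrow> ('x, 'y) bundle_chart \<Rightarrow> ('x, 'y) inf_jet \<Rightarrow> jet_index \<Rightarrow> real" where
  "inf_coords r c z = restrict (inf_jet_coord c z) (jet_indices Y r)"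

lemma inf_jets_over_rep:
  assumes c: "is_bundle_chart Y c" and z: "z \<in> inf_jets_over Y U" and U: "U \<subseteq> bdom c"
  obtains q where "q \<in> pointed_sections Y" "snd q (fst q) \<in> U" "\<And>r'. r' \<le> r \<Longrightarrow> z r' = jet_rel Y r' `` {q}"
    "\<And>k. k \<in> jet_indices Y r \<Longrightarrow> inf_jet_coord c z k = sec_coord c q k" "inf_coords r c z = sec_coords Y r c q"
proof -
  have zi: "z \<in> inf_jets Y" "jet_value (z 0) \<in> U" using z by (auto simp: inf_jets_over_def)
  obtain q where q: "q \<in> pointed_sections Y" "\<And>r'. r' \<le> r \<Longrightarrow> z r' = jet_rel Y r' `` {q}"
    using inf_jets_rep[OF zi(1)] by metis
  have v: "snd q (fst q) \<in> U" using zi(2) q jet_value_class[OF q(1), of 0] by simp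
  have eq: "inf_jet_coord c z k = sec_coord c q k" if "k \<in> jet_indices Y r" for k
  proof (cases k)
    case (Bas l)
    then show ?thesis using that q v U jet_coord_class[OF c q(1), of k 0] by (auto simp: inf_jet_coord_def)
  next
    case (Fib i \<Lambda>)
    then show ?thesis using that q v U jet_coord_class[OF c q(1), of k "size \<Lambda>"] by (auto simp: inf_jet_coord_def)
  qed
  have "inf_coords r c z = sec_coords Y r c q"
    using eq by (auto simp: inf_coords_def sec_coords_def restrict_def fun_eq_iff)
  from that[OF q(1) v q(2) eq this] show thesis by blast
qed

lemma prolongation:
  assumes q: "q \<in> pointed_sections Y" and v: "snd q (fst q) \<in> U"
  shows "(\<lambda>r. jet_rel Y r `` {q}) \<in> inf_jets_over Y U"
  using q v jet_value_class[OF q, of 0]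
  by (auto simp: inf_jets_over_def inf_jets_def jets_def jet_proj_class intro: quotientI)

lemma inf_jets_over_mono: "U \<subseteq> U' \<Longrightarrow> inf_jets_over Y U \<subseteq> inf_jets_over Y U'"
  by (auto simp: inf_jets_over_def)

lemma inf_jets_over_total: "inf_jets_over Y (total_space Y) = inf_jets Y"
proof -
  have "jet_value (z 0) \<in> total_space Y" if z: "z \<in> inf_jets Y" for z
  proof -
    obtain q where "q \<in> pointed_sections Y" "\<And>r'. r' \<le> 0 \<Longrightarrow> z r' = jet_rel Y r' `` {q}"
      using inf_jets_rep[OF z] by metis
    then show ?thesis using jet_value_class section_value_in_total by simp
  qed
  then show ?thesis by (auto simp: inf_jets_over_def)
qed

lemma jet_value_const:
  assumes "z \<in> inf_jets Y" shows "jet_value (z r) = jet_value (z 0)"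
  using inf_jets_rep[OF assms, of r] jet_value_class by (metis le0 order_refl)

lemma inf_coords_eq_iff:
  assumes c: "is_bundle_chart Y c" and z: "z \<in> inf_jets_over Y (bdom c)" and w: "w \<in> inf_jets_over Y (bdom c)"
  shows "inf_coords r c z = inf_coords r c w \<longleftrightarrow> z r = w r"
proof -
  obtain q where q: "q \<in> pointed_sections Y" "snd q (fst q) \<in> bdom c" "\<And>r'. r' \<le> r \<Longrightarrow> z r' = jet_rel Y r' `` {q}"
    "inf_coords r c z = sec_coords Y r c q"
    using inf_jets_over_rep[OF c z order_refl] by metis
  obtain q' where q': "q' \<in> pointed_sections Y" "snd q' (fst q') \<in> bdom c" "\<And>r'. r' \<le> r \<Longrightarrow> w r' = jet_rel Y r' `` {q'}"
    "inf_coords r c w = sec_coords Y r c q'"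
    using inf_jets_over_rep[OF c w order_refl] by metis
  show ?thesis
    using q q' jet_class_eq[OF q(1) q'(1)] jet_rel_iff[OF c q(1,2) q'(1,2)] by simp
qed

lemma restrict_inf_coords:
  "r \<le> r' \<Longrightarrow> restrict (inf_coords r' c z) (jet_indices Y r) = inf_coords r c z"
  using jet_indices_mono[of r r' Y] by (auto simp: inf_coords_def restrict_def fun_eq_iff)

lemma inf_coords_in_image:
  assumes c: "is_bundle_chart Y c" and z: "z \<in> inf_jets_over Y (bdom c \<inter> U)"
  shows "inf_coords r c z \<in> jet_image Y r c U"
proof -
  obtain q where "q \<in> pointed_sections Y" "snd q (fst q) \<in> bdom c \<inter> U" "inf_coords r c z = sec_coords Y r c q"
    using inf_jets_over_rep[OF c z Int_lower1] by metis
  then show ?thesis using sec_coords_in_jet_image[OF c] by simp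
qed

lemma ex_inf_coords:
  assumes c: "is_bundle_chart Y c" and p: "p \<in> jet_image Y r c U"
  obtains z where "z \<in> inf_jets_over Y (bdom c \<inter> U)" "inf_coords r c z = p"
proof -
  obtain q where q: "q \<in> pointed_sections Y" "snd q (fst q) \<in> bdom c \<inter> U" "sec_coords Y r c q = p"
    by (rule ex_section_coords[OF c p])
  define z where "z = (\<lambda>r. jet_rel Y r `` {q})"
  have z: "z \<in> inf_jets_over Y (bdom c \<inter> U)" unfolding z_def by (rule prolongation[OF q(1,2)])
  obtain q' where q': "q' \<in> pointed_sections Y" "snd q' (fst q') \<in> bdom c \<inter> U" "\<And>r'. r' \<le> r \<Longrightarrow> z r' = jet_rel Y r' `` {q'}"
    "inf_coords r c z = sec_coords Y r c q'"
    using inf_jets_over_rep[OF c z Int_lower1] by metis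
  have "(q, q') \<in> jet_rel Y r" using q'(3)[of r] jet_class_eq[OF q(1) q'(1)] by (simp add: z_def)
  then have "sec_coords Y r c q' = p" using jet_rel_iff[OF c q(1) _ q'(1)] q q' by auto
  then show thesis using that z q' by simp
qed

lemma inf_chart_inj: "is_bundle_chart Y c \<Longrightarrow> inj_on (cmap (inf_jet_chart Y c)) (cdom (inf_jet_chart Y c))"
proof (rule inj_onI, simp add: inf_jet_chart_def, rule ext)
  fix z w r
  assume c: "is_bundle_chart Y c" and z: "z \<in> inf_jets_over Y (bdom c)" "w \<in> inf_jets_over Y (bdom c)"
    and eq: "restrict (inf_jet_coord c z) (inf_jet_indices Y) = restrict (inf_jet_coord c w) (inf_jet_indices Y)"
  have "inf_jet_coord c z k = inf_jet_coord c w k" if "k \<in> jet_indices Y r" for k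
    using fun_cong[OF eq, of k] that by (auto simp: inf_jet_indices_def split: if_splits)
  then have "inf_coords r c z = inf_coords r c w" by (auto simp: inf_coords_def restrict_def fun_eq_iff)
  then show "z r = w r" using inf_coords_eq_iff[OF c z] by simp
qed

text \<open>A section is chosen for each order separately; their lower coordinates agree, so the
  classes form a compatible sequence. Hence one coordinate of an infinite jet can be moved, while
  the underlying point of \<open>Y\<close> stays in the chart, without leaving the chart image.
  Partial derivatives on the infinite jet space rest on this.\<close>

lemma ex_inf_jet:
  assumes c: "is_bundle_chart Y c" and p: "p \<in> coord_space (inf_jet_indices Y)"
    and t: "total_part Y p \<in> cmap (total_chart Y c) ` (bdom c \<inter> U)"
  obtains z where "z \<in> inf_jets_over Y (bdom c \<inter> U)" "cmap (inf_jet_chart Y c) z = p"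
proof -
  have "restrict p (jet_indices Y r) \<in> jet_image Y r c U" for r
    using t by (auto simp: jet_image_def total_part_restrict)
  then have "\<exists>q. q \<in> pointed_sections Y \<and> snd q (fst q) \<in> bdom c \<inter> U \<and> sec_coords Y r c q = restrict p (jet_indices Y r)" for r
    using ex_section_coords[OF c] by metis
  then obtain q where q: "\<And>r. q r \<in> pointed_sections Y" "\<And>r. snd (q r) (fst (q r)) \<in> bdom c \<inter> U"
    "\<And>r. sec_coords Y r c (q r) = restrict p (jet_indices Y r)" by metis
  define z where "z r = jet_rel Y r `` {q r}" for r
  have "jet_proj Y r (z (Suc r)) = z r" for r
  proof -
    have "sec_coords Y r c (q (Suc r)) = sec_coords Y r c (q r)"
      using restrict_sec_coords[of r "Suc r" c "q (Suc r)", symmetric] jet_indices_mono[of r "Suc r" Y]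
      by (simp add: q(3) Int_absorb1)
    then have "(q (Suc r), q r) \<in> jet_rel Y r" using jet_rel_iff[OF c q(1) _ q(1)] q(2) by blast
    then show ?thesis
      using jet_proj_class[OF q(1), of r "Suc r"] jet_class_eq[OF q(1) q(1)] by (simp add: z_def)
  qed
  then have zi: "z \<in> inf_jets Y" using q(1) by (auto simp: inf_jets_def z_def jets_def intro: quotientI)
  have zo: "z \<in> inf_jets_over Y (bdom c \<inter> U)"
    using zi q(2)[of 0] jet_value_class[OF q(1)[of 0], of 0] by (simp add: inf_jets_over_def z_def)
  have "inf_jet_coord c z k = p k" if "k \<in> inf_jet_indices Y" for k
  proof -
    obtain r where r: "k \<in> jet_indices Y r" using \<open>k \<in> _\<close> by (auto simp: inf_jet_indices_def)
    obtain q' where q': "q' \<in> pointed_sections Y" "snd q' (fst q') \<in> bdom c \<inter> U" "\<And>r'. r' \<le> r \<Longrightarrow> z r' = jet_rel Y r' `` {q'}"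
      "inf_coords r c z = sec_coords Y r c q'"
      using inf_jets_over_rep[OF c zo Int_lower1] by metis
    have "(q r, q') \<in> jet_rel Y r" using q'(3)[of r] jet_class_eq[OF q(1) q'(1)] by (simp add: z_def)
    then have "inf_coords r c z = restrict p (jet_indices Y r)"
      using jet_rel_iff[OF c q(1) _ q'(1)] q q' by auto
    from fun_cong[OF this, of k] show ?thesis using r by (simp add: inf_coords_def)
  qed
  then have "cmap (inf_jet_chart Y c) z = p"
    using p by (auto simp: inf_jet_chart_def PiE_iff extensional_def fun_eq_iff)
  then show thesis using that zo by blast
qed

end

section \<open>Functions of finite jet order in coordinates\<close>

context smooth_fibration
begin

lemma base_coord_inf:
  assumes c: "is_bundle_chart Y c" and z: "z \<in> inf_jets_over Y (bdom c)"
  shows "base_part Y (inf_coords r c z) = cmap (bbase c) (proj Y (jet_value (z 0)))"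
proof -
  obtain q where q: "q \<in> pointed_sections Y" "snd q (fst q) \<in> bdom c" "\<And>r'. r' \<le> r \<Longrightarrow> z r' = jet_rel Y r' `` {q}"
    "inf_coords r c z = sec_coords Y r c q"
    using inf_jets_over_rep[OF c z order_refl] by metis
  have "proj Y (snd q (fst q)) = fst q" using q(1) by (elim pointed_sectionsE) simp
  then have v: "proj Y (jet_value (z 0)) = fst q" using q(3)[of 0] jet_value_class[OF q(1), of 0] by simp
  have "fst q \<in> cdom (bbase c)" using proj_bdom[OF c q(2)] \<open>proj Y (snd q (fst q)) = fst q\<close> by simp
  then have "cmap (bbase c) (fst q) \<in> coord_space {..<base_dim Y}" by (rule top_chart_space[OF base_top_chart[OF c]])
  then show ?thesis
    unfolding v q(4) by (auto simp: base_part_def sec_coords_def sec_coord_def PiE_iff extensional_def fun_eq_iff)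
qed

lemma inf_jet_coord_Bas:
  assumes "is_bundle_chart Y c" "z \<in> inf_jets_over Y (bdom c)" "l < base_dim Y"
  shows "inf_jet_coord c z (Bas l) = cmap (bbase c) (proj Y (jet_value (z 0))) l"
  using fun_cong[OF base_coord_inf[OF assms(1,2), of 0], of l] assms(3)
  by (simp add: base_part_def inf_coords_def)

lemma smooth_on_restrict_coords:
  assumes F: "smooth_on (jet_indices Y r) (jet_image Y r c U) F" and r: "r \<le> r'"
    and c: "is_bundle_chart Y c" and U: "openin (mtop (total_mfd Y)) U"
  shows "smooth_on (jet_indices Y r') (jet_image Y r' c U) (\<lambda>p. F (restrict p (jet_indices Y r)))"
proof (rule smooth_on_compose[OF finite_jet_indices openin_jet_image[OF c U] finite_jet_indices openin_jet_image[OF c U] F])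
  show "(\<lambda>p. restrict p (jet_indices Y r)) ` jet_image Y r' c U \<subseteq> jet_image Y r c U"
    using restrict_jet_image by blast
  show "smooth_on (jet_indices Y r') (jet_image Y r' c U) (\<lambda>p. restrict p (jet_indices Y r) l)"
    if "l \<in> jet_indices Y r" for l
    using smooth_on_coord[OF finite_jet_indices openin_jet_image[OF c U]] that by simp
qed

text \<open>Bundle charts take their base coordinates from charts of the base, so this transition
  factors through \<open>base_part\<close>. Its derivatives in the fibre coordinates vanish for that
  reason.\<close>

lemma Bas_transition:
  assumes c: "is_bundle_chart Y c" and c': "is_bundle_chart Y c'" and l: "l < base_dim Y"
  obtains F where "smooth_on {..<base_dim Y} (cmap (bbase c) ` (cdom (bbase c) \<inter> cdom (bbase c'))) F"
    "smooth_on (jet_indices Y r) (jet_image Y r c (bdom c')) (\<lambda>p. F (base_part Y p))"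
    "\<And>z. z \<in> inf_jets_over Y (bdom c \<inter> bdom c') \<Longrightarrow>
       inf_jet_coord c' z (Bas l) = F (base_part Y (inf_coords r c z))"
proof
  let ?F = "in_chart (bbase c) (\<lambda>x. cmap (bbase c') x l)"
  show F: "smooth_on {..<base_dim Y} (cmap (bbase c) ` (cdom (bbase c) \<inter> cdom (bbase c'))) ?F"
    by (rule manifold_chart_transition[OF base_structure base_chart[OF c] base_chart[OF c'] l])
  have op: "openin (powertop_real {..<base_dim Y}) (cmap (bbase c) ` (cdom (bbase c) \<inter> cdom (bbase c')))"
    using top_chart_image_open[OF base_top_chart[OF c] top_chart_open[OF base_top_chart[OF c']]] .
  note K = finite_jet_indices[of Y r] openin_jet_image[OF c openin_bdom[OF c'], of r]
  show "smooth_on (jet_indices Y r) (jet_image Y r c (bdom c')) (\<lambda>p. ?F (base_part Y p))"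
  proof (rule smooth_on_compose[OF K finite_lessThan op F])
    show "base_part Y ` jet_image Y r c (bdom c') \<subseteq> cmap (bbase c) ` (cdom (bbase c) \<inter> cdom (bbase c'))"
      using base_part_in_image[OF c c'] by blast
    show "smooth_on (jet_indices Y r) (jet_image Y r c (bdom c')) (\<lambda>p. base_part Y p k)" if "k \<in> {..<base_dim Y}" for k
      using smooth_on_coord[OF K] that by (simp add: base_part_def)
  qed
  fix z assume z: "z \<in> inf_jets_over Y (bdom c \<inter> bdom c')"
  then have "z \<in> inf_jets_over Y (bdom c)" "z \<in> inf_jets_over Y (bdom c')" "jet_value (z 0) \<in> bdom c"
    by (auto simp: inf_jets_over_def)
  then show "inf_jet_coord c' z (Bas l) = ?F (base_part Y (inf_coords r c z))"
    using inf_jet_coord_Bas[OF c' _ l] base_coord_inf[OF c] proj_bdom[OF c]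
    by (simp add: in_chart_cmap[OF top_chart_inj[OF base_top_chart[OF c]]])
qed

lemma inf_coord_transition:
  assumes c: "is_bundle_chart Y c" and c': "is_bundle_chart Y c'" and k: "k \<in> jet_indices Y r"
  obtains T where "smooth_on (jet_indices Y r) (jet_image Y r c (bdom c')) T"
    "\<And>z. z \<in> inf_jets_over Y (bdom c \<inter> bdom c') \<Longrightarrow> inf_jet_coord c' z k = T (inf_coords r c z)"
proof (cases k)
  case (Bas l)
  then have l: "l < base_dim Y" using k by simp
  show thesis
    by (rule Bas_transition[OF c c' l, of r]) (rule that, auto simp: Bas)
next
  case (Fib i \<Lambda>)
  then have i: "i < fib_dim Y" "\<Lambda> \<in> multi_indices (base_dim Y)" "size \<Lambda> \<le> r" using k by auto
  obtain T where T: "smooth_on (jet_indices Y (size \<Lambda>)) (jet_image Y (size \<Lambda>) c (bdom c')) T"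
      "\<And>q. q \<in> pointed_sections Y \<Longrightarrow> snd q (fst q) \<in> bdom c \<inter> bdom c' \<Longrightarrow>
         section_deriv c' i \<Lambda> q = T (sec_coords Y (size \<Lambda>) c q)"
    using section_deriv_transition[OF c c' i(1,2)] by metis
  show thesis
  proof (rule that)
    show "smooth_on (jet_indices Y r) (jet_image Y r c (bdom c')) (\<lambda>p. T (restrict p (jet_indices Y (size \<Lambda>))))"
      by (rule smooth_on_restrict_coords[OF T(1) i(3) c openin_bdom[OF c']])
    fix z assume z: "z \<in> inf_jets_over Y (bdom c \<inter> bdom c')"
    obtain q where q: "q \<in> pointed_sections Y" "snd q (fst q) \<in> bdom c \<inter> bdom c'" "\<And>r'. r' \<le> r \<Longrightarrow> z r' = jet_rel Y r' `` {q}"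
      "\<And>k. k \<in> jet_indices Y r \<Longrightarrow> inf_jet_coord c z k = sec_coord c q k" "inf_coords r c z = sec_coords Y r c q"
      using inf_jets_over_rep[OF c z Int_lower1, of r] by metis
    have "z \<in> inf_jets_over Y (bdom c')" using z by (auto simp: inf_jets_over_def)
    then obtain q' where q': "q' \<in> pointed_sections Y" "snd q' (fst q') \<in> bdom c'" "\<And>r'. r' \<le> r \<Longrightarrow> z r' = jet_rel Y r' `` {q'}"
      "\<And>k. k \<in> jet_indices Y r \<Longrightarrow> inf_jet_coord c' z k = sec_coord c' q' k" "inf_coords r c' z = sec_coords Y r c' q'"
      using inf_jets_over_rep[OF c' _ order_refl, of z r] by metis
    \<comment> \<open>The coordinates in the two charts were read off from separately chosen
      representatives; they define the same jet.\<close>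
    have "jet_rel Y r `` {q} = jet_rel Y r `` {q'}" using q(3)[OF order_refl] q'(3)[OF order_refl] by simp
    then have "(q, q') \<in> jet_rel Y r" using jet_class_eq[OF q(1) q'(1)] by simp
    then have "sec_coords Y r c' q = sec_coords Y r c' q'"
      using jet_rel_iff[OF c' q(1) _ q'(1,2)] q(2) by blast
    from fun_cong[OF this, of k] have "sec_coord c' q k = sec_coord c' q' k" using k by (simp add: sec_coords_def)
    then have "inf_jet_coord c' z k = section_deriv c' i \<Lambda> q"
      using q'(4)[OF k] by (simp add: sec_coord_def Fib)
    also have "\<dots> = T (sec_coords Y (size \<Lambda>) c q)" by (rule T(2)[OF q(1,2)])
    also have "sec_coords Y (size \<Lambda>) c q = restrict (inf_coords r c z) (jet_indices Y (size \<Lambda>))"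
      unfolding q(5) by (rule restrict_sec_coords[OF i(3), symmetric])
    finally show "inf_jet_coord c' z k = T (restrict (inf_coords r c z) (jet_indices Y (size \<Lambda>)))" .
  qed
qed

text \<open>All transition functions up to order \<open>r\<close> as one map. The inclusion of
  images is obtained by lifting a coordinate point to an infinite jet and reading that in the other
  chart.\<close>

lemma coords_transition:
  assumes c: "is_bundle_chart Y c" and c': "is_bundle_chart Y c'"
  obtains \<Phi> where "\<And>k. k \<in> jet_indices Y r \<Longrightarrow> smooth_on (jet_indices Y r) (jet_image Y r c (bdom c')) (\<lambda>p. \<Phi> p k)"
    "\<And>z. z \<in> inf_jets_over Y (bdom c \<inter> bdom c') \<Longrightarrow> inf_coords r c' z = \<Phi> (inf_coords r c z)"
    "\<And>U. \<Phi> ` jet_image Y r c (bdom c' \<inter> U) \<subseteq> jet_image Y r c' (bdom c \<inter> U)"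
proof -
  define P where "P k T \<longleftrightarrow> smooth_on (jet_indices Y r) (jet_image Y r c (bdom c')) T \<and>
    (\<forall>z\<in>inf_jets_over Y (bdom c \<inter> bdom c'). inf_jet_coord c' z k = T (inf_coords r c z))" for k T
  define T where "T k = (SOME T. P k T)" for k
  have T: "P k (T k)" if k: "k \<in> jet_indices Y r" for k
  proof -
    have "\<exists>T. P k T" by (rule inf_coord_transition[OF c c' k]) (auto simp: P_def)
    then show ?thesis unfolding T_def by (rule someI_ex)
  qed
  define \<Phi> where "\<Phi> p = (\<lambda>k\<in>jet_indices Y r. T k p)" for p
  have \<Phi>z: "inf_coords r c' z = \<Phi> (inf_coords r c z)" if "z \<in> inf_jets_over Y (bdom c \<inter> bdom c')" for z
    using T that by (auto simp: \<Phi>_def inf_coords_def P_def restrict_def fun_eq_iff)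
  show thesis
  proof (rule that)
    show "smooth_on (jet_indices Y r) (jet_image Y r c (bdom c')) (\<lambda>p. \<Phi> p k)" if "k \<in> jet_indices Y r" for k
      using T[OF that] that by (simp add: \<Phi>_def P_def)
    show "\<Phi> ` jet_image Y r c (bdom c' \<inter> U) \<subseteq> jet_image Y r c' (bdom c \<inter> U)" for U
    proof
      fix p' assume "p' \<in> \<Phi> ` jet_image Y r c (bdom c' \<inter> U)"
      then obtain p where p: "p \<in> jet_image Y r c (bdom c' \<inter> U)" "p' = \<Phi> p" by auto
      obtain z where z: "z \<in> inf_jets_over Y (bdom c \<inter> (bdom c' \<inter> U))" "inf_coords r c z = p"
        by (rule ex_inf_coords[OF c p(1)])
      have "z \<in> inf_jets_over Y (bdom c \<inter> bdom c')" "z \<in> inf_jets_over Y (bdom c' \<inter> (bdom c \<inter> U))"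
        using z(1) by (auto simp: inf_jets_over_def)
      then show "p' \<in> jet_image Y r c' (bdom c \<inter> U)"
        using inf_coords_in_image[OF c', of z "bdom c \<inter> U" r] \<Phi>z z(2) p(2) by simp
    qed
  qed (rule \<Phi>z)
qed

text \<open>The working form of finite jet order: a single chart, and an explicit order that
  survives chart changes (\<open>smooth_of_order_chart\<close>) and the joining of local pieces
  (\<open>smooth_of_order_local\<close>).\<close>

definition smooth_of_order ::
    "nat \<Rightarrow> ('x, 'y) bundle_chart \<Rightarrow> 'y set \<Rightarrow> (('x, 'y) inf_jet \<Rightarrow> real) \<Rightarrow> bool" where
  "smooth_of_order r c U f \<longleftrightarrow> (\<exists>F. smooth_on (jet_indices Y r) (jet_image Y r c U) F \<and>
     (\<forall>z\<in>inf_jets_over Y (bdom c \<inter> U). f z = F (inf_coords r c z)))"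

lemma smooth_of_orderI:
  "smooth_on (jet_indices Y r) (jet_image Y r c U) F \<Longrightarrow>
   (\<And>z. z \<in> inf_jets_over Y (bdom c \<inter> U) \<Longrightarrow> f z = F (inf_coords r c z)) \<Longrightarrow> smooth_of_order r c U f"
  unfolding smooth_of_order_def by blast

lemma smooth_of_orderE:
  assumes "smooth_of_order r c U f"
  obtains F where "smooth_on (jet_indices Y r) (jet_image Y r c U) F"
    "\<And>z. z \<in> inf_jets_over Y (bdom c \<inter> U) \<Longrightarrow> f z = F (inf_coords r c z)"
  using assms unfolding smooth_of_order_def by blast

lemma smooth_of_order_cong:
  "smooth_of_order r c U f \<Longrightarrow> (\<And>z. z \<in> inf_jets_over Y (bdom c \<inter> U) \<Longrightarrow> g z = f z) \<Longrightarrow> smooth_of_order r c U g"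
  unfolding smooth_of_order_def by (metis (no_types, lifting))

lemma smooth_of_order_subset:
  assumes f: "smooth_of_order r c U f" and "bdom c \<inter> U' \<subseteq> U" shows "smooth_of_order r c U' f"
proof -
  obtain F where F: "smooth_on (jet_indices Y r) (jet_image Y r c U) F"
    "\<And>z. z \<in> inf_jets_over Y (bdom c \<inter> U) \<Longrightarrow> f z = F (inf_coords r c z)"
    by (rule smooth_of_orderE[OF f], rule that)
  show ?thesis
  proof (rule smooth_of_orderI)
    show "smooth_on (jet_indices Y r) (jet_image Y r c U') F"
      by (rule smooth_on_subset[OF F(1)]) (use assms(2) in \<open>auto simp: jet_image_def\<close>)
    show "f z = F (inf_coords r c z)" if "z \<in> inf_jets_over Y (bdom c \<inter> U')" for z
      using that assms(2) by (intro F(2)) (auto simp: inf_jets_over_def)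
  qed
qed

context
  fixes c :: "('x, 'y) bundle_chart" and U :: "'y set"
  assumes c: "is_bundle_chart Y c" and U: "openin (mtop (total_mfd Y)) U"
begin

lemma smooth_of_order_mono:
  assumes f: "smooth_of_order r c U f" and r: "r \<le> r'" shows "smooth_of_order r' c U f"
proof -
  obtain F where F: "smooth_on (jet_indices Y r) (jet_image Y r c U) F"
    "\<And>z. z \<in> inf_jets_over Y (bdom c \<inter> U) \<Longrightarrow> f z = F (inf_coords r c z)"
    by (rule smooth_of_orderE[OF f], rule that)
  show ?thesis
    by (rule smooth_of_orderI[OF smooth_on_restrict_coords[OF F(1) r c U]]) (simp add: F(2) restrict_inf_coords[OF r])
qed

lemma smooth_of_order_const: "smooth_of_order r c U (\<lambda>_. a)"
  by (rule smooth_of_orderI[OF smooth_on_const[OF finite_jet_indices openin_jet_image[OF c U]]]) simp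

lemma smooth_of_order_coord: "k \<in> jet_indices Y r \<Longrightarrow> smooth_of_order r c U (\<lambda>z. inf_jet_coord c z k)"
  by (rule smooth_of_orderI[OF smooth_on_coord[OF finite_jet_indices openin_jet_image[OF c U], of r k]]) (simp add: inf_coords_def)

lemma smooth_of_order_add:
  assumes "smooth_of_order r c U f" "smooth_of_order r c U g" shows "smooth_of_order r c U (\<lambda>z. f z + g z)"
proof -
  obtain F G where "smooth_on (jet_indices Y r) (jet_image Y r c U) F" "\<And>z. z \<in> inf_jets_over Y (bdom c \<inter> U) \<Longrightarrow> f z = F (inf_coords r c z)"
    "smooth_on (jet_indices Y r) (jet_image Y r c U) G" "\<And>z. z \<in> inf_jets_over Y (bdom c \<inter> U) \<Longrightarrow> g z = G (inf_coords r c z)"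
    using assms unfolding smooth_of_order_def by blast
  then show ?thesis
    by (intro smooth_of_orderI[OF smooth_on_add[OF finite_jet_indices openin_jet_image[OF c U], of r F G]]) auto
qed

lemma smooth_of_order_mult:
  assumes "smooth_of_order r c U f" "smooth_of_order r c U g" shows "smooth_of_order r c U (\<lambda>z. f z * g z)"
proof -
  obtain F G where "smooth_on (jet_indices Y r) (jet_image Y r c U) F" "\<And>z. z \<in> inf_jets_over Y (bdom c \<inter> U) \<Longrightarrow> f z = F (inf_coords r c z)"
    "smooth_on (jet_indices Y r) (jet_image Y r c U) G" "\<And>z. z \<in> inf_jets_over Y (bdom c \<inter> U) \<Longrightarrow> g z = G (inf_coords r c z)"
    using assms unfolding smooth_of_order_def by blast
  then show ?thesis
    by (intro smooth_of_orderI[OF smooth_on_mult[OF finite_jet_indices openin_jet_image[OF c U], of r F G]]) auto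
qed

lemma smooth_of_order_sum:
  assumes "\<And>i. i \<in> I \<Longrightarrow> smooth_of_order r c U (f i)" shows "smooth_of_order r c U (\<lambda>z. \<Sum>i\<in>I. f i z)"
  using assms by (induction I rule: infinite_finite_induct) (auto intro: smooth_of_order_const smooth_of_order_add)

lemma smooth_of_order_inverse:
  assumes f: "smooth_of_order r c U f" and nz: "\<And>z. z \<in> inf_jets_over Y (bdom c \<inter> U) \<Longrightarrow> f z \<noteq> 0"
  shows "smooth_of_order r c U (\<lambda>z. inverse (f z))"
proof -
  obtain F where F: "smooth_on (jet_indices Y r) (jet_image Y r c U) F"
    "\<And>z. z \<in> inf_jets_over Y (bdom c \<inter> U) \<Longrightarrow> f z = F (inf_coords r c z)"
    by (rule smooth_of_orderE[OF f], rule that)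
  have "F p \<noteq> 0" if p: "p \<in> jet_image Y r c U" for p
    by (rule ex_inf_coords[OF c p]) (use F(2) nz in auto)
  then show ?thesis
    by (intro smooth_of_orderI[OF smooth_on_inverse[OF finite_jet_indices openin_jet_image[OF c U] F(1)]]) (auto simp: F(2))
qed

lemma smooth_of_order_chart:
  assumes c': "is_bundle_chart Y c'" and f: "smooth_of_order r c' (bdom c \<inter> U) f"
  shows "smooth_of_order r c (bdom c' \<inter> U) f"
proof -
  obtain F where F: "smooth_on (jet_indices Y r) (jet_image Y r c' (bdom c \<inter> U)) F"
    "\<And>z. z \<in> inf_jets_over Y (bdom c' \<inter> (bdom c \<inter> U)) \<Longrightarrow> f z = F (inf_coords r c' z)"
    by (rule smooth_of_orderE[OF f], rule that)
  obtain \<Phi> where \<Phi>: "\<And>k. k \<in> jet_indices Y r \<Longrightarrow> smooth_on (jet_indices Y r) (jet_image Y r c (bdom c')) (\<lambda>p. \<Phi> p k)"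
    "\<And>z. z \<in> inf_jets_over Y (bdom c \<inter> bdom c') \<Longrightarrow> inf_coords r c' z = \<Phi> (inf_coords r c z)"
    "\<And>U. \<Phi> ` jet_image Y r c (bdom c' \<inter> U) \<subseteq> jet_image Y r c' (bdom c \<inter> U)"
    using coords_transition[OF c c', of r] by metis
  have o1: "openin (mtop (total_mfd Y)) (bdom c' \<inter> U)" and o2: "openin (mtop (total_mfd Y)) (bdom c \<inter> U)"
    using U openin_bdom[OF c] openin_bdom[OF c'] by auto
  show ?thesis
  proof (rule smooth_of_orderI)
    show "smooth_on (jet_indices Y r) (jet_image Y r c (bdom c' \<inter> U)) (\<lambda>p. F (\<Phi> p))"
    proof (rule smooth_on_compose[OF finite_jet_indices openin_jet_image[OF c o1] finite_jet_indices openin_jet_image[OF c' o2] F(1) \<Phi>(3)])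
      show "smooth_on (jet_indices Y r) (jet_image Y r c (bdom c' \<inter> U)) (\<lambda>p. \<Phi> p l)" if "l \<in> jet_indices Y r" for l
        by (rule smooth_on_subset[OF \<Phi>(1)[OF that] jet_image_mono]) simp
    qed
    fix z assume "z \<in> inf_jets_over Y (bdom c \<inter> (bdom c' \<inter> U))"
    then have "z \<in> inf_jets_over Y (bdom c' \<inter> (bdom c \<inter> U))" "z \<in> inf_jets_over Y (bdom c \<inter> bdom c')"
      by (auto simp: inf_jets_over_def)
    then show "f z = F (\<Phi> (inf_coords r c z))" using F(2) \<Phi>(2) by simp
  qed
qed

text \<open>The local expressions are not chosen coherently; a global one is the value of
  \<open>f\<close> at a lift of the coordinate point. Two lifts have the same jet of order
  \<open>r\<close>, and over the neighbourhood \<open>U'\<close> the function depends only on this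
  jet.\<close>

lemma smooth_of_order_local:
  assumes loc: "\<And>y. y \<in> bdom c \<inter> U \<Longrightarrow> \<exists>U'. openin (mtop (total_mfd Y)) U' \<and> y \<in> U' \<and> U' \<subseteq> U \<and> smooth_of_order r c U' f"
  shows "smooth_of_order r c U f"
proof -
  define pick where "pick p = (SOME z. z \<in> inf_jets_over Y (bdom c \<inter> U) \<and> inf_coords r c z = p)" for p
  have key: "f (pick p) = f z" if z: "z \<in> inf_jets_over Y (bdom c \<inter> U)" "inf_coords r c z = p" for z p
  proof -
    have p: "pick p \<in> inf_jets_over Y (bdom c \<inter> U) \<and> inf_coords r c (pick p) = p"
      unfolding pick_def by (rule someI[of _ z]) (use z in simp)
    define y where "y = jet_value (z 0)"
    have y: "y \<in> bdom c \<inter> U" using z by (simp add: inf_jets_over_def y_def)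
    obtain U' where U': "openin (mtop (total_mfd Y)) U'" "y \<in> U'" "U' \<subseteq> U" "smooth_of_order r c U' f"
      using loc[OF y] by (elim exE conjE)
    obtain F where F: "\<And>z. z \<in> inf_jets_over Y (bdom c \<inter> U') \<Longrightarrow> f z = F (inf_coords r c z)"
      by (rule smooth_of_orderE[OF U'(4)], rule that)
    have zc: "z \<in> inf_jets_over Y (bdom c)" "pick p \<in> inf_jets_over Y (bdom c)"
      using z(1) p by (auto simp: inf_jets_over_def)
    have "pick p r = z r" using inf_coords_eq_iff[OF c zc(2,1), of r] p z(2) by simp
    then have "jet_value (pick p 0) = y"
      using jet_value_const[of z r] jet_value_const[of "pick p" r] zc by (simp add: y_def inf_jets_over_def)
    then have "pick p \<in> inf_jets_over Y (bdom c \<inter> U')" "z \<in> inf_jets_over Y (bdom c \<inter> U')"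
      using zc y U'(2) by (auto simp: inf_jets_over_def y_def)
    then show ?thesis using F p z(2) by simp
  qed
  show ?thesis
  proof (rule smooth_of_orderI)
    show "smooth_on (jet_indices Y r) (jet_image Y r c U) (\<lambda>p. f (pick p))"
    proof (rule smooth_on_local_cong[OF finite_jet_indices jet_image_subset_space])
      fix p assume p: "p \<in> jet_image Y r c U"
      obtain y where y: "y \<in> bdom c \<inter> U" "total_part Y p = cmap (total_chart Y c) y" using p by (auto simp: jet_image_def)
      obtain U' where U': "openin (mtop (total_mfd Y)) U'" "y \<in> U'" "U' \<subseteq> U" "smooth_of_order r c U' f"
        using loc[OF y(1)] by (elim exE conjE)
      obtain F where F: "smooth_on (jet_indices Y r) (jet_image Y r c U') F"
        "\<And>z. z \<in> inf_jets_over Y (bdom c \<inter> U') \<Longrightarrow> f z = F (inf_coords r c z)"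
        by (rule smooth_of_orderE[OF U'(4)], rule that)
      have "F q = f (pick q)" if q: "q \<in> jet_image Y r c U'" for q
      proof -
        obtain z where z: "z \<in> inf_jets_over Y (bdom c \<inter> U')" "inf_coords r c z = q" by (rule ex_inf_coords[OF c q])
        have "z \<in> inf_jets_over Y (bdom c \<inter> U)" using z(1) U'(3) by (auto simp: inf_jets_over_def)
        then show ?thesis using key[OF _ z(2)] F(2)[OF z(1)] z(2) by simp
      qed
      moreover have "p \<in> jet_image Y r c U'" using p y U'(2) by (auto simp: jet_image_def)
      ultimately show "\<exists>N G. openin (powertop_real (jet_indices Y r)) N \<and> p \<in> N \<and> N \<subseteq> jet_image Y r c U \<and>
          smooth_on (jet_indices Y r) N G \<and> (\<forall>q\<in>N. G q = f (pick q))"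
        using openin_jet_image[OF c U'(1)] jet_image_mono[OF U'(3), of Y r c] F(1)
        by (intro exI[of _ "jet_image Y r c U'"] exI[of _ F]) auto
    qed
    show "f z = f (pick (inf_coords r c z))" if "z \<in> inf_jets_over Y (bdom c \<inter> U)" for z
      using key[OF that refl] by simp
  qed
qed

end

section \<open>Functions on finite order jet manifolds and their pull-backs\<close>

lemma jet_chart_coords:
  assumes c: "is_bundle_chart Y c" and z: "z \<in> inf_jets_over Y (bdom c)"
  shows "cmap (jet_chart Y r c) (z r) = inf_coords r c z"
proof -
  obtain q where q: "q \<in> pointed_sections Y" "snd q (fst q) \<in> bdom c" "\<And>r'. r' \<le> r \<Longrightarrow> z r' = jet_rel Y r' `` {q}"
    "inf_coords r c z = sec_coords Y r c q"
    using inf_jets_over_rep[OF c z order_refl] by metis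
  show ?thesis
    using jet_coord_class[OF c q(1,2)] q(3)[of r]
    by (auto simp: jet_chart_def q(4) sec_coords_def restrict_def fun_eq_iff)
qed

lemma jets_over_eq: "jets_over Y r U = (\<lambda>z. z r) ` inf_jets_over Y U"
proof -
  have "j \<in> (\<lambda>z. z r) ` inf_jets_over Y U" if j: "j \<in> jets Y r" "jet_value j \<in> U" for j
  proof -
    obtain z where z: "z \<in> inf_jets Y" "j = z r" using j(1) inf_jets_surj[of r Y] by blast
    then show ?thesis using j(2) jet_value_const[OF z(1), of r] by (auto simp: inf_jets_over_def)
  qed
  moreover have "z r \<in> jets Y r \<and> jet_value (z r) \<in> U" if "z \<in> inf_jets_over Y U" for z
    using that jet_value_const[of z r] by (auto simp: inf_jets_over_def inf_jets_def)
  ultimately show ?thesis by (auto simp: jets_over_def)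
qed

lemma jet_chart_inj: "is_bundle_chart Y c \<Longrightarrow> inj_on (cmap (jet_chart Y r c)) (cdom (jet_chart Y r c))"
proof (rule inj_onI)
  fix i j assume c: "is_bundle_chart Y c" and ij: "i \<in> cdom (jet_chart Y r c)" "j \<in> cdom (jet_chart Y r c)"
    and eq: "cmap (jet_chart Y r c) i = cmap (jet_chart Y r c) j"
  then obtain z w where zw: "z \<in> inf_jets_over Y (bdom c)" "w \<in> inf_jets_over Y (bdom c)" "i = z r" "j = w r"
    by (auto simp: jet_chart_def jets_over_eq)
  then show "i = j" using eq jet_chart_coords[OF c] inf_coords_eq_iff[OF c zw(1,2)] by simp
qed

lemma jet_chart_image:
  assumes c: "is_bundle_chart Y c"
  shows "cmap (jet_chart Y r c) ` (cdom (jet_chart Y r c) \<inter> jets_over Y r U) = jet_image Y r c U"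
proof -
  have "cdom (jet_chart Y r c) \<inter> jets_over Y r U = jets_over Y r (bdom c \<inter> U)"
    by (auto simp: jet_chart_def jets_over_def)
  then have "cmap (jet_chart Y r c) ` (cdom (jet_chart Y r c) \<inter> jets_over Y r U) =
      (\<lambda>z. cmap (jet_chart Y r c) (z r)) ` inf_jets_over Y (bdom c \<inter> U)"
    by (simp add: jets_over_eq image_image)
  also have "\<dots> = inf_coords r c ` inf_jets_over Y (bdom c \<inter> U)"
    using jet_chart_coords[OF c] inf_jets_over_mono[of "bdom c \<inter> U" "bdom c"] by (intro image_cong) auto
  also have "\<dots> = jet_image Y r c U"
  proof
    show "jet_image Y r c U \<subseteq> inf_coords r c ` inf_jets_over Y (bdom c \<inter> U)"
    proof
      fix p assume "p \<in> jet_image Y r c U"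
      then show "p \<in> inf_coords r c ` inf_jets_over Y (bdom c \<inter> U)" by (rule ex_inf_coords[OF c]) auto
    qed
  qed (use inf_coords_in_image[OF c] in auto)
  finally show ?thesis .
qed

text \<open>The order is that of the jet manifold from which \<open>f\<close> is pulled back, hence
  the same for all charts.\<close>

lemma fin_order_functions_smooth:
  assumes "f \<in> fin_order_functions Y U"
  obtains r where "\<And>c. is_bundle_chart Y c \<Longrightarrow> smooth_of_order r c U f"
proof -
  obtain r g where g: "smooth_fun (jet_atlas Y r) (jet_indices Y r) (jets_over Y r U) g"
    "\<forall>z\<in>inf_jets_over Y U. f z = g (z r)"
    using assms by (auto simp: fin_order_functions_def)
  have "smooth_of_order r c U f" if c: "is_bundle_chart Y c" for c
  proof (rule smooth_of_orderI)
    have "jet_chart Y r c \<in> jet_atlas Y r" using c by (auto simp: jet_atlas_def)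
    then show "smooth_on (jet_indices Y r) (jet_image Y r c U) (in_chart (jet_chart Y r c) g)"
      using g(1) jet_chart_image[OF c] by (auto simp: smooth_fun_def)
    fix z assume z: "z \<in> inf_jets_over Y (bdom c \<inter> U)"
    then have zc: "z \<in> inf_jets_over Y (bdom c)" "z \<in> inf_jets_over Y U" by (auto simp: inf_jets_over_def)
    then have "z r \<in> cdom (jet_chart Y r c)" by (auto simp: jet_chart_def jets_over_eq)
    then have "in_chart (jet_chart Y r c) g (cmap (jet_chart Y r c) (z r)) = g (z r)"
      by (rule in_chart_cmap[OF jet_chart_inj[OF c]])
    then show "f z = in_chart (jet_chart Y r c) g (inf_coords r c z)"
      using g(2) zc jet_chart_coords[OF c] by simp
  qed
  then show thesis using that by blast
qed

text \<open>\<open>jet_atlas\<close> contains all bundle charts, but tests in the charts of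
  \<open>A\<close> with one common order imply the others. The function on the jet manifold takes at
  a jet the value of \<open>f\<close> at some infinite jet above it.\<close>

lemma fin_order_functionsI:
  assumes A: "bundle_atlas Y A" and U: "openin (mtop (total_mfd Y)) U"
    and f0: "\<And>z. z \<notin> inf_jets_over Y U \<Longrightarrow> f z = 0"
    and f: "\<And>c. c \<in> A \<Longrightarrow> smooth_of_order r c U f"
  shows "f \<in> fin_order_functions Y U"
proof -
  have A': "is_bundle_chart Y c" if "c \<in> A" for c using A that by (auto simp: bundle_atlas_def)
  have f': "smooth_of_order r c U f" if c: "is_bundle_chart Y c" for c
  proof (rule smooth_of_order_local[OF c U])
    fix y assume y: "y \<in> bdom c \<inter> U"
    then have "y \<in> total_space Y" using openin_subset[OF U] by auto
    then obtain c' where c': "c' \<in> A" "y \<in> bdom c'" using A by (auto simp: bundle_atlas_def)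
    have "smooth_of_order r c' (bdom c \<inter> U) f" by (rule smooth_of_order_subset[OF f[OF c'(1)]]) auto
    then have "smooth_of_order r c (bdom c' \<inter> U) f"
      by (rule smooth_of_order_chart[OF c U A'[OF c'(1)]])
    then show "\<exists>U'. openin (mtop (total_mfd Y)) U' \<and> y \<in> U' \<and> U' \<subseteq> U \<and> smooth_of_order r c U' f"
      using y c'(2) U openin_bdom[OF A'[OF c'(1)]] by (intro exI[of _ "bdom c' \<inter> U"]) auto
  qed
  define g where "g j = f (SOME z. z \<in> inf_jets_over Y U \<and> z r = j)" for j
  have gz: "f z = g (z r)" if z: "z \<in> inf_jets_over Y U" for z
  proof -
    define w where "w = (SOME w. w \<in> inf_jets_over Y U \<and> w r = z r)"
    have w: "w \<in> inf_jets_over Y U \<and> w r = z r" unfolding w_def by (rule someI[of _ z]) (use z in simp)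
    define y where "y = jet_value (z 0)"
    have y: "y \<in> U" "jet_value (w 0) = y"
      using z w jet_value_const[of z r] jet_value_const[of w r] by (auto simp: inf_jets_over_def y_def)
    then have "y \<in> total_space Y" using openin_subset[OF U] by auto
    then obtain c where c: "c \<in> A" "y \<in> bdom c" using A by (auto simp: bundle_atlas_def)
    obtain F where F: "\<And>z. z \<in> inf_jets_over Y (bdom c \<inter> U) \<Longrightarrow> f z = F (inf_coords r c z)"
      by (rule smooth_of_orderE[OF f[OF c(1)]], rule that)
    have zw: "z \<in> inf_jets_over Y (bdom c \<inter> U)" "w \<in> inf_jets_over Y (bdom c \<inter> U)"
      using z w y c(2) by (auto simp: inf_jets_over_def y_def)
    have "inf_coords r c z = inf_coords r c w"
      using inf_coords_eq_iff[OF A'[OF c(1)], of z w r] zw w by (auto simp: inf_jets_over_def)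
    then show ?thesis using F zw by (simp add: g_def w_def[symmetric])
  qed
  have "smooth_fun (jet_atlas Y r) (jet_indices Y r) (jets_over Y r U) g"
    unfolding smooth_fun_def jet_atlas_def
  proof
    fix jc assume "jc \<in> {jet_chart Y r c |c. is_bundle_chart Y c}"
    then obtain c where jc: "jc = jet_chart Y r c" and c: "is_bundle_chart Y c" by auto
    obtain F where F: "smooth_on (jet_indices Y r) (jet_image Y r c U) F"
      "\<And>z. z \<in> inf_jets_over Y (bdom c \<inter> U) \<Longrightarrow> f z = F (inf_coords r c z)"
      using f'[OF c] unfolding smooth_of_order_def by blast
    have "smooth_on (jet_indices Y r) (jet_image Y r c U) (in_chart (jet_chart Y r c) g)"
    proof (rule smooth_on_cong[OF finite_jet_indices openin_jet_image[OF c U] F(1)])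
      fix p assume p: "p \<in> jet_image Y r c U"
      obtain z where z: "z \<in> inf_jets_over Y (bdom c \<inter> U)" "inf_coords r c z = p" by (rule ex_inf_coords[OF c p])
      then have zc: "z \<in> inf_jets_over Y (bdom c)" "z \<in> inf_jets_over Y U" by (auto simp: inf_jets_over_def)
      then have "z r \<in> cdom (jet_chart Y r c)" by (auto simp: jet_chart_def jets_over_eq)
      then have "in_chart (jet_chart Y r c) g (cmap (jet_chart Y r c) (z r)) = g (z r)"
        by (rule in_chart_cmap[OF jet_chart_inj[OF c]])
      then show "F p = in_chart (jet_chart Y r c) g p"
        using gz[OF zc(2)] F(2)[OF z(1)] z(2) jet_chart_coords[OF c zc(1)] by simp
    qed
    then show "smooth_on (jet_indices Y r) (cmap jc ` (cdom jc \<inter> jets_over Y r U)) (in_chart jc g)"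
      by (simp add: jc jet_chart_image[OF c])
  qed
  then show ?thesis using f0 gz by (auto simp: fin_order_functions_def)
qed

end

subsection \<open>Cut-off functions\<close>

context smooth_fibration
begin

lemma total_part_inf_coords:
  assumes c: "is_bundle_chart Y c" and z: "z \<in> inf_jets_over Y (bdom c)"
  shows "total_part Y (inf_coords r c z) = cmap (total_chart Y c) (jet_value (z 0))"
proof -
  obtain q where q: "q \<in> pointed_sections Y" "snd q (fst q) \<in> bdom c" "\<And>r'. r' \<le> r \<Longrightarrow> z r' = jet_rel Y r' `` {q}"
    "inf_coords r c z = sec_coords Y r c q"
    using inf_jets_over_rep[OF c z order_refl] by metis
  then show ?thesis
    using total_part_sec_coord[OF c q(1,2)] q(3)[of 0] jet_value_class[OF q(1), of 0]
    by (simp add: sec_coords_def total_part_restrict)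
qed

text \<open>A bump function on \<open>Y\<close>, pulled back. The test for \<open>U\<close> sets it
  to zero where the coordinates of \<open>c\<close> may have no meaning.\<close>

definition box_bump ::
    "('x, 'y) bundle_chart \<Rightarrow> 'y set \<Rightarrow> (jet_index \<Rightarrow> real) \<times> real \<Rightarrow> ('x, 'y) inf_jet \<Rightarrow> real" where
  "box_bump c U b z =
     (if z \<in> inf_jets_over Y U then bump (jet_indices Y 0) (fst b) (snd b) (inf_coords 0 c z) else 0)"

text \<open>The support of a bump function lies over a compact, hence closed, subset of \<open>U\<close>.\<close>

lemma smooth_of_order_box_bump:
  assumes c: "is_bundle_chart Y c" and U: "openin (mtop (total_mfd Y)) U" "U \<subseteq> bdom c"
    and b: "b \<in> rat_boxes (jet_indices Y 0) (jet_image Y 0 c U)" and g: "smooth_of_order r c U g"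
    and c': "is_bundle_chart Y c'"
  shows "smooth_of_order r c' (total_space Y) (\<lambda>z. box_bump c U b z * g z)"
proof (rule smooth_of_order_local[OF c' openin_topspace])
  let ?K = "jet_indices Y 0" and ?N = "mtop (total_mfd Y)"
  obtain a e where ae: "b = (a, e)" by (cases b)
  have e: "e > 0" "cbox_at ?K a e \<subseteq> jet_image Y 0 c U" using b by (auto simp: rat_boxes_def ae)
  fix y assume y: "y \<in> bdom c' \<inter> total_space Y"
  show "\<exists>U'. openin ?N U' \<and> y \<in> U' \<and> U' \<subseteq> total_space Y \<and> smooth_of_order r c' U' (\<lambda>z. box_bump c U b z * g z)"
  proof (cases "y \<in> U")
    case True
    have "smooth_of_order 0 c U (box_bump c U b)"
    proof (rule smooth_of_orderI)
      show "smooth_on ?K (jet_image Y 0 c U) (bump ?K a e)"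
        by (rule smooth_on_bump[OF finite_jet_indices openin_jet_image[OF c U(1)]])
      show "box_bump c U b z = bump ?K a e (inf_coords 0 c z)" if "z \<in> inf_jets_over Y (bdom c \<inter> U)" for z
        using that by (auto simp: box_bump_def ae inf_jets_over_def)
    qed
    then have "smooth_of_order r c U (box_bump c U b)" by (rule smooth_of_order_mono[OF c U(1)]) simp
    then have "smooth_of_order r c U (\<lambda>z. box_bump c U b z * g z)" by (rule smooth_of_order_mult[OF c U(1) _ g])
    then have "smooth_of_order r c (bdom c' \<inter> U) (\<lambda>z. box_bump c U b z * g z)"
      by (rule smooth_of_order_subset) auto
    then have "smooth_of_order r c' (bdom c \<inter> U) (\<lambda>z. box_bump c U b z * g z)"
      by (rule smooth_of_order_chart[OF c' U(1) c])
    then show ?thesis using True U openin_subset[OF U(1)] by (intro exI[of _ U]) (auto simp: Int_absorb1)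
  next
    case False
    define tc where "tc = total_chart Y c"
    note tt = total_top_chart[OF c, folded tc_def]
    define iv where "iv = inv_into (cdom tc) (cmap tc)"
    define C where "C = iv ` total_part Y ` cbox_at ?K a e"
    have tcb: "cdom tc = bdom c" by (simp add: tc_def)
    have im: "total_part Y ` cbox_at ?K a e \<subseteq> cmap tc ` (bdom c \<inter> U)"
      using e(2) by (auto simp: jet_image_def tc_def)
    have "compactin (powertop_real {..<base_dim Y + fib_dim Y}) (total_part Y ` cbox_at ?K a e)"
      by (rule image_compactin[OF compactin_cbox_at continuous_map_total_part])
    then have "compactin (subtopology (powertop_real {..<base_dim Y + fib_dim Y}) (cmap tc ` cdom tc)) (total_part Y ` cbox_at ?K a e)"
      using im by (auto simp: compactin_subtopology tcb)
    then have "compactin ?N C"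
      unfolding C_def iv_def by (rule image_compactin[OF _ top_chart_inv_continuous[OF tt]])
    then have "closedin ?N C"
      using compactin_imp_closedin total_structure unfolding smooth_structure_def by blast
    then have op: "openin ?N (total_space Y - C)" by blast
    have "C \<subseteq> U"
    proof
      fix x assume "x \<in> C"
      then obtain u where u: "u \<in> total_part Y ` cbox_at ?K a e" "x = iv u" by (auto simp: C_def)
      then obtain x' where "x' \<in> bdom c \<inter> U" "u = cmap tc x'" using subsetD[OF im u(1)] by (elim imageE)
      with u(2) show "x \<in> U" using top_chart_inj[OF tt] by (simp add: iv_def tcb)
    qed
    have zero: "box_bump c U b z = 0" if z: "z \<in> inf_jets_over Y (total_space Y - C)" for z
    proof (cases "z \<in> inf_jets_over Y U")
      case True
      then have zc: "z \<in> inf_jets_over Y (bdom c \<inter> U)" "z \<in> inf_jets_over Y (bdom c)" "jet_value (z 0) \<in> bdom c"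
        using U(2) by (auto simp: inf_jets_over_def)
      have sp: "inf_coords 0 c z \<in> coord_space ?K"
        by (rule subsetD[OF jet_image_subset_space inf_coords_in_image[OF c zc(1)]])
      have "inf_coords 0 c z \<notin> cbox_at ?K a e"
      proof
        assume "inf_coords 0 c z \<in> cbox_at ?K a e"
        then have "iv (total_part Y (inf_coords 0 c z)) \<in> C" by (simp add: C_def)
        moreover have "iv (total_part Y (inf_coords 0 c z)) = jet_value (z 0)"
          using total_part_inf_coords[OF c zc(2), of 0] zc(3) top_chart_inj[OF tt]
          by (simp add: iv_def tcb tc_def[symmetric])
        ultimately show False using z by (simp add: inf_jets_over_def)
      qed
      then obtain k where k: "k \<in> ?K" "\<bar>inf_coords 0 c z k - a k\<bar> > e" using sp by (auto simp: cbox_at_def)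
      then show ?thesis
        using bump_zero[OF finite_jet_indices k(1), of e "inf_coords 0 c z" a] e(1) by (simp add: box_bump_def ae)
    qed (simp add: box_bump_def)
    have "smooth_of_order r c' (total_space Y - C) (\<lambda>z. box_bump c U b z * g z)"
      by (rule smooth_of_order_cong[OF smooth_of_order_const[OF c' op, of r 0]])
        (use zero in \<open>auto simp: inf_jets_over_def\<close>)
    then show ?thesis using op y False \<open>C \<subseteq> U\<close> by (intro exI[of _ "total_space Y - C"]) auto
  qed
qed

text \<open>The series of bump functions is weighted so that it converges with all derivatives also
  after multiplication by the members of \<open>G\<close>, which need not be bounded near the boundary
  of \<open>U\<close>.\<close>

lemma ex_cutoff:
  assumes A: "bundle_atlas Y A" "finite A"
    and c: "is_bundle_chart Y c" and U: "openin (mtop (total_mfd Y)) U" "U \<subseteq> bdom c"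
    and G: "finite G" "\<And>g. g \<in> G \<Longrightarrow> smooth_of_order r c U g"
  obtains \<rho> where "\<rho> \<in> fin_order_ring Y" "\<And>z. z \<in> inf_jets_over Y U \<Longrightarrow> \<rho> z > 0"
    "\<And>z. z \<notin> inf_jets_over Y U \<Longrightarrow> \<rho> z = 0" "\<And>g. g \<in> G \<Longrightarrow> (\<lambda>z. \<rho> z * g z) \<in> fin_order_ring Y"
proof (cases "inf_jets_over Y U = {}")
  case True
  \<comment> \<open>With no jets over \<open>U\<close> the zero function will do; otherwise the set
    \<open>B\<close> below is nonempty and can be enumerated.\<close>
  have "(\<lambda>z. 0) \<in> fin_order_ring Y"
    unfolding fin_order_ring_def
    by (rule fin_order_functionsI[OF A(1) openin_topspace, where r = 0])
      (use A(1) in \<open>auto simp: bundle_atlas_def intro!: smooth_of_order_const\<close>)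
  then show thesis by (intro that[of "\<lambda>_. 0"]) (auto simp: True)
next
  case False
  let ?K = "jet_indices Y 0"
  define B where "B = rat_boxes ?K (jet_image Y 0 c U)"
  have Bc: "countable B" unfolding B_def by (rule countable_rat_boxes[OF finite_jet_indices])
  have cover: "\<exists>b\<in>B. bump ?K (fst b) (snd b) (inf_coords 0 c z) > 0" if z: "z \<in> inf_jets_over Y U" for z
  proof -
    have "z \<in> inf_jets_over Y (bdom c \<inter> U)" using z U(2) by (auto simp: inf_jets_over_def)
    then have "inf_coords 0 c z \<in> jet_image Y 0 c U" by (rule inf_coords_in_image[OF c])
    then obtain a e where "(a, e) \<in> B" "inf_coords 0 c z \<in> box_at ?K a e"
      unfolding B_def by (rule rat_boxes_cover[OF finite_jet_indices openin_jet_image[OF c U(1)]])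
    then show ?thesis by (intro bexI[of _ "(a, e)"]) (auto intro!: bump_pos simp: box_at_def)
  qed
  then have B0: "B \<noteq> {}" using False by blast
  define b where "b n = from_nat_into B n" for n
  have b: "b n \<in> B" for n using B0 by (simp add: b_def from_nat_into)
  define h where "h n g z = box_bump c U (b n) z * g z" for n and g :: "('x, 'y) inf_jet \<Rightarrow> real" and z
  \<comment> \<open>Adding the constant 1 makes \<rho> itself one of the series, built with the same
    weights as its products with \<open>G\<close>.\<close>
  define G1 where "G1 = insert (\<lambda>_. 1) G"
  have hs: "smooth_of_order r c' (total_space Y) (h n g)" if "is_bundle_chart Y c'" "g \<in> G1" for c' n g
  proof -
    have "smooth_of_order r c U g" using that(2) G(2) smooth_of_order_const[OF c U(1)] by (auto simp: G1_def)
    from smooth_of_order_box_bump[OF c U b[unfolded B_def] this that(1), of n]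
    show ?thesis unfolding h_def[abs_def] .
  qed
  have A': "is_bundle_chart Y c'" if "c' \<in> A" for c' using A(1) that by (auto simp: bundle_atlas_def)
  define P where "P c' g n F \<longleftrightarrow> smooth_on (jet_indices Y r) (jet_image Y r c' (total_space Y)) F \<and>
     (\<forall>z\<in>inf_jets_over Y (bdom c' \<inter> total_space Y). h n g z = F (inf_coords r c' z))" for c' g n F
  \<comment> \<open>One series for each pair of a chart of the atlas and a member of
    \<open>G1\<close>; its terms are the coordinate expressions of \<open>h n g\<close> in that
    chart, all of the same order \<open>r\<close>.\<close>
  define F where "F i n = (SOME F. P (fst i) (snd i) n F)" for i n
  have F: "P c' g n (F (c', g) n)" if "c' \<in> A" "g \<in> G1" for c' g n
  proof -
    have "\<exists>F. P c' g n F" using hs[OF A'[OF that(1)] that(2), of n] unfolding smooth_of_order_def P_def .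
    then show ?thesis unfolding F_def fst_conv snd_conv by (rule someI_ex)
  qed
  have cI: "countable (A \<times> G1)" using A(2) G(1) by (auto simp: G1_def intro: countable_finite)
  obtain w :: "nat \<Rightarrow> real" where w: "\<And>n. w n > 0"
    "\<And>i. i \<in> A \<times> G1 \<Longrightarrow> smooth_on (jet_indices Y r) (jet_image Y r (fst i) (total_space Y)) (\<lambda>p. \<Sum>n. w n * F i n p)"
    "\<And>i p. i \<in> A \<times> G1 \<Longrightarrow> p \<in> jet_image Y r (fst i) (total_space Y) \<Longrightarrow> summable (\<lambda>n. w n * F i n p)"
    by (rule ex_smooth_weighted_series[where S = "\<lambda>i. jet_image Y r (fst i) (total_space Y)" and F = F, OF finite_jet_indices cI])
      (use A' F in \<open>auto simp: P_def intro!: openin_jet_image\<close>)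
  define S where "S g z = (\<Sum>n. w n * h n g z)" for g z
  have Sring: "S g \<in> fin_order_ring Y" if g: "g \<in> G1" for g
    unfolding fin_order_ring_def
  proof (rule fin_order_functionsI[OF A(1) openin_topspace])
    show "S g z = 0" if "z \<notin> inf_jets_over Y (total_space Y)" for z
    proof -
      have "z \<notin> inf_jets_over Y U" using that openin_subset[OF U(1)] by (auto simp: inf_jets_over_def)
      then show ?thesis by (simp add: S_def h_def box_bump_def)
    qed
    show "smooth_of_order r c' (total_space Y) (S g)" if c': "c' \<in> A" for c'
    proof (rule smooth_of_orderI)
      show "smooth_on (jet_indices Y r) (jet_image Y r c' (total_space Y)) (\<lambda>p. \<Sum>n. w n * F (c', g) n p)"
        using w(2)[of "(c', g)"] c' g by simp
      show "S g z = (\<Sum>n. w n * F (c', g) n (inf_coords r c' z))"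
        if "z \<in> inf_jets_over Y (bdom c' \<inter> total_space Y)" for z
        using F[OF c' g] that by (simp add: S_def P_def)
    qed
  qed
  define \<rho> where "\<rho> = S (\<lambda>_. 1)"
  have sum1: "summable (\<lambda>n. w n * h n (\<lambda>_. 1) z)" if z: "z \<in> inf_jets_over Y U" for z
  proof -
    have "jet_value (z 0) \<in> total_space Y" using z openin_subset[OF U(1)] by (auto simp: inf_jets_over_def)
    then obtain c' where c': "c' \<in> A" "jet_value (z 0) \<in> bdom c'" using A(1) by (auto simp: bundle_atlas_def)
    then have zc: "z \<in> inf_jets_over Y (bdom c' \<inter> total_space Y)"
      using z openin_subset[OF U(1)] by (auto simp: inf_jets_over_def)
    have "summable (\<lambda>n. w n * F (c', \<lambda>_. 1) n (inf_coords r c' z))"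
      using w(3)[of "(c', \<lambda>_. 1)"] c' inf_coords_in_image[OF A'[OF c'(1)] zc] by (simp add: G1_def)
    then show ?thesis using F[OF c'(1), of "\<lambda>_. 1"] zc by (simp add: P_def G1_def)
  qed
  have \<rho>0: "\<rho> z = 0" if "z \<notin> inf_jets_over Y U" for z
    using that by (simp add: \<rho>_def S_def h_def box_bump_def)
  show thesis
  proof (rule that)
    show "\<rho> \<in> fin_order_ring Y" unfolding \<rho>_def by (rule Sring) (simp add: G1_def)
    show "\<rho> z = 0" if "z \<notin> inf_jets_over Y U" for z using \<rho>0[OF that] .
    show "\<rho> z > 0" if z: "z \<in> inf_jets_over Y U" for z
    proof -
      obtain b' where b': "b' \<in> B" "bump ?K (fst b') (snd b') (inf_coords 0 c z) > 0" using cover[OF z] by blast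
      obtain n where n: "b n = b'" using from_nat_into_surj[OF Bc b'(1)] by (auto simp: b_def)
      have "h n (\<lambda>_. 1) z > 0" using b' z by (simp add: h_def box_bump_def n)
      moreover have "h n (\<lambda>_. 1) z \<ge> 0" for n by (simp add: h_def box_bump_def bump_nonneg)
      ultimately show ?thesis
        unfolding \<rho>_def S_def using w(1) by (intro suminf_pos2[OF sum1[OF z], of n]) (auto simp: less_imp_le)
    qed
    show "(\<lambda>z. \<rho> z * g z) \<in> fin_order_ring Y" if g: "g \<in> G" for g
    proof -
      have "S g z = \<rho> z * g z" for z
      proof (cases "z \<in> inf_jets_over Y U")
        case True
        then show ?thesis
          using suminf_mult2[OF sum1[OF True], of "g z"] by (simp add: S_def \<rho>_def h_def mult_ac)
      next
        case False
        then show ?thesis using \<rho>0 by (simp add: S_def h_def box_bump_def)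
      qed
      then have "S g = (\<lambda>z. \<rho> z * g z)" by (rule ext)
      then show ?thesis using Sring[of g] g by (simp add: G1_def)
    qed
  qed
qed

end

section \<open>Vector fields in coordinates\<close>

context smooth_fibration
begin

abbreviation inf_partial :: "('x, 'y) bundle_chart \<Rightarrow> jet_index \<Rightarrow> (('x, 'y) inf_jet \<Rightarrow> real) \<Rightarrow> ('x, 'y) inf_jet \<Rightarrow> real" where
  "inf_partial c k f z \<equiv> chart_partial (inf_jet_chart Y c) k f z"

lemma jet_indices_subset_inf: "jet_indices Y r \<subseteq> inf_jet_indices Y"
  by (auto simp: inf_jet_indices_def)

text \<open>Derivatives on the infinite jet space are partial derivatives of a finite-order
  expression, and coordinates beyond its order contribute zero. The calculus of
  \<open>inf_partial\<close> rests on this.\<close>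

lemma inf_partial_eq:
  assumes c: "is_bundle_chart Y c" and U: "openin (mtop (total_mfd Y)) U" and z: "z \<in> inf_jets_over Y (bdom c \<inter> U)"
    and k: "k \<in> inf_jet_indices Y" and f: "\<And>w. w \<in> inf_jets_over Y (bdom c \<inter> U) \<Longrightarrow> f w = F (inf_coords r c w)"
  shows "inf_partial c k f z = (if k \<in> jet_indices Y r then partial k F (inf_coords r c z) else 0)"
proof -
  define ic where "ic = inf_jet_chart Y c"
  define p where "p = cmap ic z"
  have pk: "p k' = inf_jet_coord c z k'" if "k' \<in> inf_jet_indices Y" for k'
    using that by (simp add: p_def ic_def inf_jet_chart_def)
  have pK: "p \<in> coord_space (inf_jet_indices Y)" by (simp add: p_def ic_def inf_jet_chart_def)
  \<comment> \<open>The coordinate \<open>k\<close> may exceed the order \<open>r\<close> of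
    \<open>F\<close>; openness of the chart image is used at an order \<open>R\<close> that includes
    \<open>k\<close>.\<close>
  obtain R where R: "k \<in> jet_indices Y R" using k by (auto simp: inf_jet_indices_def)
  define u where "u = inf_coords R c z"
  have uk: "u k' = p k'" if "k' \<in> jet_indices Y R" for k'
    using that pk subsetD[OF jet_indices_subset_inf that] by (simp add: u_def inf_coords_def)
  have "\<forall>\<^sub>F t in nhds (u k). u(k := t) \<in> jet_image Y R c U"
    unfolding u_def
    by (rule eventually_upd[OF finite_jet_indices openin_jet_image[OF c U] inf_coords_in_image[OF c z] R])
  then have ev: "\<forall>\<^sub>F t in nhds (p k). in_chart ic f (p(k := t)) = F (restrict (p(k := t)) (jet_indices Y r))"
    unfolding uk[OF R]
  proof eventually_elim
    case (elim t)
    have "total_part Y (p(k := t)) = total_part Y (u(k := t))" by (rule total_part_cong) (auto simp: uk)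
    then have "total_part Y (p(k := t)) \<in> cmap (total_chart Y c) ` (bdom c \<inter> U)"
      using elim by (simp add: jet_image_def)
    moreover have "p(k := t) \<in> coord_space (inf_jet_indices Y)"
      using pK k by (auto simp: PiE_iff extensional_def)
    ultimately obtain w where w: "w \<in> inf_jets_over Y (bdom c \<inter> U)" "cmap ic w = p(k := t)"
      using ex_inf_jet[OF c, of "p(k := t)" U] unfolding ic_def by metis
    have "w \<in> cdom ic" using w(1) by (auto simp: ic_def inf_jet_chart_def inf_jets_over_def)
    then have "in_chart ic f (cmap ic w) = f w" unfolding ic_def by (rule in_chart_cmap[OF inf_chart_inj[OF c]])
    moreover have "inf_coords r c w = restrict (cmap ic w) (jet_indices Y r)"
      using jet_indices_subset_inf[of r] by (auto simp: inf_coords_def ic_def inf_jet_chart_def restrict_def fun_eq_iff)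
    ultimately show ?case using f[OF w(1)] w(2) by simp
  qed
  have cz: "inf_coords r c z = restrict p (jet_indices Y r)"
    using pk subsetD[OF jet_indices_subset_inf] by (auto simp: inf_coords_def restrict_def fun_eq_iff)
  have "inf_partial c k f z = deriv (\<lambda>t. F (restrict (p(k := t)) (jet_indices Y r))) (p k)"
    unfolding chart_partial_def partial_def ic_def[symmetric] p_def[symmetric] by (rule deriv_cong_ev[OF ev refl])
  also have "\<dots> = (if k \<in> jet_indices Y r then partial k F (inf_coords r c z) else 0)"
  proof (cases "k \<in> jet_indices Y r")
    case True
    then have "restrict (p(k := t)) (jet_indices Y r) = (inf_coords r c z)(k := t)" for t
      by (auto simp: cz fun_eq_iff)
    then show ?thesis using True by (simp add: partial_def cz)
  next
    case False
    then have "restrict (p(k := t)) (jet_indices Y r) = inf_coords r c z" for t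
      by (auto simp: cz fun_eq_iff restrict_def)
    then show ?thesis using False by simp
  qed
  finally show ?thesis .
qed

context
  fixes c :: "('x, 'y) bundle_chart" and U :: "'y set"
  assumes c: "is_bundle_chart Y c" and U: "openin (mtop (total_mfd Y)) U"
begin

lemma inf_partial_zero:
  assumes "smooth_of_order r c U f" "z \<in> inf_jets_over Y (bdom c \<inter> U)" "k \<in> inf_jet_indices Y" "k \<notin> jet_indices Y r"
  shows "inf_partial c k f z = 0"
proof -
  obtain F where "\<forall>w\<in>inf_jets_over Y (bdom c \<inter> U). f w = F (inf_coords r c w)"
    using assms(1) unfolding smooth_of_order_def by blast
  then show ?thesis using inf_partial_eq[OF c U assms(2,3), of f F r] assms(4) by simp
qed

lemma inf_partial_mult:
  assumes f: "smooth_of_order r c U f" and g: "smooth_of_order r c U g"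
    and z: "z \<in> inf_jets_over Y (bdom c \<inter> U)" and k: "k \<in> inf_jet_indices Y"
  shows "inf_partial c k (\<lambda>z. f z * g z) z = inf_partial c k f z * g z + f z * inf_partial c k g z"
proof -
  obtain F where F: "smooth_on (jet_indices Y r) (jet_image Y r c U) F"
    "\<And>z. z \<in> inf_jets_over Y (bdom c \<inter> U) \<Longrightarrow> f z = F (inf_coords r c z)"
    by (rule smooth_of_orderE[OF f], rule that)
  obtain G where G: "smooth_on (jet_indices Y r) (jet_image Y r c U) G"
    "\<And>z. z \<in> inf_jets_over Y (bdom c \<inter> U) \<Longrightarrow> g z = G (inf_coords r c z)"
    by (rule smooth_of_orderE[OF g], rule that)
  have FG: "f w * g w = F (inf_coords r c w) * G (inf_coords r c w)" if "w \<in> inf_jets_over Y (bdom c \<inter> U)" for w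
    using F(2) G(2) that by simp
  note pf = inf_partial_eq[OF c U z k, of f F r, OF F(2)] and pg = inf_partial_eq[OF c U z k, of g G r, OF G(2)]
    and pfg = inf_partial_eq[OF c U z k, of "\<lambda>w. f w * g w" "\<lambda>p. F p * G p" r, OF FG]
  show ?thesis
  proof (cases "k \<in> jet_indices Y r")
    case True
    define p where "p = inf_coords r c z"
    have p: "p \<in> jet_image Y r c U" unfolding p_def by (rule inf_coords_in_image[OF c z])
    have "partial k (\<lambda>p. F p * G p) p = partial k F p * G p + F p * partial k G p"
      using DERIV_mult[OF smooth_on_has_derivative[OF openin_jet_image[OF c U] F(1) True p]
          smooth_on_has_derivative[OF openin_jet_image[OF c U] G(1) True p]]
      by (intro partial_eqI) (simp add: algebra_simps del: fun_upd_apply)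
    then show ?thesis using pf pg pfg True F(2)[OF z] G(2)[OF z] by (simp add: p_def)
  qed (use pf pg pfg in simp)
qed

lemma inf_partial_add:
  assumes f: "smooth_of_order r c U f" and g: "smooth_of_order r c U g"
    and z: "z \<in> inf_jets_over Y (bdom c \<inter> U)" and k: "k \<in> inf_jet_indices Y"
  shows "inf_partial c k (\<lambda>z. f z + g z) z = inf_partial c k f z + inf_partial c k g z"
proof -
  obtain F where F: "smooth_on (jet_indices Y r) (jet_image Y r c U) F"
    "\<And>z. z \<in> inf_jets_over Y (bdom c \<inter> U) \<Longrightarrow> f z = F (inf_coords r c z)"
    by (rule smooth_of_orderE[OF f], rule that)
  obtain G where G: "smooth_on (jet_indices Y r) (jet_image Y r c U) G"
    "\<And>z. z \<in> inf_jets_over Y (bdom c \<inter> U) \<Longrightarrow> g z = G (inf_coords r c z)"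
    by (rule smooth_of_orderE[OF g], rule that)
  have FG: "f w + g w = F (inf_coords r c w) + G (inf_coords r c w)" if "w \<in> inf_jets_over Y (bdom c \<inter> U)" for w
    using F(2) G(2) that by simp
  note pf = inf_partial_eq[OF c U z k, of f F r, OF F(2)] and pg = inf_partial_eq[OF c U z k, of g G r, OF G(2)]
    and pfg = inf_partial_eq[OF c U z k, of "\<lambda>w. f w + g w" "\<lambda>p. F p + G p" r, OF FG]
  show ?thesis
  proof (cases "k \<in> jet_indices Y r")
    case True
    define p where "p = inf_coords r c z"
    have p: "p \<in> jet_image Y r c U" unfolding p_def by (rule inf_coords_in_image[OF c z])
    have "partial k (\<lambda>p. F p + G p) p = partial k F p + partial k G p"
      by (rule partial_eqI, rule DERIV_add[OF smooth_on_has_derivative[OF openin_jet_image[OF c U] F(1) True p]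
          smooth_on_has_derivative[OF openin_jet_image[OF c U] G(1) True p]])
    then show ?thesis using pf pg pfg True by (simp add: p_def)
  qed (use pf pg pfg in simp)
qed

lemma inf_partial_const:
  assumes z: "z \<in> inf_jets_over Y (bdom c \<inter> U)" and k: "k \<in> inf_jet_indices Y"
  shows "inf_partial c k (\<lambda>_. a) z = 0"
  using inf_partial_eq[OF c U z k, of "\<lambda>_. a" "\<lambda>_. a" 0] by (simp add: partial_def)

lemma inf_partial_coord:
  assumes z: "z \<in> inf_jets_over Y (bdom c \<inter> U)" and k: "k \<in> inf_jet_indices Y" and k': "k' \<in> jet_indices Y r"
  shows "inf_partial c k (\<lambda>w. inf_jet_coord c w k') z = (if k = k' then 1 else 0)"
proof -
  have "inf_partial c k (\<lambda>w. inf_jet_coord c w k') z =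
      (if k \<in> jet_indices Y r then partial k (\<lambda>p. p k') (inf_coords r c z) else 0)"
    by (rule inf_partial_eq[OF c U z k]) (simp add: inf_coords_def k')
  then show ?thesis using k' by (auto simp: partial_def)
qed

lemma smooth_of_order_inf_partial:
  assumes f: "smooth_of_order r c U f" and k: "k \<in> inf_jet_indices Y"
  shows "smooth_of_order r c U (inf_partial c k f)"
proof -
  obtain F where F: "smooth_on (jet_indices Y r) (jet_image Y r c U) F"
    "\<And>z. z \<in> inf_jets_over Y (bdom c \<inter> U) \<Longrightarrow> f z = F (inf_coords r c z)"
    by (rule smooth_of_orderE[OF f], rule that)
  note pf = inf_partial_eq[OF c U _ k, of _ f F r, OF _ F(2)]
  show ?thesis
  proof (cases "k \<in> jet_indices Y r")
    case True
    show ?thesis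
      by (rule smooth_of_orderI[OF smooth_on_partial[OF openin_jet_image[OF c U] F(1) True]]) (simp add: pf True)
  next
    case False
    show ?thesis
      by (rule smooth_of_order_cong[OF smooth_of_order_const[OF c U, of r 0]]) (simp add: pf False)
  qed
qed

lemma smooth_of_order_foreign_coord:
  assumes c': "is_bundle_chart Y c'" and k: "k \<in> jet_indices Y r"
  shows "smooth_of_order r c (bdom c' \<inter> U) (\<lambda>w. inf_jet_coord c' w k)"
proof (rule smooth_of_order_chart[OF c U c'])
  show "smooth_of_order r c' (bdom c \<inter> U) (\<lambda>w. inf_jet_coord c' w k)"
    using smooth_of_order_coord[OF c' _ k] openin_bdom[OF c] U by blast
qed

text \<open>The ordinary chain rule for expressions of order \<open>r\<close>: the expression of
  \<open>f\<close> in \<open>c\<close> is its expression in \<open>c'\<close> after the transition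
  map \<open>\<Phi>\<close>, which preserves the order, so finitely many terms occur.\<close>

lemma inf_partial_chain:
  assumes c': "is_bundle_chart Y c'" and f: "smooth_of_order r c' U f"
    and z: "z \<in> inf_jets_over Y (bdom c \<inter> (bdom c' \<inter> U))" and k: "k \<in> inf_jet_indices Y"
  shows "inf_partial c k f z =
    (\<Sum>k'\<in>jet_indices Y r. inf_partial c' k' f z * inf_partial c k (\<lambda>w. inf_jet_coord c' w k') z)"
proof -
  obtain F where F: "smooth_on (jet_indices Y r) (jet_image Y r c' U) F"
    "\<And>z. z \<in> inf_jets_over Y (bdom c' \<inter> U) \<Longrightarrow> f z = F (inf_coords r c' z)"
    by (rule smooth_of_orderE[OF f], rule that)
  obtain \<Phi> where \<Phi>: "\<And>k. k \<in> jet_indices Y r \<Longrightarrow> smooth_on (jet_indices Y r) (jet_image Y r c (bdom c')) (\<lambda>p. \<Phi> p k)"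
    "\<And>z. z \<in> inf_jets_over Y (bdom c \<inter> bdom c') \<Longrightarrow> inf_coords r c' z = \<Phi> (inf_coords r c z)"
    "\<And>U. \<Phi> ` jet_image Y r c (bdom c' \<inter> U) \<subseteq> jet_image Y r c' (bdom c \<inter> U)"
    using coords_transition[OF c c', of r] by metis
  let ?U = "bdom c' \<inter> U"
  have o1: "openin (mtop (total_mfd Y)) ?U" and o2: "openin (mtop (total_mfd Y)) (bdom c \<inter> U)"
    using U openin_bdom[OF c] openin_bdom[OF c'] by auto
  have sub: "w \<in> inf_jets_over Y (bdom c' \<inter> U)" "w \<in> inf_jets_over Y (bdom c \<inter> bdom c')"
    if "w \<in> inf_jets_over Y (bdom c \<inter> ?U)" for w
    using that by (auto simp: inf_jets_over_def)
  have eq: "f w = F (\<Phi> (inf_coords r c w))" if "w \<in> inf_jets_over Y (bdom c \<inter> ?U)" for w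
    using F(2) \<Phi>(2) sub[OF that] by simp
  have eqk: "inf_jet_coord c' w k' = \<Phi> (inf_coords r c w) k'"
    if "w \<in> inf_jets_over Y (bdom c \<inter> ?U)" "k' \<in> jet_indices Y r" for w k'
    using fun_cong[OF \<Phi>(2)[OF sub(2)[OF that(1)]], of k'] that(2) by (simp add: inf_coords_def)
  note pf = inf_partial_eq[OF c o1 z k, of f "\<lambda>p. F (\<Phi> p)" r, OF eq]
  have pk: "inf_partial c k (\<lambda>w. inf_jet_coord c' w k') z =
      (if k \<in> jet_indices Y r then partial k (\<lambda>p. \<Phi> p k') (inf_coords r c z) else 0)" if "k' \<in> jet_indices Y r" for k'
    by (rule inf_partial_eq[OF c o1 z k]) (rule eqk[OF _ that])
  have pf': "inf_partial c' k' f z = partial k' F (\<Phi> (inf_coords r c z))" if "k' \<in> jet_indices Y r" for k'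
    using inf_partial_eq[OF c' U sub(1)[OF z] subsetD[OF jet_indices_subset_inf that], of f F r, OF F(2)] that
      \<Phi>(2)[OF sub(2)[OF z]] by simp
  show ?thesis
  proof (cases "k \<in> jet_indices Y r")
    case True
    have "partial k (\<lambda>p. F (\<Phi> p)) (inf_coords r c z) =
      (\<Sum>k'\<in>jet_indices Y r. partial k' F (\<Phi> (inf_coords r c z)) * partial k (\<lambda>p. \<Phi> p k') (inf_coords r c z))"
    proof (rule partial_compose[OF finite_jet_indices openin_jet_image[OF c o1] finite_jet_indices openin_jet_image[OF c' o2] \<Phi>(3) _ _ True])
      show "Ck 1 (jet_indices Y r) (jet_image Y r c' (bdom c \<inter> U)) F"
        by (rule Ck_subset[OF smooth_on_Ck[OF openin_jet_image[OF c' U] F(1)] jet_image_mono]) simp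
      show "Ck 1 (jet_indices Y r) (jet_image Y r c ?U) (\<lambda>p. \<Phi> p l)" if "l \<in> jet_indices Y r" for l
        by (rule Ck_subset[OF smooth_on_Ck[OF openin_jet_image[OF c openin_bdom[OF c']] \<Phi>(1)[OF that]] jet_image_mono]) simp
      show "inf_coords r c z \<in> jet_image Y r c ?U" by (rule inf_coords_in_image[OF c z])
    qed
    then show ?thesis using True pf pk pf' by simp
  qed (use pf pk in simp)
qed

end

section \<open>Coordinate expressions and the transformation law as finite sums\<close>

lemma sum_jet_indices:
  "(\<Sum>k\<in>jet_indices Y r. g k) = (\<Sum>l<base_dim Y. g (Bas l)) +
    (\<Sum>\<Sigma> | \<Sigma> \<in> multi_indices (base_dim Y) \<and> size \<Sigma> \<le> r. \<Sum>j<fib_dim Y. g (Fib j \<Sigma>))"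
proof -
  let ?M = "{\<Sigma>. \<Sigma> \<in> multi_indices (base_dim Y) \<and> size \<Sigma> \<le> r}"
  have J: "jet_indices Y r = Bas ` {..<base_dim Y} \<union> (\<lambda>(\<Sigma>, j). Fib j \<Sigma>) ` (?M \<times> {..<fib_dim Y})"
    by (auto simp: jet_indices_def)
  have "sum g (jet_indices Y r) = sum g (Bas ` {..<base_dim Y}) + sum g ((\<lambda>(\<Sigma>, j). Fib j \<Sigma>) ` (?M \<times> {..<fib_dim Y}))"
    unfolding J using finite_multi_indices_le[of "base_dim Y" r] by (intro sum.union_disjoint) auto
  also have "sum g (Bas ` {..<base_dim Y}) = (\<Sum>l<base_dim Y. g (Bas l))"
    by (subst sum.reindex) (auto simp: inj_on_def)
  also have "sum g ((\<lambda>(\<Sigma>, j). Fib j \<Sigma>) ` (?M \<times> {..<fib_dim Y})) = (\<Sum>(\<Sigma>, j)\<in>?M \<times> {..<fib_dim Y}. g (Fib j \<Sigma>))"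
    by (subst sum.reindex) (auto simp: inj_on_def case_prod_unfold)
  also have "\<dots> = (\<Sum>\<Sigma>\<in>?M. \<Sum>j<fib_dim Y. g (Fib j \<Sigma>))" by (simp add: sum.cartesian_product)
  finally show ?thesis .
qed

text \<open>For \<open>f\<close> of order \<open>r\<close> the formal sum, whose index set depends
  on \<open>z\<close>, becomes a sum over one fixed finite set. Smoothness, Leibniz's rule and the
  chain rule are applied in this form.\<close>

lemma coordinate_expression_eq:
  assumes c: "is_bundle_chart Y c" and U: "openin (mtop (total_mfd Y)) U"
    and f: "smooth_of_order r c U f" and z: "z \<in> inf_jets_over Y (bdom c \<inter> U)"
  shows "coordinate_expression Y c \<nu> f z = (\<Sum>k\<in>jet_indices Y r. \<nu> k z * inf_partial c k f z)"
proof -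
  let ?n = "base_dim Y" and ?m = "fib_dim Y"
  define g where "g k = \<nu> k z * inf_partial c k f z" for k
  have inf: "Fib i \<Lambda> \<in> inf_jet_indices Y" if "i < ?m" "\<Lambda> \<in> multi_indices ?n" for i \<Lambda>
    using that by (auto simp: inf_jet_indices_def intro!: exI[of _ "size \<Lambda>"])
  have D0: "size \<Lambda> \<le> r" if "i < ?m" "\<Lambda> \<in> multi_indices ?n" "inf_partial c (Fib i \<Lambda>) f z \<noteq> 0" for i \<Lambda>
    using inf_partial_zero[OF c U f z inf[OF that(1,2)]] that by fastforce
  let ?M = "{\<Sigma>. \<Sigma> \<in> multi_indices ?n \<and> size \<Sigma> \<le> r}"
  \<comment> \<open>Splits off the empty multi-index, which has its own sum in the
    definition.\<close>
  have M: "?M = insert {#} (?M - {{#}})" by auto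
  have "(\<Sum>\<Sigma>\<in>?M. \<Sum>j<?m. g (Fib j \<Sigma>)) = (\<Sum>j<?m. g (Fib j {#})) + (\<Sum>\<Sigma>\<in>?M - {{#}}. \<Sum>j<?m. g (Fib j \<Sigma>))"
    by (subst M, subst sum.insert) (use finite_multi_indices_le[of ?n r] in auto)
  also have "(\<Sum>\<Sigma>\<in>?M - {{#}}. \<Sum>j<?m. g (Fib j \<Sigma>)) = (\<Sum>j<?m. \<Sum>\<Sigma>\<in>?M - {{#}}. g (Fib j \<Sigma>))"
    by (rule sum.swap)
  also have "\<dots> = (\<Sum>(i, \<Lambda>)\<in>{..<?m} \<times> (?M - {{#}}). g (Fib i \<Lambda>))"
    by (simp add: sum.cartesian_product)
  also have "\<dots> = (\<Sum>(i, \<Lambda>) | i < ?m \<and> \<Lambda> \<in> multi_indices ?n \<and> size \<Lambda> > 0 \<and> inf_partial c (Fib i \<Lambda>) f z \<noteq> 0. g (Fib i \<Lambda>))"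
  proof (rule sum.mono_neutral_right)
    show "finite ({..<?m} \<times> (?M - {{#}}))" using finite_multi_indices_le[of ?n r] by auto
  qed (use D0 in \<open>auto simp: g_def nonempty_has_size\<close>)
  finally show ?thesis
    unfolding coordinate_expression_def Let_def
    using sum_jet_indices[of g r] by (simp add: g_def)
qed

lemma inf_partial_Bas_Fib:
  assumes c: "is_bundle_chart Y c" and c': "is_bundle_chart Y c'" and z: "z \<in> inf_jets_over Y (bdom c \<inter> bdom c')"
    and l: "l < base_dim Y" and k: "Fib j \<Sigma> \<in> inf_jet_indices Y"
  shows "inf_partial c (Fib j \<Sigma>) (\<lambda>w. inf_jet_coord c' w (Bas l)) z = 0"
proof -
  obtain F where F: "\<And>w. w \<in> inf_jets_over Y (bdom c \<inter> bdom c') \<Longrightarrow>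
       inf_jet_coord c' w (Bas l) = F (base_part Y (inf_coords 0 c w))"
    using Bas_transition[OF c c' l, of 0] by metis
  have "base_part Y (p(Fib j \<Sigma> := t)) = base_part Y p" for p t by (simp add: base_part_def)
  then have "partial (Fib j \<Sigma>) (\<lambda>p. F (base_part Y p)) p = 0" for p by (simp add: partial_def)
  note partial_0 = this
  have "inf_partial c (Fib j \<Sigma>) (\<lambda>w. inf_jet_coord c' w (Bas l)) z =
      (if Fib j \<Sigma> \<in> jet_indices Y 0 then partial (Fib j \<Sigma>) (\<lambda>p. F (base_part Y p)) (inf_coords 0 c z) else 0)"
    by (rule inf_partial_eq[OF c openin_bdom[OF c'] z k]) (rule F)
  also have "\<dots> = 0" unfolding partial_0 by (rule if_cancel)
  finally show ?thesis .
qed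

text \<open>The three cases of the law are one matrix equation, which may be summed up to any order
  \<open>r\<close> that includes \<open>k'\<close>: base coordinates do not depend on fibre
  coordinates, and the coordinate of \<open>\<Lambda>\<close> does not depend on coordinates of
  order above \<open>size \<Lambda>\<close>.\<close>

lemma transformation_law_iff:
  assumes A: "bundle_atlas Y A"
  shows "transformation_law Y A \<nu> \<longleftrightarrow> (\<forall>c\<in>A. \<forall>c'\<in>A. \<forall>z\<in>inf_jets_over Y (bdom c \<inter> bdom c'). \<forall>r. \<forall>k'\<in>jet_indices Y r.
    \<nu> c' k' z = (\<Sum>k\<in>jet_indices Y r. \<nu> c k z * inf_partial c k (\<lambda>w. inf_jet_coord c' w k') z))"
proof -
  let ?n = "base_dim Y" and ?m = "fib_dim Y"
  define S where "S c c' z r k' = (\<Sum>k\<in>jet_indices Y r. \<nu> c k z * inf_partial c k (\<lambda>w. inf_jet_coord c' w k') z)" for c c' z r k'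
  define D where "D c c' z k' k = inf_partial c k (\<lambda>w. inf_jet_coord c' w k') z" for c c' z k' k
  have A': "is_bundle_chart Y c" if "c \<in> A" for c using A that by (auto simp: bundle_atlas_def)
  have inf: "Fib i \<Lambda> \<in> inf_jet_indices Y" if "i < ?m" "\<Lambda> \<in> multi_indices ?n" for i \<Lambda>
    using that by (auto simp: inf_jet_indices_def intro!: exI[of _ "size \<Lambda>"])
  have SB: "S c c' z r (Bas l) = (\<Sum>\<mu><?n. D c c' z (Bas l) (Bas \<mu>) * \<nu> c (Bas \<mu>) z)"
    if "c \<in> A" "c' \<in> A" "z \<in> inf_jets_over Y (bdom c \<inter> bdom c')" "l < ?n" for c c' z r l
  proof -
    have "D c c' z (Bas l) (Fib j \<Sigma>) = 0" if "j < ?m" "\<Sigma> \<in> multi_indices ?n" for j \<Sigma>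
      unfolding D_def using inf_partial_Bas_Fib[OF A' A' _ _ inf[OF that]] \<open>c \<in> A\<close> \<open>c' \<in> A\<close> \<open>z \<in> _\<close> \<open>l < ?n\<close> by blast
    then show ?thesis
      unfolding S_def sum_jet_indices D_def[symmetric] by (simp add: mult.commute)
  qed
  have SF: "S c c' z r (Fib i \<Lambda>) = (\<Sum>\<Sigma> | \<Sigma> \<in> multi_indices ?n \<and> size \<Sigma> \<le> size \<Lambda>. \<Sum>j<?m. D c c' z (Fib i \<Lambda>) (Fib j \<Sigma>) * \<nu> c (Fib j \<Sigma>) z)
      + (\<Sum>\<mu><?n. D c c' z (Fib i \<Lambda>) (Bas \<mu>) * \<nu> c (Bas \<mu>) z)"
    if "c \<in> A" "c' \<in> A" "z \<in> inf_jets_over Y (bdom c \<inter> bdom c')" "Fib i \<Lambda> \<in> jet_indices Y r" for c c' z r i \<Lambda>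
  proof -
    have i: "i < ?m" "\<Lambda> \<in> multi_indices ?n" "size \<Lambda> \<le> r" using that(4) by auto
    have sm: "smooth_of_order (size \<Lambda>) c (bdom c') (\<lambda>w. inf_jet_coord c' w (Fib i \<Lambda>))"
      using smooth_of_order_foreign_coord[OF A'[OF that(1)] openin_bdom[OF A'[OF that(2)]] A'[OF that(2)], of "Fib i \<Lambda>" "size \<Lambda>"] i
      by simp
    have D0: "D c c' z (Fib i \<Lambda>) (Fib j \<Sigma>) = 0" if "j < ?m" "\<Sigma> \<in> multi_indices ?n" "\<not> size \<Sigma> \<le> size \<Lambda>" for j \<Sigma>
      unfolding D_def
      by (rule inf_partial_zero[OF A'[OF \<open>c \<in> A\<close>] openin_bdom[OF A'[OF \<open>c' \<in> A\<close>]] sm \<open>z \<in> _\<close> inf[OF that(1,2)]])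
        (use that in simp)
    have "(\<Sum>\<Sigma> | \<Sigma> \<in> multi_indices ?n \<and> size \<Sigma> \<le> r. \<Sum>j<?m. \<nu> c (Fib j \<Sigma>) z * D c c' z (Fib i \<Lambda>) (Fib j \<Sigma>)) =
       (\<Sum>\<Sigma> | \<Sigma> \<in> multi_indices ?n \<and> size \<Sigma> \<le> size \<Lambda>. \<Sum>j<?m. \<nu> c (Fib j \<Sigma>) z * D c c' z (Fib i \<Lambda>) (Fib j \<Sigma>))"
      by (rule sum.mono_neutral_right[OF finite_multi_indices_le]) (use i D0 in auto)
    then show ?thesis
      unfolding S_def sum_jet_indices D_def[symmetric] by (simp add: mult.commute)
  qed
  have M0: "{\<Sigma>. \<Sigma> \<in> multi_indices ?n \<and> size \<Sigma> \<le> size {#}} = {{#}}" by auto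
  show ?thesis
    unfolding S_def[symmetric]
  proof (intro iffI ballI allI)
    fix c c' z r k'
    assume L: "transformation_law Y A \<nu>" and cz: "c \<in> A" "c' \<in> A" "z \<in> inf_jets_over Y (bdom c \<inter> bdom c')"
      and k': "k' \<in> jet_indices Y r"
    note L' = L[unfolded transformation_law_def Let_def, rule_format, OF cz, folded D_def]
    show "\<nu> c' k' z = S c c' z r k'"
    proof (cases k')
      case (Bas l)
      then show ?thesis using SB[OF cz] k' L' by simp
    next
      case (Fib i \<Lambda>)
      then have i: "i < ?m" "\<Lambda> \<in> multi_indices ?n" using k' by auto
      show ?thesis
      proof (cases "\<Lambda> = {#}")
        case True
        then show ?thesis using SF[OF cz, of i \<Lambda> r] k' Fib L' i M0 by simp
      next
        case False
        then have "size \<Lambda> > 0" by (simp add: nonempty_has_size)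
        then show ?thesis using SF[OF cz, of i \<Lambda> r] k' Fib L' i by simp
      qed
    qed
  next
    assume R: "\<forall>c\<in>A. \<forall>c'\<in>A. \<forall>z\<in>inf_jets_over Y (bdom c \<inter> bdom c'). \<forall>r. \<forall>k'\<in>jet_indices Y r. \<nu> c' k' z = S c c' z r k'"
    show "transformation_law Y A \<nu>"
      unfolding transformation_law_def Let_def D_def[symmetric]
    proof (intro ballI conjI allI impI)
      fix c c' z assume cz: "c \<in> A" "c' \<in> A" "z \<in> inf_jets_over Y (bdom c \<inter> bdom c')"
      note R' = R[rule_format, OF cz]
      show "\<nu> c' (Bas l) z = (\<Sum>\<mu><?n. D c c' z (Bas l) (Bas \<mu>) * \<nu> c (Bas \<mu>) z)" if "l < ?n" for l
        using R'[of "Bas l" 0] SB[OF cz that] that by simp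
      show "\<nu> c' (Fib i {#}) z = (\<Sum>j<?m. D c c' z (Fib i {#}) (Fib j {#}) * \<nu> c (Fib j {#}) z) +
          (\<Sum>\<mu><?n. D c c' z (Fib i {#}) (Bas \<mu>) * \<nu> c (Bas \<mu>) z)" if "i < ?m" for i
        using R'[of "Fib i {#}" 0] SF[OF cz, of i "{#}" 0] that M0 by simp
      show "\<nu> c' (Fib i \<Lambda>) z =
          (\<Sum>\<Sigma> | \<Sigma> \<in> multi_indices ?n \<and> size \<Sigma> \<le> size \<Lambda>. \<Sum>j<?m. D c c' z (Fib i \<Lambda>) (Fib j \<Sigma>) * \<nu> c (Fib j \<Sigma>) z) +
          (\<Sum>\<mu><?n. D c c' z (Fib i \<Lambda>) (Bas \<mu>) * \<nu> c (Bas \<mu>) z)" if "i < ?m" "\<Lambda> \<in> multi_indices ?n" for i \<Lambda>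
        using R'[of "Fib i \<Lambda>" "size \<Lambda>"] SF[OF cz, of i \<Lambda> "size \<Lambda>"] that by simp
    qed
  qed
qed

end

section \<open>Derivations\<close>

locale fibration_atlas = smooth_fibration Y V
  for Y :: "('x, 'y) fibration" and V :: "'v manifold" +
  fixes A :: "('x, 'y) bundle_chart set"
  assumes atlas: "bundle_atlas Y A" and finite_atlas: "finite A"
begin

abbreviation R :: "(('x, 'y) inf_jet \<Rightarrow> real) set" where "R \<equiv> fin_order_ring Y"

lemma atlas_chart: "c \<in> A \<Longrightarrow> is_bundle_chart Y c"
  using atlas by (auto simp: bundle_atlas_def)

lemma inf_jet_in_chart: "z \<in> inf_jets Y \<Longrightarrow> \<exists>c\<in>A. z \<in> inf_jets_over Y (bdom c)"
  using atlas inf_jets_over_total by (auto simp: bundle_atlas_def inf_jets_over_def)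

text \<open>One order serves every chart and every \<open>U\<close>. All larger orders are included
  so that several functions can be given a common one.\<close>

lemma ring_smooth:
  assumes "f \<in> R"
  obtains r where "\<And>c r' U. is_bundle_chart Y c \<Longrightarrow> r \<le> r' \<Longrightarrow> smooth_of_order r' c U f"
proof -
  obtain r where r: "\<And>c. is_bundle_chart Y c \<Longrightarrow> smooth_of_order r c (total_space Y) f"
    using fin_order_functions_smooth assms unfolding fin_order_ring_def by metis
  have "smooth_of_order r' c U f" if c: "is_bundle_chart Y c" and r': "r \<le> r'" for c r' U
    by (rule smooth_of_order_subset[OF smooth_of_order_mono[OF c openin_topspace r[OF c] r']])
      (use openin_subset[OF openin_bdom[OF c]] in auto)
  then show thesis by (rule that)
qed

lemma ring_zero: "f \<in> R \<Longrightarrow> z \<notin> inf_jets Y \<Longrightarrow> f z = 0"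
  by (auto simp: fin_order_ring_def fin_order_functions_def inf_jets_over_total)

lemma ringI:
  assumes "\<And>z. z \<notin> inf_jets Y \<Longrightarrow> f z = 0" "\<And>c. c \<in> A \<Longrightarrow> smooth_of_order r c (total_space Y) f"
  shows "f \<in> R"
  unfolding fin_order_ring_def
  by (rule fin_order_functionsI[OF atlas openin_topspace]) (use assms inf_jets_over_total in auto)

lemma ring_add: assumes "f \<in> R" "g \<in> R" shows "(\<lambda>z. f z + g z) \<in> R"
proof -
  obtain r s where r: "\<And>c r' U. is_bundle_chart Y c \<Longrightarrow> r \<le> r' \<Longrightarrow> smooth_of_order r' c U f"
    and s: "\<And>c r' U. is_bundle_chart Y c \<Longrightarrow> s \<le> r' \<Longrightarrow> smooth_of_order r' c U g"
    using ring_smooth[OF assms(1)] ring_smooth[OF assms(2)] by metis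
  show ?thesis
    by (rule ringI[of _ "max r s"])
      (use ring_zero[OF assms(1)] ring_zero[OF assms(2)] r s atlas_chart in \<open>auto intro!: smooth_of_order_add openin_topspace\<close>)
qed

lemma ring_mult: assumes "f \<in> R" "g \<in> R" shows "(\<lambda>z. f z * g z) \<in> R"
proof -
  obtain r s where r: "\<And>c r' U. is_bundle_chart Y c \<Longrightarrow> r \<le> r' \<Longrightarrow> smooth_of_order r' c U f"
    and s: "\<And>c r' U. is_bundle_chart Y c \<Longrightarrow> s \<le> r' \<Longrightarrow> smooth_of_order r' c U g"
    using ring_smooth[OF assms(1)] ring_smooth[OF assms(2)] by metis
  show ?thesis
    by (rule ringI[of _ "max r s"])
      (use ring_zero[OF assms(1)] ring_zero[OF assms(2)] r s atlas_chart in \<open>auto intro!: smooth_of_order_mult openin_topspace\<close>)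
qed

lemma ring_cmult: assumes "f \<in> R" shows "(\<lambda>z. a * f z) \<in> R"
proof -
  obtain r where r: "\<And>c r' U. is_bundle_chart Y c \<Longrightarrow> r \<le> r' \<Longrightarrow> smooth_of_order r' c U f"
    using ring_smooth[OF assms] by metis
  show ?thesis
    by (rule ringI[of _ r])
      (use ring_zero[OF assms] r atlas_chart in \<open>auto intro!: smooth_of_order_mult smooth_of_order_const openin_topspace\<close>)
qed

lemma ring_const_zero: "(\<lambda>_. 0) \<in> R"
  by (rule ringI[of _ 0]) (use atlas_chart in \<open>auto intro!: smooth_of_order_const openin_topspace\<close>)

lemma ring_sum: "(\<And>i. i \<in> I \<Longrightarrow> f i \<in> R) \<Longrightarrow> (\<lambda>z. \<Sum>i\<in>I. f i z) \<in> R"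
  by (induction I rule: infinite_finite_induct) (auto intro: ring_const_zero ring_add)

context
  fixes \<upsilon> assumes \<upsilon>: "\<upsilon> \<in> derivations R"
begin

lemma derivation_in: "f \<in> R \<Longrightarrow> \<upsilon> f \<in> R"
  and derivation_add: "f \<in> R \<Longrightarrow> g \<in> R \<Longrightarrow> \<upsilon> (\<lambda>z. f z + g z) = (\<lambda>z. \<upsilon> f z + \<upsilon> g z)"
  and derivation_cmult: "f \<in> R \<Longrightarrow> \<upsilon> (\<lambda>z. a * f z) = (\<lambda>z. a * \<upsilon> f z)"
  and derivation_mult: "f \<in> R \<Longrightarrow> g \<in> R \<Longrightarrow> \<upsilon> (\<lambda>z. f z * g z) = (\<lambda>z. \<upsilon> f z * g z + f z * \<upsilon> g z)"
  using \<upsilon> by (auto simp: derivations_def)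

lemma derivation_sum:
  "(\<And>i. i \<in> I \<Longrightarrow> f i \<in> R) \<Longrightarrow> \<upsilon> (\<lambda>z. \<Sum>i\<in>I. f i z) = (\<lambda>z. \<Sum>i\<in>I. \<upsilon> (f i) z)"
proof (induction I rule: infinite_finite_induct)
  case (insert i I)
  then show ?case by (simp add: derivation_add ring_sum)
qed (use derivation_cmult[OF ring_const_zero, of 0] in simp_all)

text \<open>Both sides are the value of \<open>\<upsilon>\<close> on the local function \<open>y\<close>: apply \<open>\<upsilon>\<close> to
  \<open>\<rho>(\<sigma>y) = \<sigma>(\<rho>y)\<close>.\<close>

lemma derivation_cutoff:
  assumes "\<rho> \<in> R" "(\<lambda>z. \<rho> z * y z) \<in> R" "\<rho> z \<noteq> 0" "\<sigma> \<in> R" "(\<lambda>z. \<sigma> z * y z) \<in> R" "\<sigma> z \<noteq> 0"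
  shows "(\<upsilon> (\<lambda>z. \<rho> z * y z) z - y z * \<upsilon> \<rho> z) / \<rho> z = (\<upsilon> (\<lambda>z. \<sigma> z * y z) z - y z * \<upsilon> \<sigma> z) / \<sigma> z"
proof -
  have 1: "\<upsilon> (\<lambda>z. \<rho> z * (\<sigma> z * y z)) z = \<upsilon> \<rho> z * (\<sigma> z * y z) + \<rho> z * \<upsilon> (\<lambda>z. \<sigma> z * y z) z"
    by (rule fun_cong[OF derivation_mult[OF assms(1,5)]])
  have 2: "\<upsilon> (\<lambda>z. \<sigma> z * (\<rho> z * y z)) z = \<upsilon> \<sigma> z * (\<rho> z * y z) + \<sigma> z * \<upsilon> (\<lambda>z. \<rho> z * y z) z"
    by (rule fun_cong[OF derivation_mult[OF assms(4,2)]])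
  have "(\<lambda>z. \<rho> z * (\<sigma> z * y z)) = (\<lambda>z. \<sigma> z * (\<rho> z * y z))" by (rule ext) (rule mult.left_commute)
  then have eq: "\<upsilon> \<rho> z * (\<sigma> z * y z) + \<rho> z * \<upsilon> (\<lambda>z. \<sigma> z * y z) z =
      \<upsilon> \<sigma> z * (\<rho> z * y z) + \<sigma> z * \<upsilon> (\<lambda>z. \<rho> z * y z) z"
    using 1 2 by (simp only:)
  have "(a - y' * r) / \<rho>' = (b - y' * s) / \<sigma>'"
    if "r * (\<sigma>' * y') + \<rho>' * b = s * (\<rho>' * y') + \<sigma>' * a" "\<rho>' \<noteq> 0" "\<sigma>' \<noteq> 0" for a b r s \<rho>' \<sigma>' y' :: real
    using that by (simp add: field_simps)
  from this[OF eq assms(3,6)] show ?thesis .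
qed

text \<open>The value of \<upsilon> on a local function \<open>y\<close>, computed from components:
  in the numerator Leibniz's rule leaves \<open>\<sigma>\<close> times the vector field applied to
  \<open>y\<close>. A coordinate of \<open>c\<close> as \<open>y\<close> yields uniqueness of the
  components, a coordinate of another chart the transformation law.\<close>

lemma expressed_cutoff:
  assumes \<nu>: "expressed_by Y A \<upsilon> \<nu>" and c: "c \<in> A" and U: "openin (mtop (total_mfd Y)) U"
    and z: "z \<in> inf_jets_over Y (bdom c \<inter> U)" and y: "smooth_of_order r c U y"
    and \<sigma>: "\<sigma> \<in> R" "(\<lambda>z. \<sigma> z * y z) \<in> R" "\<sigma> z \<noteq> 0"
  shows "(\<upsilon> (\<lambda>z. \<sigma> z * y z) z - y z * \<upsilon> \<sigma> z) / \<sigma> z = (\<Sum>k\<in>jet_indices Y r. \<nu> c k z * inf_partial c k y z)"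
proof -
  note ch = atlas_chart[OF c]
  obtain s where s: "\<And>c r' U. is_bundle_chart Y c \<Longrightarrow> s \<le> r' \<Longrightarrow> smooth_of_order r' c U \<sigma>"
    using ring_smooth[OF \<sigma>(1)] by metis
  define N where "N = max r s"
  have zc: "z \<in> inf_jets_over Y (bdom c)" using z by (auto simp: inf_jets_over_def)
  have yN: "smooth_of_order N c U y" by (rule smooth_of_order_mono[OF ch U y]) (simp add: N_def)
  have \<sigma>N: "smooth_of_order N c U \<sigma>" by (rule s[OF ch]) (simp add: N_def)
  note \<sigma>y = smooth_of_order_mult[OF ch U \<sigma>N yN]
  have "\<upsilon> \<sigma> z = (\<Sum>k\<in>jet_indices Y N. \<nu> c k z * inf_partial c k \<sigma> z)"
    using \<nu> \<sigma>(1) c zc coordinate_expression_eq[OF ch U \<sigma>N z] by (simp add: expressed_by_def)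
  moreover have "\<upsilon> (\<lambda>z. \<sigma> z * y z) z = (\<Sum>k\<in>jet_indices Y N. \<nu> c k z * inf_partial c k (\<lambda>z. \<sigma> z * y z) z)"
    using \<nu> \<sigma>(2) c zc coordinate_expression_eq[OF ch U \<sigma>y z] by (simp add: expressed_by_def)
  moreover have "\<dots> = (\<Sum>k\<in>jet_indices Y N. y z * (\<nu> c k z * inf_partial c k \<sigma> z) + \<sigma> z * (\<nu> c k z * inf_partial c k y z))"
    using inf_partial_mult[OF ch U \<sigma>N yN z] jet_indices_subset_inf[of N]
    by (intro sum.cong) (auto simp: algebra_simps)
  ultimately have "\<upsilon> (\<lambda>z. \<sigma> z * y z) z - y z * \<upsilon> \<sigma> z = \<sigma> z * (\<Sum>k\<in>jet_indices Y N. \<nu> c k z * inf_partial c k y z)"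
    by (simp add: sum.distrib sum_distrib_left)
  \<comment> \<open>Raising the order from \<open>r\<close> to \<open>N\<close>, for the sake of
    \<open>\<sigma>\<close>, only adds vanishing derivatives of \<open>y\<close>.\<close>
  moreover have "(\<Sum>k\<in>jet_indices Y N. \<nu> c k z * inf_partial c k y z) = (\<Sum>k\<in>jet_indices Y r. \<nu> c k z * inf_partial c k y z)"
    using jet_indices_mono[of r N Y] inf_partial_zero[OF ch U y z] jet_indices_subset_inf[of N]
    by (intro sum.mono_neutral_right finite_jet_indices) (auto simp: N_def)
  ultimately show ?thesis using \<sigma>(3) by simp
qed

end

section \<open>From derivations to components\<close>

definition coord_cutoff :: "('x, 'y) bundle_chart \<Rightarrow> jet_index \<Rightarrow> (('x, 'y) inf_jet \<Rightarrow> real) \<Rightarrow> bool" where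
  "coord_cutoff c k \<rho> \<longleftrightarrow> \<rho> \<in> R \<and> (\<lambda>z. \<rho> z * inf_jet_coord c z k) \<in> R \<and> (\<forall>z\<in>inf_jets_over Y (bdom c). \<rho> z > 0)"

definition cutoff :: "('x, 'y) bundle_chart \<Rightarrow> jet_index \<Rightarrow> ('x, 'y) inf_jet \<Rightarrow> real" where
  "cutoff c k = (SOME \<rho>. coord_cutoff c k \<rho>)"

lemma cutoff:
  assumes c: "c \<in> A" and k: "k \<in> inf_jet_indices Y"
  shows "cutoff c k \<in> R" "(\<lambda>z. cutoff c k z * inf_jet_coord c z k) \<in> R"
    "z \<in> inf_jets_over Y (bdom c) \<Longrightarrow> cutoff c k z > 0"
proof -
  obtain r where r: "k \<in> jet_indices Y r" using k by (auto simp: inf_jet_indices_def)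
  have "\<exists>\<rho>. coord_cutoff c k \<rho>"
  proof (rule ex_cutoff[OF atlas finite_atlas atlas_chart[OF c] openin_bdom[OF atlas_chart[OF c]] order_refl,
        of "{\<lambda>z. inf_jet_coord c z k}" r])
    show "smooth_of_order r c (bdom c) g" if "g \<in> {\<lambda>z. inf_jet_coord c z k}" for g
      using that smooth_of_order_coord[OF atlas_chart[OF c] openin_bdom[OF atlas_chart[OF c]] r] by simp
  qed (auto simp: coord_cutoff_def)
  then have "coord_cutoff c k (cutoff c k)" unfolding cutoff_def by (rule someI_ex)
  then show "cutoff c k \<in> R" "(\<lambda>z. cutoff c k z * inf_jet_coord c z k) \<in> R"
    "z \<in> inf_jets_over Y (bdom c) \<Longrightarrow> cutoff c k z > 0"
    by (auto simp: coord_cutoff_def)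
qed

definition components_of ::
    "((('x, 'y) inf_jet \<Rightarrow> real) \<Rightarrow> ('x, 'y) inf_jet \<Rightarrow> real) \<Rightarrow> ('x, 'y) components" where
  "components_of \<upsilon> = (\<lambda>c\<in>A. \<lambda>k\<in>inf_jet_indices Y. \<lambda>z. if z \<in> inf_jets_over Y (bdom c) then
     (\<upsilon> (\<lambda>z. cutoff c k z * inf_jet_coord c z k) z - inf_jet_coord c z k * \<upsilon> (cutoff c k) z) / cutoff c k z else 0)"

context
  fixes \<upsilon> assumes \<upsilon>: "\<upsilon> \<in> derivations R"
begin

lemma components_of_local: "components_of \<upsilon> \<in> local_components Y A"
  unfolding local_components_def components_of_def
proof (intro restrict_PiE_iff[THEN iffD2] ballI)
  fix c k assume c: "c \<in> A" and k: "k \<in> inf_jet_indices Y"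
  let ?\<rho> = "cutoff c k" and ?y = "\<lambda>z. inf_jet_coord c z k"
  let ?f = "\<lambda>z. (\<upsilon> (\<lambda>z. ?\<rho> z * ?y z) z - ?y z * \<upsilon> ?\<rho> z) / ?\<rho> z"
  note cut = cutoff[OF c k] and ch = atlas_chart[OF c]
  obtain r0 where r0: "k \<in> jet_indices Y r0" using k by (auto simp: inf_jet_indices_def)
  obtain r1 where r1: "\<And>c r' U. is_bundle_chart Y c \<Longrightarrow> r1 \<le> r' \<Longrightarrow> smooth_of_order r' c U ?\<rho>"
    using ring_smooth[OF cut(1)] by metis
  obtain r2 where r2: "\<And>c r' U. is_bundle_chart Y c \<Longrightarrow> r2 \<le> r' \<Longrightarrow> smooth_of_order r' c U (\<upsilon> ?\<rho>)"
    using ring_smooth[OF derivation_in[OF \<upsilon> cut(1)]] by metis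
  obtain r3 where r3: "\<And>c r' U. is_bundle_chart Y c \<Longrightarrow> r3 \<le> r' \<Longrightarrow> smooth_of_order r' c U (\<upsilon> (\<lambda>z. ?\<rho> z * ?y z))"
    using ring_smooth[OF derivation_in[OF \<upsilon> cut(2)]] by metis
  \<comment> \<open>\<open>N\<close> bounds the orders of the coordinate, the cut-off and the two
    values of \<upsilon>. The last three are global functions, so each has one order over the whole
    chart.\<close>
  define N where "N = max (max r0 r1) (max r2 r3)"
  have N: "r0 \<le> N" "r1 \<le> N" "r2 \<le> N" "r3 \<le> N" by (auto simp: N_def)
  show "(\<lambda>z. if z \<in> inf_jets_over Y (bdom c) then ?f z else 0) \<in> fin_order_functions Y (bdom c)"
  proof (rule fin_order_functionsI[OF atlas openin_bdom[OF ch]])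
    fix c' assume c': "c' \<in> A"
    note ch' = atlas_chart[OF c'] and U = openin_bdom[OF ch]
    have y: "smooth_of_order N c' (bdom c) ?y"
      using smooth_of_order_foreign_coord[OF ch' U ch, of k N] subsetD[OF jet_indices_mono[OF N(1)] r0] by simp
    have "smooth_of_order N c' (bdom c) (\<lambda>z. (\<upsilon> (\<lambda>z. ?\<rho> z * ?y z) z + (- 1) * (?y z * \<upsilon> ?\<rho> z)) * inverse (?\<rho> z))"
    proof (intro smooth_of_order_mult[OF ch' U] smooth_of_order_add[OF ch' U] smooth_of_order_const[OF ch' U]
          smooth_of_order_inverse[OF ch' U] y r1 r2 r3 ch' N)
      show "?\<rho> z \<noteq> 0" if "z \<in> inf_jets_over Y (bdom c' \<inter> bdom c)" for z
        using cut(3)[of z] that by (auto simp: inf_jets_over_def)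
    qed
    then show "smooth_of_order N c' (bdom c) (\<lambda>z. if z \<in> inf_jets_over Y (bdom c) then ?f z else 0)"
      by (rule smooth_of_order_cong) (auto simp: inf_jets_over_def divide_inverse)
  qed simp
qed

text \<open>\<upsilon> is applied at \<open>z\<close> to \<open>\<rho> \<rho> f\<close> in two ways:
  directly by Leibniz's rule, and after Hadamard's expansion of \<open>f\<close> about the
  coordinates of \<open>z\<close>. The terms containing the derivative of
  \<open>\<rho> \<rho>\<close> cancel because \<open>F p\<close> is \<open>f z\<close>.\<close>

lemma components_of_expressed: "expressed_by Y A \<upsilon> (components_of \<upsilon>)"
  unfolding expressed_by_def
proof (intro ballI)
  fix f c z assume f: "f \<in> R" and c: "c \<in> A" and z: "z \<in> inf_jets_over Y (bdom c)"
  note ch = atlas_chart[OF c]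
  obtain r where r: "\<And>c r' U. is_bundle_chart Y c \<Longrightarrow> r \<le> r' \<Longrightarrow> smooth_of_order r' c U f"
    using ring_smooth[OF f] by metis
  let ?K = "jet_indices Y r" and ?D = "base_dim Y + fib_dim Y"
  define tc where "tc = total_chart Y c"
  note tt = total_top_chart[OF ch, folded tc_def]
  have tcb: "cdom tc = bdom c" by (simp add: tc_def)
  define p where "p = inf_coords r c z"
  have pU: "p \<in> jet_image Y r c (bdom c)" unfolding p_def using inf_coords_in_image[OF ch, of z "bdom c"] z by simp
  define u where "u = total_part Y p"
  have "openin (powertop_real {..<?D}) (cmap tc ` bdom c)"
    using top_chart_image_open'[OF tt openin_bdom[OF ch]] by (simp add: tcb)
  moreover have "u \<in> cmap tc ` bdom c" using pU by (auto simp: jet_image_def u_def tc_def)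
  ultimately obtain e where e: "e > 0" "box_at {..<?D} u e \<subseteq> cmap tc ` bdom c"
    unfolding openin_powertop_iff[OF finite_lessThan] by blast
  \<comment> \<open>A box in the chart of \<open>Y\<close>. Its preimage in the jet chart is
    star-shaped about \<open>p\<close>, the derivative coordinates being unrestricted.\<close>
  define U where "U = {y \<in> bdom c. cmap tc y \<in> box_at {..<?D} u e}"
  have Ub: "U \<subseteq> bdom c" by (auto simp: U_def)
  have "openin (subtopology (mtop (total_mfd Y)) (bdom c)) U"
    using openin_continuous_map_preimage[OF top_chart_continuous[OF tt] openin_box_at[OF finite_lessThan]]
    unfolding U_def tcb top_chart_topspace[OF tt, unfolded tcb] .
  then have U: "openin (mtop (total_mfd Y)) U" using openin_bdom[OF ch] by (rule openin_trans_full)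
  have JU: "jet_image Y r c U = {q \<in> coord_space ?K. total_part Y q \<in> box_at {..<?D} u e}"
    using e(2) Ub by (auto simp: jet_image_def U_def tc_def[symmetric])
  have pJ: "p \<in> jet_image Y r c U"
    using subsetD[OF jet_image_subset_space pU] box_at_centre[OF total_part_in_space e(1), of Y p]
    unfolding JU u_def by simp
  have zU: "z \<in> inf_jets_over Y U"
  proof -
    have "cmap tc (jet_value (z 0)) = u" using total_part_inf_coords[OF ch z, of r] by (simp add: u_def p_def tc_def)
    then show ?thesis
      using z box_at_centre[OF total_part_in_space e(1), of Y p] by (simp add: inf_jets_over_def U_def u_def)
  qed
  have zcU: "z \<in> inf_jets_over Y (bdom c \<inter> U)" using z zU by (simp add: inf_jets_over_def)
  obtain F where F: "smooth_on ?K (jet_image Y r c U) F" "\<And>z. z \<in> inf_jets_over Y (bdom c \<inter> U) \<Longrightarrow> f z = F (inf_coords r c z)"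
    by (rule smooth_of_orderE[OF r[OF ch order_refl, of U]], rule that)
  have star: "homothety ?K p t q \<in> jet_image Y r c U" if q: "q \<in> jet_image Y r c U" and t: "0 \<le> t" "t \<le> 1" for q t
  proof -
    have tp: "total_part Y (homothety ?K p t q) k = u k + t * (total_part Y q k - u k)" if "k < ?D" for k
      using that by (auto simp: total_part_def append_coords_apply u_def homothety_def)
    have "\<bar>total_part Y (homothety ?K p t q) k - u k\<bar> < e" if k: "k < ?D" for k
    proof -
      have "\<bar>total_part Y (homothety ?K p t q) k - u k\<bar> = t * \<bar>total_part Y q k - u k\<bar>"
        using t by (simp add: tp[OF k] abs_mult)
      also have "\<dots> \<le> 1 * \<bar>total_part Y q k - u k\<bar>" by (rule mult_right_mono) (use t in auto)
      also have "\<dots> < e" using q k by (auto simp: JU box_at_def)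
      finally show ?thesis .
    qed
    then show ?thesis using total_part_in_space by (auto simp: JU box_at_def homothety_def)
  qed
  obtain G where G: "\<And>k. k \<in> ?K \<Longrightarrow> smooth_on ?K (jet_image Y r c U) (G k)" "\<And>k. k \<in> ?K \<Longrightarrow> G k p = partial k F p"
    "\<And>q. q \<in> jet_image Y r c U \<Longrightarrow> F q = F p + (\<Sum>k\<in>?K. (q k - p k) * G k q)"
  proof (rule hadamard[OF finite_jet_indices openin_jet_image[OF ch U] pJ _ F(1)])
    show "homothety ?K p t q \<in> jet_image Y r c U" if "q \<in> jet_image Y r c U" "0 \<le> t" "t \<le> 1" for q t
      by (rule star[OF that])
  qed (rule that)
  define g where "g k z = G k (inf_coords r c z)" for k z
  define y where "y k z = inf_jet_coord c z k" for k z
  have gs: "smooth_of_order r c U (g k)" if "k \<in> ?K" for k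
    by (rule smooth_of_orderI[OF G(1)[OF that]]) (simp add: g_def)
  have ys: "smooth_of_order r c U (y k)" if "k \<in> ?K" for k
    using smooth_of_order_coord[OF ch U that] by (simp add: y_def[abs_def])
  \<comment> \<open>This \<rho> belongs to \<open>f\<close> and \<open>z\<close>, unlike the cut-off
    in \<open>components_of\<close>; \<open>derivation_cutoff\<close> will exchange the two.\<close>
  obtain \<rho> where \<rho>: "\<rho> \<in> R" "\<And>z. z \<in> inf_jets_over Y U \<Longrightarrow> \<rho> z > 0" "\<And>z. z \<notin> inf_jets_over Y U \<Longrightarrow> \<rho> z = 0"
    "\<And>h. h \<in> g ` ?K \<union> y ` ?K \<Longrightarrow> (\<lambda>z. \<rho> z * h z) \<in> R"
  proof (rule ex_cutoff[OF atlas finite_atlas ch U Ub, of "g ` ?K \<union> y ` ?K" r])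
    show "finite (g ` ?K \<union> y ` ?K)" by (intro finite_UnI finite_imageI finite_jet_indices)
    show "smooth_of_order r c U h" if "h \<in> g ` ?K \<union> y ` ?K" for h using that gs ys by auto
  qed (rule that)
  \<comment> \<open>Both factors of each product must lie in \<open>R\<close>, hence two factors
    \<rho>. The first, \<rho> times the increment of the coordinate, is written as a sum of members
    of \<open>R\<close> so that additivity of \<upsilon> applies.\<close>
  define a where "a k z = \<rho> z * y k z + (- p k) * \<rho> z" for k z
  define b where "b k z = \<rho> z * g k z" for k z
  have aR: "a k \<in> R" and bR: "b k \<in> R" if k: "k \<in> ?K" for k
  proof -
    have "(\<lambda>z. \<rho> z * y k z) \<in> R" using \<rho>(4) k by blast
    then show "a k \<in> R" unfolding a_def[abs_def] by (rule ring_add[OF _ ring_cmult[OF \<rho>(1)]])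
    show "b k \<in> R" unfolding b_def[abs_def] using \<rho>(4) k by blast
  qed
  have \<rho>2: "(\<lambda>z. \<rho> z * \<rho> z) \<in> R" by (rule ring_mult[OF \<rho>(1,1)])
  have \<rho>f: "(\<lambda>z. \<rho> z * \<rho> z * f z) = (\<lambda>z. F p * (\<rho> z * \<rho> z) + (\<Sum>k\<in>?K. a k z * b k z))"
  proof
    fix w
    show "\<rho> w * \<rho> w * f w = F p * (\<rho> w * \<rho> w) + (\<Sum>k\<in>?K. a k w * b k w)"
    proof (cases "w \<in> inf_jets_over Y U")
      case True
      then have w: "w \<in> inf_jets_over Y (bdom c \<inter> U)" using Ub by (auto simp: inf_jets_over_def)
      have "f w = F p + (\<Sum>k\<in>?K. (inf_coords r c w k - p k) * G k (inf_coords r c w))"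
        using F(2)[OF w] G(3)[OF inf_coords_in_image[OF ch w]] by simp
      also have "(\<Sum>k\<in>?K. (inf_coords r c w k - p k) * G k (inf_coords r c w)) = (\<Sum>k\<in>?K. (y k w - p k) * g k w)"
        by (intro sum.cong) (auto simp: inf_coords_def y_def g_def)
      finally show ?thesis by (simp add: a_def b_def sum_distrib_left algebra_simps)
    qed (simp add: \<rho>(3) a_def b_def)
  qed
  have pz: "y k z = p k" if "k \<in> ?K" for k using that by (simp add: p_def inf_coords_def y_def)
  have fz: "f z = F p" using F(2)[OF zcU] by (simp add: p_def)
  have \<rho>z: "\<rho> z > 0" by (rule \<rho>(2)[OF zU])
  have "\<upsilon> (\<lambda>z. \<rho> z * \<rho> z * f z) z = \<upsilon> (\<lambda>z. \<rho> z * \<rho> z) z * f z + \<rho> z * \<rho> z * \<upsilon> f z"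
    using derivation_mult[OF \<upsilon> \<rho>2 f] by simp
  moreover have "\<upsilon> (\<lambda>z. \<rho> z * \<rho> z * f z) z = F p * \<upsilon> (\<lambda>z. \<rho> z * \<rho> z) z + (\<Sum>k\<in>?K. \<upsilon> (\<lambda>z. a k z * b k z) z)"
  proof -
    have ab: "(\<lambda>z. a k z * b k z) \<in> R" if "k \<in> ?K" for k by (rule ring_mult[OF aR[OF that] bR[OF that]])
    have "(\<lambda>z. \<Sum>k\<in>?K. a k z * b k z) \<in> R" by (rule ring_sum[OF ab])
    then have "\<upsilon> (\<lambda>z. F p * (\<rho> z * \<rho> z) + (\<Sum>k\<in>?K. a k z * b k z)) =
        (\<lambda>z. \<upsilon> (\<lambda>z. F p * (\<rho> z * \<rho> z)) z + \<upsilon> (\<lambda>z. \<Sum>k\<in>?K. a k z * b k z) z)"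
      by (rule derivation_add[OF \<upsilon> ring_cmult[OF \<rho>2]])
    then show ?thesis
      unfolding \<rho>f using derivation_cmult[OF \<upsilon> \<rho>2] derivation_sum[OF \<upsilon>, of ?K "\<lambda>k z. a k z * b k z"] ab by simp
  qed
  ultimately have main: "\<rho> z * \<rho> z * \<upsilon> f z = (\<Sum>k\<in>?K. \<upsilon> (\<lambda>z. a k z * b k z) z)" using fz by simp
  have "\<upsilon> (\<lambda>z. a k z * b k z) z = \<rho> z * \<rho> z * (components_of \<upsilon> c k z * inf_partial c k f z)" if k: "k \<in> ?K" for k
  proof -
    have ki: "k \<in> inf_jet_indices Y" using k jet_indices_subset_inf by blast
    have \<rho>y: "(\<lambda>z. \<rho> z * y k z) \<in> R" using \<rho>(4) k by blast
    \<comment> \<open>\<open>a k\<close> vanishes at \<open>z\<close>, so one of the two terms of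
      Leibniz's rule drops out.\<close>
    have "\<upsilon> (\<lambda>z. a k z * b k z) z = \<upsilon> (a k) z * b k z"
      using derivation_mult[OF \<upsilon> aR[OF k] bR[OF k]] pz[OF k] by (simp add: a_def)
    also have "\<upsilon> (a k) z = \<upsilon> (\<lambda>z. \<rho> z * y k z) z - y k z * \<upsilon> \<rho> z"
      using derivation_add[OF \<upsilon> \<rho>y ring_cmult[OF \<rho>(1), of "- p k"]] derivation_cmult[OF \<upsilon> \<rho>(1), of "- p k"] pz[OF k]
      by (simp add: a_def[abs_def])
    also have "\<dots> = \<rho> z * components_of \<upsilon> c k z"
      using derivation_cutoff[OF \<upsilon> \<rho>(1) \<rho>y _ cutoff(1,2)[OF c ki, folded y_def], of z] \<rho>z cutoff(3)[OF c ki z] c ki z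
      by (simp add: components_of_def y_def field_simps)
    also have "b k z = \<rho> z * inf_partial c k f z"
      using inf_partial_eq[OF ch U zcU ki, of f F r, OF F(2)] k G(2)[OF k] by (simp add: b_def g_def p_def)
    finally show ?thesis by simp
  qed
  then have "\<rho> z * \<rho> z * \<upsilon> f z = \<rho> z * \<rho> z * (\<Sum>k\<in>?K. components_of \<upsilon> c k z * inf_partial c k f z)"
    using main by (simp add: sum_distrib_left)
  then have "\<upsilon> f z = (\<Sum>k\<in>?K. components_of \<upsilon> c k z * inf_partial c k f z)" using \<rho>z by simp
  then show "\<upsilon> f z = coordinate_expression Y c (components_of \<upsilon> c) f z"
    using coordinate_expression_eq[OF ch U r[OF ch order_refl] zcU] by simp
qed

lemma expressed_eq_components_of:
  assumes \<nu>: "expressed_by Y A \<upsilon> \<nu>" and c: "c \<in> A" and k: "k \<in> inf_jet_indices Y" and z: "z \<in> inf_jets_over Y (bdom c)"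
  shows "\<nu> c k z = components_of \<upsilon> c k z"
proof -
  note ch = atlas_chart[OF c] and U = openin_bdom[OF atlas_chart[OF c]]
  obtain r where r: "k \<in> jet_indices Y r" using k by (auto simp: inf_jet_indices_def)
  have z': "z \<in> inf_jets_over Y (bdom c \<inter> bdom c)" using z by simp
  have "components_of \<upsilon> c k z = (\<Sum>k'\<in>jet_indices Y r. \<nu> c k' z * inf_partial c k' (\<lambda>z. inf_jet_coord c z k) z)"
    using expressed_cutoff[OF \<upsilon> \<nu> c U z' smooth_of_order_coord[OF ch U r] cutoff(1,2)[OF c k]] cutoff(3)[OF c k z] c k z
    by (simp add: components_of_def)
  also have "\<dots> = (\<Sum>k'\<in>jet_indices Y r. if k' = k then \<nu> c k z else 0)"
    using inf_partial_coord[OF ch U z' _ r] jet_indices_subset_inf[of r] by (intro sum.cong) auto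
  also have "\<dots> = \<nu> c k z" using r finite_jet_indices[of Y r] by simp
  finally show ?thesis by simp
qed

lemma components_of_transformation: "transformation_law Y A (components_of \<upsilon>)"
  unfolding transformation_law_iff[OF atlas]
proof (intro ballI allI)
  fix c c' z r k assume c: "c \<in> A" and c': "c' \<in> A" and z: "z \<in> inf_jets_over Y (bdom c \<inter> bdom c')"
    and k: "k \<in> jet_indices Y r"
  note ch = atlas_chart[OF c] and ch' = atlas_chart[OF c'] and U = openin_bdom[OF atlas_chart[OF c']]
  have ki: "k \<in> inf_jet_indices Y" using k jet_indices_subset_inf by blast
  have z': "z \<in> inf_jets_over Y (bdom c')" using z by (auto simp: inf_jets_over_def)
  have "smooth_of_order r c (bdom c') (\<lambda>w. inf_jet_coord c' w k)"
    using smooth_of_order_foreign_coord[OF ch U ch' k] by simp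
  from expressed_cutoff[OF \<upsilon> components_of_expressed c U z this cutoff(1,2)[OF c' ki]]
  show "components_of \<upsilon> c' k z = (\<Sum>k'\<in>jet_indices Y r. components_of \<upsilon> c k' z * inf_partial c k' (\<lambda>w. inf_jet_coord c' w k) z)"
    using cutoff(3)[OF c' ki z'] c' ki z' by (simp add: components_of_def[of \<upsilon>, THEN fun_cong, of c'])
qed

text \<open>The values over each chart are forced. Elsewhere both families are fixed by convention:
  zero off the chart domain, \<open>undefined\<close> outside the index sets.\<close>

lemma components_unique:
  assumes \<nu>: "\<nu> \<in> local_components Y A" "expressed_by Y A \<upsilon> \<nu>"
  shows "\<nu> = components_of \<upsilon>"
proof (rule PiE_ext[OF \<nu>(1)[unfolded local_components_def] components_of_local[unfolded local_components_def]])
  fix c assume c: "c \<in> A"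
  note m = PiE_mem[OF \<nu>(1)[unfolded local_components_def] c] and m' = PiE_mem[OF components_of_local[unfolded local_components_def] c]
  show "\<nu> c = components_of \<upsilon> c"
  proof (rule PiE_ext[OF m m'])
    fix k assume k: "k \<in> inf_jet_indices Y"
    show "\<nu> c k = components_of \<upsilon> c k"
    proof
      fix z
      show "\<nu> c k z = components_of \<upsilon> c k z"
        using expressed_eq_components_of[OF \<nu>(2) c k] PiE_mem[OF m k] PiE_mem[OF m' k]
        by (cases "z \<in> inf_jets_over Y (bdom c)") (auto simp: fin_order_functions_def)
    qed
  qed
qed

end

lemma ex1_components:
  assumes "\<upsilon> \<in> derivations R"
  shows "\<exists>!\<nu>. \<nu> \<in> local_components Y A \<and> transformation_law Y A \<nu> \<and> expressed_by Y A \<upsilon> \<nu>"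
  using components_of_local[OF assms] components_of_transformation[OF assms] components_of_expressed[OF assms]
    components_unique[OF assms] by blast

section \<open>From components to derivations\<close>

context
  fixes \<nu> assumes \<nu>: "\<nu> \<in> local_components Y A" and law: "transformation_law Y A \<nu>"
begin

lemma coordinate_expression_chart_indep:
  assumes c: "c \<in> A" and c': "c' \<in> A" and z: "z \<in> inf_jets_over Y (bdom c)" "z \<in> inf_jets_over Y (bdom c')" and f: "f \<in> R"
  shows "coordinate_expression Y c (\<nu> c) f z = coordinate_expression Y c' (\<nu> c') f z"
proof -
  note ch = atlas_chart[OF c] and ch' = atlas_chart[OF c']
  obtain r where r: "\<And>c r' U. is_bundle_chart Y c \<Longrightarrow> r \<le> r' \<Longrightarrow> smooth_of_order r' c U f"
    using ring_smooth[OF f] by metis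
  let ?K = "jet_indices Y r" and ?D = "\<lambda>k' k. inf_partial c k (\<lambda>w. inf_jet_coord c' w k') z"
  have zz: "z \<in> inf_jets_over Y (bdom c \<inter> bdom c')" using z by (auto simp: inf_jets_over_def)
  have zt: "z \<in> inf_jets_over Y (bdom c \<inter> (bdom c' \<inter> total_space Y))" "z \<in> inf_jets_over Y (bdom c \<inter> total_space Y)"
    "z \<in> inf_jets_over Y (bdom c' \<inter> total_space Y)"
    using z openin_subset[OF openin_bdom[OF ch]] by (auto simp: inf_jets_over_def)
  have "coordinate_expression Y c (\<nu> c) f z = (\<Sum>k\<in>?K. \<nu> c k z * inf_partial c k f z)"
    by (rule coordinate_expression_eq[OF ch openin_topspace r[OF ch order_refl] zt(2)])
  also have "\<dots> = (\<Sum>k\<in>?K. \<Sum>k'\<in>?K. inf_partial c' k' f z * (\<nu> c k z * ?D k' k))"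
    using inf_partial_chain[OF ch openin_topspace ch' r[OF ch' order_refl] zt(1)] jet_indices_subset_inf[of r]
    by (intro sum.cong) (auto simp: sum_distrib_left mult_ac)
  also have "\<dots> = (\<Sum>k'\<in>?K. inf_partial c' k' f z * (\<Sum>k\<in>?K. \<nu> c k z * ?D k' k))"
    by (subst sum.swap) (simp add: sum_distrib_left)
  also have "\<dots> = (\<Sum>k'\<in>?K. \<nu> c' k' z * inf_partial c' k' f z)"
    using law[unfolded transformation_law_iff[OF atlas], rule_format, OF c c' zz, of _ r]
    by (intro sum.cong) auto
  also have "\<dots> = coordinate_expression Y c' (\<nu> c') f z"
    by (rule coordinate_expression_eq[OF ch' openin_topspace r[OF ch' order_refl] zt(3), symmetric])
  finally show ?thesis .
qed

text \<open>The choice of chart is harmless by the preceding lemma. Restriction to \<open>R\<close>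
  and the value zero off \<open>inf_jets Y\<close> match the conventions in
  \<open>derivations\<close> and \<open>fin_order_ring\<close>.\<close>

definition derivation_of :: "(('x, 'y) inf_jet \<Rightarrow> real) \<Rightarrow> ('x, 'y) inf_jet \<Rightarrow> real" where
  "derivation_of = (\<lambda>f\<in>R. \<lambda>z. if z \<in> inf_jets Y then
     (let c = SOME c. c \<in> A \<and> z \<in> inf_jets_over Y (bdom c) in coordinate_expression Y c (\<nu> c) f z) else 0)"

lemma derivation_of_eq:
  assumes f: "f \<in> R" and c: "c \<in> A" and z: "z \<in> inf_jets_over Y (bdom c)"
  shows "derivation_of f z = coordinate_expression Y c (\<nu> c) f z"
proof -
  define c' where "c' = (SOME c. c \<in> A \<and> z \<in> inf_jets_over Y (bdom c))"
  have c': "c' \<in> A \<and> z \<in> inf_jets_over Y (bdom c')" unfolding c'_def by (rule someI[of _ c]) (use c z in simp)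
  have "z \<in> inf_jets Y" using z by (simp add: inf_jets_over_def)
  then show ?thesis
    using coordinate_expression_chart_indep[OF _ c _ z f] c' f by (simp add: derivation_of_def c'_def[symmetric])
qed

lemma derivation_of_expressed: "expressed_by Y A derivation_of \<nu>"
  using derivation_of_eq by (auto simp: expressed_by_def)

lemma derivation_of_sum:
  assumes f: "f \<in> R" and c: "c \<in> A" and z: "z \<in> inf_jets_over Y (bdom c)" and r: "smooth_of_order r c (total_space Y) f"
  shows "derivation_of f z = (\<Sum>k\<in>jet_indices Y r. \<nu> c k z * inf_partial c k f z)"
proof -
  have "z \<in> inf_jets_over Y (bdom c \<inter> total_space Y)"
    using z openin_subset[OF openin_bdom[OF atlas_chart[OF c]]] by (auto simp: inf_jets_over_def)
  then show ?thesis
    using derivation_of_eq[OF f c z] coordinate_expression_eq[OF atlas_chart[OF c] openin_topspace r] by simp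
qed

lemma component_smooth:
  assumes "c \<in> A" "k \<in> inf_jet_indices Y"
  shows "\<exists>r. \<forall>r'\<ge>r. smooth_of_order r' c (total_space Y) (\<nu> c k)"
proof -
  note ch = atlas_chart[OF assms(1)]
  have "\<nu> c k \<in> fin_order_functions Y (bdom c)"
    using PiE_mem[OF PiE_mem[OF \<nu>[unfolded local_components_def] assms(1)] assms(2)] .
  then obtain r where "smooth_of_order r c (bdom c) (\<nu> c k)"
    using fin_order_functions_smooth ch by metis
  then have "smooth_of_order r c (total_space Y) (\<nu> c k)" by (rule smooth_of_order_subset) auto
  then show ?thesis using smooth_of_order_mono[OF ch openin_topspace] by blast
qed

text \<open>The orders of all components together may be unbounded. On a function of order
  \<open>r\<close>, however, only the components with index in \<open>jet_indices Y r\<close> act,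
  finitely many in each of finitely many charts.\<close>

lemma derivation_of_in_ring:
  assumes f: "f \<in> R" shows "derivation_of f \<in> R"
proof -
  obtain r where r: "\<And>c r' U. is_bundle_chart Y c \<Longrightarrow> r \<le> r' \<Longrightarrow> smooth_of_order r' c U f"
    using ring_smooth[OF f] by metis
  let ?K = "jet_indices Y r"
  define s where "s c k = (SOME s. \<forall>r'\<ge>s. smooth_of_order r' c (total_space Y) (\<nu> c k))" for c k
  have s: "smooth_of_order r' c (total_space Y) (\<nu> c k)" if "c \<in> A" "k \<in> ?K" "s c k \<le> r'" for c k r'
    using someI_ex[OF component_smooth[OF that(1) subsetD[OF jet_indices_subset_inf that(2)]]] that(3)
    unfolding s_def by blast
  \<comment> \<open>The sum serves as a common upper bound of the orders \<open>s c k\<close>; the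
    summand \<open>r\<close> takes care of the derivatives of \<open>f\<close>.\<close>
  define N where "N = r + (\<Sum>c\<in>A. \<Sum>k\<in>?K. s c k)"
  have N: "s c k \<le> N" if "c \<in> A" "k \<in> ?K" for c k
  proof -
    have "s c k \<le> (\<Sum>k\<in>?K. s c k)" by (rule member_le_sum) (use that finite_jet_indices in auto)
    also have "\<dots> \<le> (\<Sum>c\<in>A. \<Sum>k\<in>?K. s c k)"
      by (rule member_le_sum[of c A "\<lambda>c. \<Sum>k\<in>?K. s c k"]) (use that finite_atlas in auto)
    finally show ?thesis by (simp add: N_def)
  qed
  show ?thesis
  proof (rule ringI)
    show "derivation_of f z = 0" if "z \<notin> inf_jets Y" for z using that f by (simp add: derivation_of_def)
    fix c assume c: "c \<in> A"
    note ch = atlas_chart[OF c]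
    have "smooth_of_order N c (total_space Y) (\<lambda>z. \<Sum>k\<in>?K. \<nu> c k z * inf_partial c k f z)"
    proof (intro smooth_of_order_sum[OF ch openin_topspace] smooth_of_order_mult[OF ch openin_topspace])
      fix k assume k: "k \<in> ?K"
      show "smooth_of_order N c (total_space Y) (\<nu> c k)" by (rule s[OF c k N[OF c k]])
      show "smooth_of_order N c (total_space Y) (inf_partial c k f)"
        using smooth_of_order_inf_partial[OF ch openin_topspace r[OF ch]] subsetD[OF jet_indices_subset_inf k]
        by (simp add: N_def)
    qed
    then show "smooth_of_order N c (total_space Y) (derivation_of f)"
      by (rule smooth_of_order_cong)
        (rule derivation_of_sum[OF f c _ r[OF ch order_refl]], auto simp: inf_jets_over_def)
  qed
qed

lemma derivation_of_derivation: "derivation_of \<in> derivations R"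
proof -
  have ext: "F = G" if "\<And>z. z \<notin> inf_jets Y \<Longrightarrow> F z = G z" "\<And>z c. c \<in> A \<Longrightarrow> z \<in> inf_jets_over Y (bdom c) \<Longrightarrow> F z = G z"
    for F G :: "('x, 'y) inf_jet \<Rightarrow> real"
    using that inf_jet_in_chart by (intro ext) metis
  have off: "derivation_of f z = 0" if "f \<in> R" "z \<notin> inf_jets Y" for f z using that by (simp add: derivation_of_def)
  have two: "\<exists>r. \<forall>c\<in>A. smooth_of_order r c (total_space Y) f \<and> smooth_of_order r c (total_space Y) g"
    if fg: "f \<in> R" "g \<in> R" for f g
  proof -
    obtain r s where r: "\<And>c r' U. is_bundle_chart Y c \<Longrightarrow> r \<le> r' \<Longrightarrow> smooth_of_order r' c U f"
      and s: "\<And>c r' U. is_bundle_chart Y c \<Longrightarrow> s \<le> r' \<Longrightarrow> smooth_of_order r' c U g"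
      using ring_smooth[OF fg(1)] ring_smooth[OF fg(2)] by metis
    show ?thesis using r s atlas_chart by (intro exI[of _ "max r s"]) auto
  qed
  have inT: "z \<in> inf_jets_over Y (bdom c \<inter> total_space Y)" if "c \<in> A" "z \<in> inf_jets_over Y (bdom c)" for c z
    using that openin_subset[OF openin_bdom[OF atlas_chart]] by (auto simp: inf_jets_over_def)
  note K = subsetD[OF jet_indices_subset_inf]
  have "derivation_of (\<lambda>z. f z + g z) = (\<lambda>z. derivation_of f z + derivation_of g z)" if fg: "f \<in> R" "g \<in> R" for f g
  proof -
    obtain r where r: "\<And>c. c \<in> A \<Longrightarrow> smooth_of_order r c (total_space Y) f" "\<And>c. c \<in> A \<Longrightarrow> smooth_of_order r c (total_space Y) g"
      using two[OF fg] by blast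
    show ?thesis
    proof (rule ext)
      fix z c assume c: "c \<in> A" and z: "z \<in> inf_jets_over Y (bdom c)"
      note ch = atlas_chart[OF c]
      show "derivation_of (\<lambda>z. f z + g z) z = derivation_of f z + derivation_of g z"
        unfolding derivation_of_sum[OF fg(1) c z r(1)[OF c]] derivation_of_sum[OF fg(2) c z r(2)[OF c]]
          derivation_of_sum[OF ring_add[OF fg] c z smooth_of_order_add[OF ch openin_topspace r(1)[OF c] r(2)[OF c]]]
          sum.distrib[symmetric]
        using inf_partial_add[OF ch openin_topspace r(1)[OF c] r(2)[OF c] inT[OF c z] K]
        by (intro sum.cong) (auto simp: algebra_simps)
    qed (use off fg ring_add in auto)
  qed
  moreover have mult: "derivation_of (\<lambda>z. f z * g z) = (\<lambda>z. derivation_of f z * g z + f z * derivation_of g z)"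
    if fg: "f \<in> R" "g \<in> R" for f g
  proof -
    obtain r where r: "\<And>c. c \<in> A \<Longrightarrow> smooth_of_order r c (total_space Y) f" "\<And>c. c \<in> A \<Longrightarrow> smooth_of_order r c (total_space Y) g"
      using two[OF fg] by blast
    show ?thesis
    proof (rule ext)
      fix z c assume c: "c \<in> A" and z: "z \<in> inf_jets_over Y (bdom c)"
      note ch = atlas_chart[OF c]
      show "derivation_of (\<lambda>z. f z * g z) z = derivation_of f z * g z + f z * derivation_of g z"
        unfolding derivation_of_sum[OF fg(1) c z r(1)[OF c]] derivation_of_sum[OF fg(2) c z r(2)[OF c]]
          derivation_of_sum[OF ring_mult[OF fg] c z smooth_of_order_mult[OF ch openin_topspace r(1)[OF c] r(2)[OF c]]]
          sum.distrib[symmetric] sum_distrib_left sum_distrib_right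
        using inf_partial_mult[OF ch openin_topspace r(1)[OF c] r(2)[OF c] inT[OF c z] K]
        by (intro sum.cong) (auto simp: algebra_simps)
    qed (use off fg ring_mult ring_zero in auto)
  qed
  moreover have "derivation_of (\<lambda>z. a * f z) = (\<lambda>z. a * derivation_of f z)" if f: "f \<in> R" for a f
  proof -
    obtain r where r: "\<And>c. c \<in> A \<Longrightarrow> smooth_of_order r c (total_space Y) f"
      using two[OF f f] by blast
    show ?thesis
    proof (rule ext)
      fix z c assume c: "c \<in> A" and z: "z \<in> inf_jets_over Y (bdom c)"
      note ch = atlas_chart[OF c]
      \<comment> \<open>A scalar multiple is treated as the product with a constant function, whose
        derivatives vanish.\<close>
      note k = smooth_of_order_const[OF ch openin_topspace, of r a]
      show "derivation_of (\<lambda>z. a * f z) z = a * derivation_of f z"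
        unfolding derivation_of_sum[OF f c z r[OF c]]
          derivation_of_sum[OF ring_cmult[OF f] c z smooth_of_order_mult[OF ch openin_topspace k r[OF c]]] sum_distrib_left
        using inf_partial_mult[OF ch openin_topspace k r[OF c] inT[OF c z] K] inf_partial_const[OF ch openin_topspace inT[OF c z] K]
        by (intro sum.cong) (auto simp: algebra_simps)
    qed (use off f ring_cmult in auto)
  qed
  ultimately show ?thesis
    using derivation_of_in_ring unfolding derivations_def by (auto simp: derivation_of_def)
qed

text \<open>For uniqueness, the expression determines \<upsilon> on the charts, which cover
  \<open>inf_jets Y\<close>; off that set members of \<open>R\<close> are zero, and off
  \<open>R\<close> derivations are \<open>undefined\<close>.\<close>

lemma ex1_derivation: "\<exists>!\<upsilon>. \<upsilon> \<in> derivations R \<and> expressed_by Y A \<upsilon> \<nu>"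
proof (rule ex1I[of _ derivation_of])
  show "derivation_of \<in> derivations R \<and> expressed_by Y A derivation_of \<nu>"
    using derivation_of_derivation derivation_of_expressed by simp
  fix \<upsilon> assume \<upsilon>: "\<upsilon> \<in> derivations R \<and> expressed_by Y A \<upsilon> \<nu>"
  then have P: "\<upsilon> \<in> R \<rightarrow>\<^sub>E R" "derivation_of \<in> R \<rightarrow>\<^sub>E R"
    using derivation_of_derivation by (auto simp: derivations_def)
  show "\<upsilon> = derivation_of"
  proof (rule PiE_ext[OF P])
    fix f assume f: "f \<in> R"
    show "\<upsilon> f = derivation_of f"
    proof
      fix z show "\<upsilon> f z = derivation_of f z"
      proof (cases "z \<in> inf_jets Y")
        case True
        then obtain c where "c \<in> A" "z \<in> inf_jets_over Y (bdom c)" using inf_jet_in_chart by blast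
        then show ?thesis using \<upsilon> f derivation_of_eq by (simp add: expressed_by_def)
      next
        case False
        show ?thesis
          unfolding ring_zero[OF PiE_mem[OF P(1) f] False] ring_zero[OF PiE_mem[OF P(2) f] False] ..
      qed
    qed
  qed
qed

end

end

theorem proposition3p2:
  fixes Y :: "('x, 'y) fibration" and V :: "'v manifold" and A :: "('x, 'y) bundle_chart set"
  assumes "fiber_bundle Y V"
    and "bundle_atlas Y A" and "finite A"
  shows "(\<forall>\<upsilon> \<in> derivations (fin_order_ring Y).
            \<exists>!\<nu>. \<nu> \<in> local_components Y A \<and> transformation_law Y A \<nu> \<and> expressed_by Y A \<upsilon> \<nu>) \<and>
         (\<forall>\<nu> \<in> local_components Y A. transformation_law Y A \<nu> \<longrightarrow>
            (\<exists>!\<upsilon>. \<upsilon> \<in> derivations (fin_order_ring Y) \<and> expressed_by Y A \<upsilon> \<nu>))"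
proof -
  interpret fibration_atlas Y V A
    using assms by unfold_locales
  show ?thesis
    using ex1_components ex1_derivation by simp
qed

end
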